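(* Let $(G/H,\mathbf{G})$ be a homogeneous spray manifold with a linear decomposition $\mathfrak{g}=\mathfrak{h}+\mathfrak{m}$, $c(t)$ any smooth curve on $G/H$ with $c(0)=o$ and nowhere-vanishing $\dot{c}(t)$, and $\overline{c}(t)$ the smooth curve on $G$ satisfying $\overline{c}(0)=e$, $c(t)=\overline{c}(t)\cdot o$ and $y(t)=(L_{\overline{c}(t)^{-1}})_*(\dot{\overline{c}}(t))\in\mathfrak{m}\backslash\{0\}$ for each $t$. Then for any smooth vector field $W(t)=(\overline{c}(t))_*(w(t))$ along $c(t)$ (with $w(t)\in\mathfrak{m}=T_o(G/H)$), we have $$D_{\dot{c}(t)}W(t)=(\overline{c}(t))_*\left(\tfrac{\mathrm{d}}{\mathrm{d}t}w(t)+N(y(t),w(t))+[y(t),w(t)]_\mathfrak{m}\right).$$ In particular, $W(t)$ is linearly parallel along $c(t)$ if and only if $w(t)$ satisfies $$\tfrac{\mathrm{d}}{\mathrm{d}t}w(t)+N(y(t),w(t))+[y(t),w(t)]_\mathfrak{m}=0$$ everywhere.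
   Context: A spray structure on a smooth manifold $M$ is a smooth tangent vector field $\mathbf{G}$ on the slit tangent bundle $TM\backslash 0$ which, in every standard local coordinate $(x^i,y^j)$ (i.e. $x=(x^i)\in M$, $y=y^j\partial_{x^j}\in T_xM$), has the form $\mathbf{G}=y^i\partial_{x^i}-2\mathbf{G}^i\partial_{y^i}$, where $\mathbf{G}^i(x,\lambda y)=\lambda^2\mathbf{G}^i(x,y)$ for all $\lambda>0$. Denote $\mathbf{N}^i_j=\frac{\partial}{\partial y^j}\mathbf{G}^i$. A smooth curve $c(t)$ with nowhere-vanishing $\dot c(t)$ is a geodesic if $(c(t),\dot c(t))$ is an integral curve of $\mathbf{G}$. For a smooth curve $c(t)$ with nowhere-vanishing $\dot c(t)$ and a smooth vector field $X(t)=X^i(t)\partial_{x^i}|_{c(t)}$ along it, the linearly covariant derivative is $D_{\dot c(t)}X(t)=(\frac{\mathrm{d}}{\mathrm{d}t}X^i(t)+\mathbf{N}^i_j(c(t),\dot c(t))X^j(t))\partial_{x^i}|_{c(t)}$; $X(t)$ is linearly parallel if $D_{\dot c(t)}X(t)=0$. Homogeneous spray manifold $(G/H,\mathbf{G})$: $G$ is a Lie group, $H$ a closed subgroup, $o=eH$, and $\mathbf{G}$ is a spray structure on $G/H$ with $(g_* )_*\mathbf{G}=\mathbf{G}$ for all $g\in G$. A linear decomposition $\mathfrak{g}=\mathfrak{h}+\mathfrak{m}$ is a direct sum of vector spaces ($\mathfrak{g}=\mathrm{Lie}(G)=T_eG$, $\mathfrak{h}=\mathrm{Lie}(H)$); $\mathfrak{m}$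 is identified with $T_o(G/H)$ via the differential at $e$ of $g\mapsto g\cdot o$; $[\cdot,\cdot]_\mathfrak{m}$ is the Lie bracket of $\mathfrak{g}$ followed by projection to $\mathfrak{m}$. $L_g$ is left translation on $G$, and $g_*$ (e.g. $(\overline{c}(t))_*$) is the tangent map of the action of $g$ on $G/H$. Fact: any smooth curve $c(t)$ on $G/H$ with $c(0)=o$ and nowhere-vanishing $\dot c(t)$ has a unique lift $\overline{c}(t)$ to $G$, defined around $t=0$, with $\overline{c}(0)=e$, $c(t)=\overline{c}(t)\cdot o$ and $(L_{\overline{c}(t)^{-1}})_*(\dot{\overline{c}}(t))\in\mathfrak{m}\backslash\{0\}$. The parameter $t$ ranges over an open interval containing $0$ on which both $c$ and $\overline{c}$ are defined. Spray vector field: for $y\in\mathfrak{m}\backslash\{0\}$ let $c_y(t)$ be the geodesic with $c_y(0)=o$, $\dot c_y(0)=y$, and $\overline{c}_y(t)$ its lift; then $\eta(y)=-\frac{\mathrm{d}}{\mathrm{d}t}|_{t=0}(L_{\overline{c}_y(t)^{-1}})_*(\dot{\overline{c}}_y(t))$, a smooth map $\mathfrak{m}\backslash\{0\}\to\mathfrak{m}$. Connection operator: $N:\mathfrak{m}\backslash\{0\}\times\mathfrak{m}\to\mathfrak{m}$, $N(y,u)=\frac12D\eta(y,u)-\frac12[y,u]_\mathfrak{m}$ with $D\eta(y,u)=\frac{\mathrm{d}}{\mathrm{d}t}|_{t=0}\eta(y+tu)$. *)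

theory Defs
  imports "HOL-Analysis.Analysis" "HOL-Algebra.Coset"
begin

section \<open>Smooth maps between Euclidean spaces\<close>

text \<open>On an open subset of a Euclidean space, \<open>ck_on k\<close> is the usual class of \<open>k\<close> times
  continuously differentiable maps. It is only ever applied to open sets.\<close>

primrec ck_on :: "nat \<Rightarrow> 'a::euclidean_space set \<Rightarrow> ('a \<Rightarrow> 'b::real_normed_vector) \<Rightarrow> bool" where
  "ck_on 0 S f \<longleftrightarrow> continuous_on S f"
| "ck_on (Suc k) S f \<longleftrightarrow> (\<forall>x\<in>S. f differentiable (at x)) \<and>
     (\<forall>v. ck_on k S (\<lambda>x. frechet_derivative f (at x) v))"

definition smooth_on :: "'a::euclidean_space set \<Rightarrow> ('a \<Rightarrow> 'b::real_normed_vector) \<Rightarrow> bool" where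
  "smooth_on S f \<longleftrightarrow> (\<forall>k. ck_on k S f)"


section \<open>Manifolds\<close>

text \<open>A chart is a domain together with a coordinate map, whose values off the domain are
  irrelevant. The atlas of a manifold need not be maximal; \<open>charts M\<close> is the maximal atlas
  that it generates, that is, the set of all local coordinate systems of \<open>M\<close>.\<close>

type_synonym ('p, 'e) chart = "'p set \<times> ('p \<Rightarrow> 'e)"

record ('p, 'e) manifold =
  mtop :: "'p topology"
  atlas :: "('p, 'e) chart set"

definition chart_inv :: "('p, 'e) chart \<Rightarrow> 'e \<Rightarrow> 'p" where
  "chart_inv \<kappa> = inv_into (fst \<kappa>) (snd \<kappa>)"

definition is_chart :: "'p topology \<Rightarrow> ('p, 'e::euclidean_space) chart \<Rightarrow> bool" where
  "is_chart T \<kappa> \<longleftrightarrow> openin T (fst \<kappa>) \<and> open (snd \<kappa> ` fst \<kappa>) \<and>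
     homeomorphic_map (subtopology T (fst \<kappa>)) (top_of_set (snd \<kappa> ` fst \<kappa>)) (snd \<kappa>)"

definition compatible :: "('p, 'e::euclidean_space) chart \<Rightarrow> ('p, 'e) chart \<Rightarrow> bool" where
  "compatible \<kappa> \<mu> \<longleftrightarrow>
     smooth_on (snd \<kappa> ` (fst \<kappa> \<inter> fst \<mu>)) (snd \<mu> \<circ> chart_inv \<kappa>) \<and>
     smooth_on (snd \<mu> ` (fst \<kappa> \<inter> fst \<mu>)) (snd \<kappa> \<circ> chart_inv \<mu>)"

definition smooth_manifold :: "('p, 'e::euclidean_space) manifold \<Rightarrow> bool" where
  "smooth_manifold M \<longleftrightarrow> Hausdorff_space (mtop M) \<and> second_countable (mtop M) \<and>
     (\<forall>\<kappa>\<in>atlas M. is_chart (mtop M) \<kappa>) \<and>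
     (\<Union>\<kappa>\<in>atlas M. fst \<kappa>) = topspace (mtop M) \<and>
     (\<forall>\<kappa>\<in>atlas M. \<forall>\<mu>\<in>atlas M. compatible \<kappa> \<mu>)"

definition charts :: "('p, 'e::euclidean_space) manifold \<Rightarrow> ('p, 'e) chart set" where
  "charts M = {\<kappa>. is_chart (mtop M) \<kappa> \<and> (\<forall>\<mu>\<in>atlas M. compatible \<kappa> \<mu>)}"

definition smooth_map ::
  "('p, 'e::euclidean_space) manifold \<Rightarrow> ('q, 'f::euclidean_space) manifold \<Rightarrow> ('p \<Rightarrow> 'q) \<Rightarrow> bool"
where
  "smooth_map M N f \<longleftrightarrow> continuous_map (mtop M) (mtop N) f \<and>
     (\<forall>\<kappa>\<in>atlas M. \<forall>\<mu>\<in>atlas N.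
        smooth_on (snd \<kappa> ` (fst \<kappa> \<inter> f -` fst \<mu>)) (snd \<mu> \<circ> f \<circ> chart_inv \<kappa>))"

definition euclid :: "'e::euclidean_space set \<Rightarrow> ('e, 'e) manifold" where
  "euclid S = \<lparr>mtop = top_of_set S, atlas = {(S, id)}\<rparr>"

definition open_submanifold :: "('p, 'e) manifold \<Rightarrow> 'p set \<Rightarrow> ('p, 'e) manifold" where
  "open_submanifold M W =
     \<lparr>mtop = subtopology (mtop M) W, atlas = (\<lambda>\<kappa>. (fst \<kappa> \<inter> W, snd \<kappa>)) ` atlas M\<rparr>"

definition prod_manifold ::
  "('p, 'e) manifold \<Rightarrow> ('q, 'f) manifold \<Rightarrow> ('p \<times> 'q, 'e \<times> 'f) manifold" where
  "prod_manifold M N = \<lparr>mtop = prod_topology (mtop M) (mtop N),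
     atlas = {(fst \<kappa> \<times> fst \<mu>, map_prod (snd \<kappa>) (snd \<mu>)) | \<kappa> \<mu>. \<kappa> \<in> atlas M \<and> \<mu> \<in> atlas N}\<rparr>"


section \<open>Tangent vectors\<close>

text \<open>Each point \<open>p\<close> has a fixed reference chart from the atlas, and the tangent space at \<open>p\<close>
  is identified with the model space \<open>'e\<close>: a tangent vector is given by its components in the
  reference chart at its base point. Its components in an arbitrary chart \<open>\<kappa>\<close> around \<open>p\<close> are
  then \<open>comps M \<kappa> p v\<close>.\<close>

definition base_chart :: "('p, 'e) manifold \<Rightarrow> 'p \<Rightarrow> ('p, 'e) chart" where
  "base_chart M p = (SOME \<kappa>. \<kappa> \<in> atlas M \<and> p \<in> fst \<kappa>)"

definition comps ::
  "('p, 'e::euclidean_space) manifold \<Rightarrow> ('p, 'e) chart \<Rightarrow> 'p \<Rightarrow> 'e \<Rightarrow> 'e" where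
  "comps M \<kappa> p v =
     frechet_derivative (snd \<kappa> \<circ> chart_inv (base_chart M p)) (at (snd (base_chart M p) p)) v"

definition tangent_map ::
  "('p, 'e::euclidean_space) manifold \<Rightarrow> ('q, 'f::euclidean_space) manifold
    \<Rightarrow> ('p \<Rightarrow> 'q) \<Rightarrow> 'p \<Rightarrow> 'e \<Rightarrow> 'f" where
  "tangent_map M N f p v =
     frechet_derivative (snd (base_chart N (f p)) \<circ> f \<circ> chart_inv (base_chart M p))
       (at (snd (base_chart M p) p)) v"

definition open_interval :: "real set \<Rightarrow> bool" where
  "open_interval J \<longleftrightarrow> open J \<and> is_interval J"

definition smooth_curve ::
  "('p, 'e::euclidean_space) manifold \<Rightarrow> real set \<Rightarrow> (real \<Rightarrow> 'p) \<Rightarrow> bool" where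
  "smooth_curve M J c \<longleftrightarrow> smooth_map (euclid J) M c"

definition velocity ::
  "('p, 'e::euclidean_space) manifold \<Rightarrow> (real \<Rightarrow> 'p) \<Rightarrow> real \<Rightarrow> 'e" where
  "velocity M c t = vector_derivative (snd (base_chart M (c t)) \<circ> c) (at t)"

text \<open>The standard local coordinates \<open>(x, y)\<close> on the tangent bundle induced by \<open>\<kappa>\<close>.\<close>

definition tangent_chart ::
  "('p, 'e::euclidean_space) manifold \<Rightarrow> ('p, 'e) chart \<Rightarrow> ('p \<times> 'e, 'e \<times> 'e) chart" where
  "tangent_chart M \<kappa> = (fst \<kappa> \<times> UNIV, \<lambda>(p, v). (snd \<kappa> p, comps M \<kappa> p v))"

definition tangent_bundle ::
  "('p, 'e::euclidean_space) manifold \<Rightarrow> ('p \<times> 'e, 'e \<times> 'e) manifold" where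
  "tangent_bundle M =
     \<lparr>mtop = topology_generated_by
        {fst (tangent_chart M \<kappa>) \<inter> snd (tangent_chart M \<kappa>) -` B | \<kappa> B. \<kappa> \<in> atlas M \<and> open B},
      atlas = tangent_chart M ` atlas M\<rparr>"

definition slit_tangent_bundle ::
  "('p, 'e::euclidean_space) manifold \<Rightarrow> ('p \<times> 'e, 'e \<times> 'e) manifold" where
  "slit_tangent_bundle M =
     open_submanifold (tangent_bundle M) (topspace (mtop M) \<times> (UNIV - {0}))"

definition tangent_lift ::
  "('p, 'e::euclidean_space) manifold \<Rightarrow> ('p \<Rightarrow> 'p) \<Rightarrow> 'p \<times> 'e \<Rightarrow> 'p \<times> 'e" where
  "tangent_lift M f = (\<lambda>(p, v). (f p, tangent_map M M f p v))"


section \<open>Vector fields\<close>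

definition field_comps ::
  "('p, 'e::euclidean_space) manifold \<Rightarrow> ('p, 'e) chart \<Rightarrow> ('p \<Rightarrow> 'e) \<Rightarrow> 'e \<Rightarrow> 'e" where
  "field_comps M \<kappa> X x = comps M \<kappa> (chart_inv \<kappa> x) (X (chart_inv \<kappa> x))"

definition smooth_vector_field ::
  "('p, 'e::euclidean_space) manifold \<Rightarrow> ('p \<Rightarrow> 'e) \<Rightarrow> bool" where
  "smooth_vector_field M X \<longleftrightarrow> (\<forall>\<kappa>\<in>atlas M. smooth_on (snd \<kappa> ` fst \<kappa>) (field_comps M \<kappa> X))"

definition vector_field_bracket ::
  "('p, 'e::euclidean_space) manifold \<Rightarrow> ('p \<Rightarrow> 'e) \<Rightarrow> ('p \<Rightarrow> 'e) \<Rightarrow> 'p \<Rightarrow> 'e" where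
  "vector_field_bracket M X Y p =
     (let \<kappa> = base_chart M p; x = snd \<kappa> p; \<xi> = field_comps M \<kappa> X; \<zeta> = field_comps M \<kappa> Y
      in frechet_derivative \<zeta> (at x) (\<xi> x) - frechet_derivative \<xi> (at x) (\<zeta> x))"

text \<open>Push-forward along a diffeomorphism of \<open>M\<close>.\<close>

definition push_forward ::
  "('p, 'e::euclidean_space) manifold \<Rightarrow> ('p \<Rightarrow> 'p) \<Rightarrow> ('p \<Rightarrow> 'e) \<Rightarrow> 'p \<Rightarrow> 'e" where
  "push_forward M F X q =
     (let p = inv_into (topspace (mtop M)) F q in tangent_map M M F p (X p))"

definition integral_curve ::
  "('p, 'e::euclidean_space) manifold \<Rightarrow> ('p \<Rightarrow> 'e) \<Rightarrow> real set \<Rightarrow> (real \<Rightarrow> 'p) \<Rightarrow> bool" where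
  "integral_curve M X J \<gamma> \<longleftrightarrow> smooth_curve M J \<gamma> \<and> (\<forall>t\<in>J. velocity M \<gamma> t = X (\<gamma> t))"

definition smooth_field_along ::
  "('p, 'e::euclidean_space) manifold \<Rightarrow> real set \<Rightarrow> (real \<Rightarrow> 'p) \<Rightarrow> (real \<Rightarrow> 'e) \<Rightarrow> bool" where
  "smooth_field_along M J c X \<longleftrightarrow> smooth_curve (tangent_bundle M) J (\<lambda>t. (c t, X t))"


section \<open>Sprays\<close>

text \<open>In the coordinates \<open>(x, y)\<close> induced by \<open>\<kappa>\<close>, a vector field \<open>S\<close> on the slit tangent bundle
  has a \<open>\<partial>\<^sub>x\<close>-part and a \<open>\<partial>\<^sub>y\<close>-part. The spray coefficients \<open>G\<^sup>i\<close> are defined by writing the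
  \<open>\<partial>\<^sub>y\<close>-part as \<open>- 2 G\<^sup>i \<partial>\<^sub>y\<^sub>i\<close>.\<close>

definition bundle_field_comps ::
  "('p, 'e::euclidean_space) manifold \<Rightarrow> ('p \<times> 'e \<Rightarrow> 'e \<times> 'e) \<Rightarrow> ('p, 'e) chart
    \<Rightarrow> 'e \<Rightarrow> 'e \<Rightarrow> 'e \<times> 'e" where
  "bundle_field_comps M S \<kappa> x y =
     field_comps (slit_tangent_bundle M) (tangent_chart M \<kappa>) S (x, y)"

definition spray_coeff ::
  "('p, 'e::euclidean_space) manifold \<Rightarrow> ('p \<times> 'e \<Rightarrow> 'e \<times> 'e) \<Rightarrow> ('p, 'e) chart
    \<Rightarrow> 'e \<Rightarrow> 'e \<Rightarrow> 'e" where
  "spray_coeff M S \<kappa> x y = (- 1/2) *\<^sub>R snd (bundle_field_comps M S \<kappa> x y)"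

definition spray ::
  "('p, 'e::euclidean_space) manifold \<Rightarrow> ('p \<times> 'e \<Rightarrow> 'e \<times> 'e) \<Rightarrow> bool" where
  "spray M S \<longleftrightarrow> smooth_vector_field (slit_tangent_bundle M) S \<and>
     (\<forall>\<kappa>\<in>charts M. \<forall>x\<in>snd \<kappa> ` fst \<kappa>. \<forall>y. y \<noteq> 0 \<longrightarrow>
        bundle_field_comps M S \<kappa> x y = (y, - 2 *\<^sub>R spray_coeff M S \<kappa> x y) \<and>
        (\<forall>r>0. spray_coeff M S \<kappa> x (r *\<^sub>R y) = r\<^sup>2 *\<^sub>R spray_coeff M S \<kappa> x y))"

text \<open>\<open>nonlin_conn M S \<kappa> x y u\<close> is the vector with components \<open>N\<^sup>i\<^sub>j(x, y) u\<^sup>j\<close>, where \<open>N\<^sup>i\<^sub>j\<close> is the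
  derivative of \<open>G\<^sup>i\<close> with respect to \<open>y\<^sup>j\<close>.\<close>

definition nonlin_conn ::
  "('p, 'e::euclidean_space) manifold \<Rightarrow> ('p \<times> 'e \<Rightarrow> 'e \<times> 'e) \<Rightarrow> ('p, 'e) chart
    \<Rightarrow> 'e \<Rightarrow> 'e \<Rightarrow> 'e \<Rightarrow> 'e" where
  "nonlin_conn M S \<kappa> x y u = frechet_derivative (spray_coeff M S \<kappa> x) (at y) u"

definition geodesic ::
  "('p, 'e::euclidean_space) manifold \<Rightarrow> ('p \<times> 'e \<Rightarrow> 'e \<times> 'e) \<Rightarrow> real set \<Rightarrow> (real \<Rightarrow> 'p) \<Rightarrow> bool"
where
  "geodesic M S J c \<longleftrightarrow> smooth_curve M J c \<and> (\<forall>t\<in>J. velocity M c t \<noteq> 0) \<and>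
     integral_curve (slit_tangent_bundle M) S J (\<lambda>t. (c t, velocity M c t))"

text \<open>The covariant derivative is the tangent vector at \<open>c t\<close> whose components in every chart
  around \<open>c t\<close> are given by the coordinate formula.\<close>

definition lin_cov_deriv ::
  "('p, 'e::euclidean_space) manifold \<Rightarrow> ('p \<times> 'e \<Rightarrow> 'e \<times> 'e) \<Rightarrow> (real \<Rightarrow> 'p)
    \<Rightarrow> (real \<Rightarrow> 'e) \<Rightarrow> real \<Rightarrow> 'e" where
  "lin_cov_deriv M S c X t =
     (THE Z. \<forall>\<kappa>\<in>charts M. c t \<in> fst \<kappa> \<longrightarrow>
        comps M \<kappa> (c t) Z =
          vector_derivative (\<lambda>s. comps M \<kappa> (c s) (X s)) (at t) +
          nonlin_conn M S \<kappa> (snd \<kappa> (c t)) (comps M \<kappa> (c t) (velocity M c t))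
            (comps M \<kappa> (c t) (X t)))"

definition linearly_parallel ::
  "('p, 'e::euclidean_space) manifold \<Rightarrow> ('p \<times> 'e \<Rightarrow> 'e \<times> 'e) \<Rightarrow> real set \<Rightarrow> (real \<Rightarrow> 'p)
    \<Rightarrow> (real \<Rightarrow> 'e) \<Rightarrow> bool" where
  "linearly_parallel M S J c X \<longleftrightarrow> (\<forall>t\<in>J. lin_cov_deriv M S c X t = 0)"


section \<open>Lie groups\<close>

definition lie_group :: "('g, 'z) monoid_scheme \<Rightarrow> ('g, 'a::euclidean_space) manifold \<Rightarrow> bool" where
  "lie_group G MG \<longleftrightarrow> group G \<and> smooth_manifold MG \<and> topspace (mtop MG) = carrier G \<and>
     smooth_map (prod_manifold MG MG) MG (\<lambda>(g, h). g \<otimes>\<^bsub>G\<^esub> h) \<and>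
     smooth_map MG MG (\<lambda>g. inv\<^bsub>G\<^esub> g)"

text \<open>The Lie algebra is the tangent space at \<open>\<one>\<close>, that is, the model space \<open>'a\<close>, with the
  bracket of left invariant vector fields.\<close>

definition left_invariant_field ::
  "('g, 'z) monoid_scheme \<Rightarrow> ('g, 'a::euclidean_space) manifold \<Rightarrow> 'a \<Rightarrow> 'g \<Rightarrow> 'a" where
  "left_invariant_field G MG u g = tangent_map MG MG (\<lambda>x. g \<otimes>\<^bsub>G\<^esub> x) \<one>\<^bsub>G\<^esub> u"

definition lie_bracket ::
  "('g, 'z) monoid_scheme \<Rightarrow> ('g, 'a::euclidean_space) manifold \<Rightarrow> 'a \<Rightarrow> 'a \<Rightarrow> 'a" where
  "lie_bracket G MG u v =
     vector_field_bracket MG (left_invariant_field G MG u) (left_invariant_field G MG v) \<one>\<^bsub>G\<^esub>"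

definition closed_subgroup ::
  "('g, 'z) monoid_scheme \<Rightarrow> ('g, 'a::euclidean_space) manifold \<Rightarrow> 'g set \<Rightarrow> bool" where
  "closed_subgroup G MG H \<longleftrightarrow> subgroup H G \<and> closedin (mtop MG) H"

text \<open>A closed subgroup is an embedded submanifold; its Lie algebra is its tangent space at
  \<open>\<one>\<close>, the set of the initial velocities of the smooth curves that run in \<open>H\<close>.\<close>

definition lie_subalgebra ::
  "('g, 'z) monoid_scheme \<Rightarrow> ('g, 'a::euclidean_space) manifold \<Rightarrow> 'g set \<Rightarrow> 'a set" where
  "lie_subalgebra G MG H =
     {velocity MG \<gamma> 0 | \<gamma> J. open_interval J \<and> 0 \<in> J \<and> smooth_curve MG J \<gamma> \<and>
        \<gamma> ` J \<subseteq> H \<and> \<gamma> 0 = \<one>\<^bsub>G\<^esub>}"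

definition left_velocity ::
  "('g, 'z) monoid_scheme \<Rightarrow> ('g, 'a::euclidean_space) manifold \<Rightarrow> (real \<Rightarrow> 'g) \<Rightarrow> real \<Rightarrow> 'a" where
  "left_velocity G MG \<gamma> t =
     tangent_map MG MG (\<lambda>x. inv\<^bsub>G\<^esub> (\<gamma> t) \<otimes>\<^bsub>G\<^esub> x) (\<gamma> t) (velocity MG \<gamma> t)"


section \<open>Homogeneous spaces\<close>

text \<open>Points of \<open>G/H\<close> are left cosets, the group element \<open>g\<close> acts by \<open>x \<mapsto> g <# x\<close>, the base
  point is the coset \<open>H\<close>, and the projection is \<open>g \<mapsto> g <# H\<close>. The manifold structure on
  \<open>G/H\<close> is characterised (Warner, Foundations of Differentiable Manifolds and Lie Groups,
  Theorem 3.58) as the unique one over the quotient topology for which the projection is smooth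
  and has smooth local sections around every point.\<close>

definition coset_manifold ::
  "('g, 'z) monoid_scheme \<Rightarrow> ('g, 'a::euclidean_space) manifold \<Rightarrow> 'g set
    \<Rightarrow> ('g set, 'e::euclidean_space) manifold \<Rightarrow> bool" where
  "coset_manifold G MG H M \<longleftrightarrow> smooth_manifold M \<and>
     topspace (mtop M) = (\<lambda>g. g <#\<^bsub>G\<^esub> H) ` carrier G \<and>
     quotient_map (mtop MG) (mtop M) (\<lambda>g. g <#\<^bsub>G\<^esub> H) \<and>
     smooth_map MG M (\<lambda>g. g <#\<^bsub>G\<^esub> H) \<and>
     (\<forall>p\<in>topspace (mtop M). \<exists>W s. openin (mtop M) W \<and> p \<in> W \<and>
        smooth_map (open_submanifold M W) MG s \<and> (\<forall>q\<in>W. s q <#\<^bsub>G\<^esub> H = q))"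

definition invariant_spray ::
  "('g, 'z) monoid_scheme \<Rightarrow> ('g set, 'e::euclidean_space) manifold
    \<Rightarrow> ('g set \<times> 'e \<Rightarrow> 'e \<times> 'e) \<Rightarrow> bool" where
  "invariant_spray G M S \<longleftrightarrow> spray M S \<and>
     (\<forall>g\<in>carrier G. \<forall>z\<in>topspace (mtop (slit_tangent_bundle M)).
        push_forward (slit_tangent_bundle M) (tangent_lift M (\<lambda>x. g <#\<^bsub>G\<^esub> x)) S z = S z)"

definition homogeneous_spray_manifold ::
  "('g, 'z) monoid_scheme \<Rightarrow> ('g, 'a::euclidean_space) manifold \<Rightarrow> 'g set
    \<Rightarrow> ('g set, 'e::euclidean_space) manifold \<Rightarrow> ('g set \<times> 'e \<Rightarrow> 'e \<times> 'e) \<Rightarrow> bool" where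
  "homogeneous_spray_manifold G MG H M S \<longleftrightarrow>
     lie_group G MG \<and> closed_subgroup G MG H \<and> coset_manifold G MG H M \<and> invariant_spray G M S"

definition linear_decomposition ::
  "('g, 'z) monoid_scheme \<Rightarrow> ('g, 'a::euclidean_space) manifold \<Rightarrow> 'g set \<Rightarrow> 'a set \<Rightarrow> bool" where
  "linear_decomposition G MG H \<mm> \<longleftrightarrow> subspace \<mm> \<and> lie_subalgebra G MG H \<inter> \<mm> = {0} \<and>
     (\<forall>u. \<exists>a\<in>lie_subalgebra G MG H. \<exists>b\<in>\<mm>. u = a + b)"

definition proj_m ::
  "('g, 'z) monoid_scheme \<Rightarrow> ('g, 'a::euclidean_space) manifold \<Rightarrow> 'g set \<Rightarrow> 'a set \<Rightarrow> 'a \<Rightarrow> 'a" where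
  "proj_m G MG H \<mm> u = (THE b. b \<in> \<mm> \<and> u - b \<in> lie_subalgebra G MG H)"

definition bracket_m ::
  "('g, 'z) monoid_scheme \<Rightarrow> ('g, 'a::euclidean_space) manifold \<Rightarrow> 'g set \<Rightarrow> 'a set
    \<Rightarrow> 'a \<Rightarrow> 'a \<Rightarrow> 'a" where
  "bracket_m G MG H \<mm> u v = proj_m G MG H \<mm> (lie_bracket G MG u v)"

text \<open>The identification of \<open>\<mm>\<close> with the tangent space of \<open>G/H\<close> at the base point.\<close>

definition iota ::
  "('g, 'z) monoid_scheme \<Rightarrow> ('g, 'a::euclidean_space) manifold \<Rightarrow> 'g set
    \<Rightarrow> ('g set, 'e::euclidean_space) manifold \<Rightarrow> 'a \<Rightarrow> 'e" where
  "iota G MG H M u = tangent_map MG M (\<lambda>g. g <#\<^bsub>G\<^esub> H) \<one>\<^bsub>G\<^esub> u"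

definition m_lift ::
  "('g, 'z) monoid_scheme \<Rightarrow> ('g, 'a::euclidean_space) manifold \<Rightarrow> 'g set \<Rightarrow> 'a set
    \<Rightarrow> real set \<Rightarrow> (real \<Rightarrow> 'g set) \<Rightarrow> (real \<Rightarrow> 'g) \<Rightarrow> bool" where
  "m_lift G MG H \<mm> J c cbar \<longleftrightarrow> smooth_curve MG J cbar \<and> cbar 0 = \<one>\<^bsub>G\<^esub> \<and>
     (\<forall>t\<in>J. c t = cbar t <#\<^bsub>G\<^esub> H \<and> left_velocity G MG cbar t \<in> \<mm> - {0})"


section \<open>Spray vector field and connection operator\<close>

definition spray_vector ::
  "('g, 'z) monoid_scheme \<Rightarrow> ('g, 'a::euclidean_space) manifold \<Rightarrow> 'g set
    \<Rightarrow> ('g set, 'e::euclidean_space) manifold \<Rightarrow> ('g set \<times> 'e \<Rightarrow> 'e \<times> 'e) \<Rightarrow> 'a set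
    \<Rightarrow> 'a \<Rightarrow> 'a" where
  "spray_vector G MG H M S \<mm> y =
     (THE z. \<exists>J c cbar. open_interval J \<and> 0 \<in> J \<and> geodesic M S J c \<and> c 0 = H \<and>
        velocity M c 0 = iota G MG H M y \<and> m_lift G MG H \<mm> J c cbar \<and>
        z = - vector_derivative (left_velocity G MG cbar) (at 0))"

definition conn_op ::
  "('g, 'z) monoid_scheme \<Rightarrow> ('g, 'a::euclidean_space) manifold \<Rightarrow> 'g set
    \<Rightarrow> ('g set, 'e::euclidean_space) manifold \<Rightarrow> ('g set \<times> 'e \<Rightarrow> 'e \<times> 'e) \<Rightarrow> 'a set
    \<Rightarrow> 'a \<Rightarrow> 'a \<Rightarrow> 'a" where
  "conn_op G MG H M S \<mm> y u =
     (1/2) *\<^sub>R vector_derivative (\<lambda>t. spray_vector G MG H M S \<mm> (y + t *\<^sub>R u)) (at 0)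
     - (1/2) *\<^sub>R bracket_m G MG H \<mm> y u"

end

theory Submission
  imports Defs
begin

text \<open>The theorem is a computation in coordinates, arranged so that everything is pulled back to one chart
\<open>\<phi>\<close> of the group around the identity; \<open>e\<close> denotes its inverse and \<open>x0 = \<phi> 1\<close>. For \<open>g\<close> in \<open>G\<close>
and a chart \<open>\<kappa>\<close> of \<open>G/H\<close> around \<open>g H\<close> consider \<open>\<Psi>(x, x') = \<kappa> (g \<cdot> e x \<cdot> e x' \<cdot> H)\<close>. The
derivative of \<open>\<Psi>\<close> in \<open>x'\<close> at \<open>(x0, x0)\<close> is a linear map \<open>P\<close>, the coordinate form of
\<open>u \<mapsto> g\<^sub>* (\<iota> u)\<close>; the mixed second derivative, first in \<open>x\<close> along \<open>a\<close> and then in \<open>x'\<close> along \<open>u\<close>, is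
a bilinear map \<open>B(a, u)\<close>. Three facts about \<open>P\<close> and \<open>B\<close> carry the proof.

First, if \<open>\<gamma>\<close> is a curve in \<open>G\<close> with left velocity \<open>Y\<close>, then near time \<open>t\<close> the coordinates of
\<open>\<gamma>\<^sub>* (\<iota> w)\<close> are the \<open>x'\<close>-derivative of \<open>\<Psi>\<close> (taken for \<open>g = \<gamma> t\<close>) at \<open>(k, x0)\<close>, applied to \<open>w\<close>, where
\<open>k\<close> is the coordinate of \<open>\<gamma>(t)\<inverse> \<gamma>\<close>. Since \<open>k' = Y\<close> at time \<open>t\<close>, their derivative is
\<open>B(Y, w) + P w'\<close> (lemma \<open>field_derivative\<close>).

Second, \<open>B(a, b) - B(b, a) = P [a, b]\<close> (lemma \<open>B_antisym\<close>): \<open>\<Psi>\<close> is a function of \<open>x\<close> composed with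
the multiplication, the second derivative of that function is symmetric, and what is left over is
the commutator of left invariant fields.

Third, invariance of the spray. If \<open>\<tau>\<close> is the action of \<open>g\<close> in charts, the spray coefficients satisfy
\<open>2 G (\<tau> x, D\<tau> w) = 2 D\<tau> (G (x, w)) - D\<^sup>2\<tau> (w, w)\<close> (lemma \<open>spray_transform\<close>). The map \<open>\<Psi>\<close> for \<open>g\<close> is
\<open>\<tau>\<close> after the map \<open>\<Psi>\<close> for the identity, so \<open>B(y, y)\<close> changes by the same second order term with the opposite sign, and
\<open>2 G (P y) + B(y, y) = P (\<eta> y)\<close> for a map \<open>\<eta>\<close> that depends neither on \<open>g\<close> nor on the chart
(lemma \<open>spray_coeff_eq_eta\<close>). With \<open>w = Y\<close> the first fact then says that \<open>\<gamma> H\<close> is a geodesic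
exactly if \<open>Y' = - \<eta> Y\<close> (lemma \<open>geodesic_equation_iff\<close>). So \<open>\<eta>\<close> is the spray vector field, as soon as
every nonzero \<open>y\<close> in \<open>\<mm>\<close> is the initial velocity of some geodesic that has a lift; this geodesic comes from solving
an ordinary differential equation on \<open>G\<close> and \<open>\<mm>\<close> (lemma \<open>geodesic_lift_exists\<close>).

Differentiating the third identity in \<open>y\<close> along \<open>w\<close> gives
\<open>2 N (P y, P w) = P (D\<eta> (y, w)) - B(y, w) - B(w, y)\<close>. Adding half of this to \<open>B(y, w) + P w'\<close> leaves
\<open>P (w' + D\<eta> (y, w) / 2 + [y, w] / 2)\<close>, which is the claimed formula. The chart was arbitrary, so
the computation also shows that the coordinate expressions define one tangent vector. The
equivalence for parallel fields follows because \<open>\<gamma>\<^sub>* \<circ> \<iota>\<close> is injective on \<open>\<mm>\<close>.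

Smooth maps out of Euclidean spaces into a manifold, called plots below, replace most uses of charts:
they are closed under multiplication, inversion, projection and the action, they lift along the local
sections of the projection, and tangent maps act on their derivatives by composition.\<close>

section \<open>Calculus of smooth maps between Euclidean spaces\<close>

abbreviation fd :: "('a::real_normed_vector \<Rightarrow> 'b::real_normed_vector) \<Rightarrow> 'a \<Rightarrow> 'a \<Rightarrow> 'b" where
  "fd f x v \<equiv> frechet_derivative f (at x) v"

lemma fd_eqI: "(f has_derivative f') (at x) \<Longrightarrow> fd f x = f'"
  by (metis frechet_derivative_at)

lemma fd_cong_open:
  assumes "open S" "x \<in> S" "\<And>x. x \<in> S \<Longrightarrow> f x = g x" "f differentiable (at x)"
  shows "g differentiable (at x)" "fd g x = fd f x"
proof -
  show "g differentiable (at x)"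
    using assms unfolding differentiable_def
    by (metis has_derivative_transform_within_open)
  show "fd g x = fd f x"
    using frechet_derivative_transform_within_open[OF assms(4,1,2,3)] by simp
qed

lemma ck_on_cong:
  assumes "open S" "\<And>x. x \<in> S \<Longrightarrow> f x = g x" "ck_on k S f"
  shows "ck_on k S g"
  using assms(2,3)
proof (induction k arbitrary: f g)
  case 0
  then show ?case using continuous_on_cong[of S S f g] by simp
next
  case (Suc k)
  have d: "f differentiable (at x)" if "x \<in> S" for x
    using Suc.prems that by simp
  have "g differentiable (at x)" "fd g x = fd f x" if "x \<in> S" for x
    using fd_cong_open[OF assms(1) that Suc.prems(1) d[OF that]] by auto
  moreover have "ck_on k S (\<lambda>x. fd f x v)" for v
    using Suc.prems(2) by simp
  ultimately show ?case
    using Suc.IH[of "\<lambda>x. fd f x v" "\<lambda>x. fd g x v" for v] by auto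
qed

lemma ck_on_subset: "ck_on k S f \<Longrightarrow> T \<subseteq> S \<Longrightarrow> ck_on k T f"
  by (induction k arbitrary: f) (auto intro: continuous_on_subset)

lemma ck_on_Suc_imp: "ck_on (Suc k) S f \<Longrightarrow> ck_on k S f"
proof (induction k arbitrary: f)
  case 0
  then show ?case
    by (auto intro!: continuous_at_imp_continuous_on dest: differentiable_imp_continuous_within)
next
  case (Suc k)
  have "ck_on (Suc k) S (\<lambda>x. fd f x v)" for v
    using Suc.prems by simp
  then show ?case using Suc.IH Suc.prems by simp
qed

lemma ck_on_const: "ck_on k S (\<lambda>x. c)"
  by (induction k arbitrary: c) auto

lemma ck_on_add: "open S \<Longrightarrow> ck_on k S f \<Longrightarrow> ck_on k S g \<Longrightarrow> ck_on k S (\<lambda>x. f x + g x)"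
proof (induction k arbitrary: f g)
  case 0
  then show ?case by (auto intro: continuous_intros)
next
  case (Suc k)
  have e: "fd (\<lambda>x. f x + g x) x = (\<lambda>v. fd f x v + fd g x v)" if "x \<in> S" for x
    using Suc.prems that
    by (intro frechet_derivative_at[symmetric] has_derivative_add)
       (auto simp: frechet_derivative_works[symmetric])
  have "ck_on k S (\<lambda>x. fd (\<lambda>x. f x + g x) x v)" for v
    by (rule ck_on_cong[OF Suc.prems(1), of "\<lambda>x. fd f x v + fd g x v"])
       (use e Suc in auto)
  then show ?case using Suc.prems by auto
qed

lemma ck_on_sum:
  assumes "open S" "finite I" "\<And>i. i \<in> I \<Longrightarrow> ck_on k S (f i)"
  shows "ck_on k S (\<lambda>x. \<Sum>i\<in>I. f i x)"
  using assms(2,3) by (induction I) (auto intro: ck_on_const ck_on_add[OF assms(1)])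

lemma ck_on_bounded_linear:
  assumes L: "bounded_linear L" and "open S"
  shows "ck_on k S f \<Longrightarrow> ck_on k S (\<lambda>x. L (f x))"
proof (induction k arbitrary: f)
  case 0
  then show ?case using L
    by (auto intro: bounded_linear.continuous_on)
next
  case (Suc k)
  have h: "((\<lambda>x. L (f x)) has_derivative (\<lambda>v. L (fd f x v))) (at x)" if "x \<in> S" for x
    using Suc.prems that
    by (intro bounded_linear.has_derivative[OF L]) (auto simp: frechet_derivative_works[symmetric])
  have e: "fd (\<lambda>x. L (f x)) x = (\<lambda>v. L (fd f x v))" if "x \<in> S" for x
    using h[OF that] by (rule fd_eqI)
  have "ck_on k S (\<lambda>x. fd (\<lambda>x. L (f x)) x v)" for v
    by (rule ck_on_cong[OF assms(2), of "\<lambda>x. L (fd f x v)"])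
       (use e Suc in auto)
  then show ?case using h by (auto simp: differentiable_def)
qed

lemma ck_on_bilinear:
  assumes B: "bounded_bilinear B" and "open S"
  shows "ck_on k S f \<Longrightarrow> ck_on k S g \<Longrightarrow> ck_on k S (\<lambda>x. B (f x) (g x))"
proof (induction k arbitrary: f g)
  case 0
  then show ?case using B
    by (auto intro: bounded_bilinear.continuous_on)
next
  case (Suc k)
  have h: "((\<lambda>x. B (f x) (g x)) has_derivative (\<lambda>v. B (f x) (fd g x v) + B (fd f x v) (g x))) (at x)"
    if "x \<in> S" for x
    using Suc.prems that
    by (intro bounded_bilinear.FDERIV[OF B]) (auto simp: frechet_derivative_works[symmetric])
  have e: "fd (\<lambda>x. B (f x) (g x)) x = (\<lambda>v. B (f x) (fd g x v) + B (fd f x v) (g x))"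
    if "x \<in> S" for x
    using h[OF that] by (rule fd_eqI)
  have "ck_on k S (\<lambda>x. fd (\<lambda>x. B (f x) (g x)) x v)" for v
  proof (rule ck_on_cong[OF assms(2), of "\<lambda>x. B (f x) (fd g x v) + B (fd f x v) (g x)"])
    have "ck_on k S (\<lambda>x. fd f x v)" "ck_on k S (\<lambda>x. fd g x v)"
      using Suc.prems by simp_all
    then show "ck_on k S (\<lambda>x. B (f x) (fd g x v) + B (fd f x v) (g x))"
      using Suc.prems[THEN ck_on_Suc_imp] by (intro ck_on_add[OF assms(2)] Suc.IH)
  qed (simp add: e)
  then show ?case using h by (auto simp: differentiable_def)
qed

lemma has_derivative_fd: "f differentiable (at x) \<Longrightarrow> (f has_derivative fd f x) (at x)"
  by (simp add: frechet_derivative_works[symmetric])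

lemma linear_fd: "f differentiable (at x) \<Longrightarrow> linear (fd f x)"
  by (rule linear_frechet_derivative)

text \<open>With it, the derivative of a map at a moving point in a moving direction becomes a finite sum of
products, each built from a derivative in a fixed direction, for which \<open>ck_on\<close> gives information.\<close>

lemma linear_basis_sum:
  fixes x :: "'a::euclidean_space"
  assumes "linear h"
  shows "h x = (\<Sum>b\<in>Basis. (x \<bullet> b) *\<^sub>R h b)"
proof -
  have "h x = h (\<Sum>b\<in>Basis. (x \<bullet> b) *\<^sub>R b)" by (simp add: euclidean_representation)
  then show ?thesis by (simp add: linear_sum[OF assms] linear_scale[OF assms])
qed

text \<open>By the chain rule the derivative of the composition is a sum over the basis of products of directional
derivatives of \<open>f\<close> along \<open>g\<close> with coefficients of the derivative of \<open>g\<close>. The former fall under the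
induction hypothesis, which is why \<open>f\<close> has to be generalised.\<close>

lemma ck_on_compose:
  fixes g :: "'a::euclidean_space \<Rightarrow> 'b::euclidean_space" and f :: "'b \<Rightarrow> 'c::real_normed_vector"
  assumes "open S" "open T" "g ` S \<subseteq> T"
  shows "ck_on k T f \<Longrightarrow> ck_on k S g \<Longrightarrow> ck_on k S (\<lambda>x. f (g x))"
proof (induction k arbitrary: f)
  case 0
  then show ?case using assms(3)
    by (auto intro: continuous_on_compose2)
next
  case (Suc k)
  have d: "g differentiable (at x)" "f differentiable (at (g x))" if "x \<in> S" for x
    using Suc.prems that assms(3) by auto
  have h: "((\<lambda>x. f (g x)) has_derivative (\<lambda>v. fd f (g x) (fd g x v))) (at x)" if "x \<in> S" for x
    using diff_chain_at[OF has_derivative_fd[OF d(1)[OF that]] has_derivative_fd[OF d(2)[OF that]]]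
    by (simp add: o_def)
  have e: "fd (\<lambda>x. f (g x)) x v = (\<Sum>b\<in>Basis. (fd g x v \<bullet> b) *\<^sub>R fd f (g x) b)" if "x \<in> S" for x v
    using frechet_derivative_at[OF h[OF that], symmetric]
      linear_basis_sum[OF linear_fd[OF d(2)[OF that]], of "fd g x v"] by simp
  have "ck_on k S (\<lambda>x. fd (\<lambda>x. f (g x)) x v)" for v
  proof (rule ck_on_cong[OF assms(1), of "\<lambda>x. \<Sum>b\<in>Basis. (fd g x v \<bullet> b) *\<^sub>R fd f (g x) b"])
    show "ck_on k S (\<lambda>x. \<Sum>b\<in>Basis. (fd g x v \<bullet> b) *\<^sub>R fd f (g x) b)"
    proof (intro ck_on_sum[OF assms(1)] ck_on_bilinear[OF bounded_bilinear_scaleR assms(1)])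
      fix b :: 'b
      show "ck_on k S (\<lambda>x. fd g x v \<bullet> b)"
        using ck_on_bounded_linear[OF bounded_linear_inner_left assms(1), of k "\<lambda>x. fd g x v" b] Suc.prems by simp
      show "ck_on k S (\<lambda>x. fd f (g x) b)"
        using Suc.IH[of "\<lambda>y. fd f y b"] Suc.prems ck_on_Suc_imp by auto
    qed simp
  qed (simp add: e)
  then show ?case using h by (auto simp: differentiable_def)
qed

lemma ck_on_Pair: "open S \<Longrightarrow> ck_on k S f \<Longrightarrow> ck_on k S g \<Longrightarrow> ck_on k S (\<lambda>x. (f x, g x))"
proof (induction k arbitrary: f g)
  case 0
  then show ?case by (auto intro: continuous_intros)
next
  case (Suc k)
  have h: "((\<lambda>x. (f x, g x)) has_derivative (\<lambda>v. (fd f x v, fd g x v))) (at x)" if "x \<in> S" for x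
    using Suc.prems that
    by (intro has_derivative_Pair) (auto simp: frechet_derivative_works[symmetric])
  have e: "fd (\<lambda>x. (f x, g x)) x = (\<lambda>v. (fd f x v, fd g x v))" if "x \<in> S" for x
    using h[OF that] by (rule fd_eqI)
  have "ck_on k S (\<lambda>x. fd (\<lambda>x. (f x, g x)) x v)" for v
    by (rule ck_on_cong[OF Suc.prems(1), of "\<lambda>x. (fd f x v, fd g x v)"])
       (use e Suc in auto)
  then show ?case using h by (auto simp: differentiable_def)
qed

lemma ck_on_ident: "open S \<Longrightarrow> ck_on k S (\<lambda>x. x)"
  by (cases k) (auto simp: ck_on_const)

lemma smooth_on_subset: "smooth_on S f \<Longrightarrow> T \<subseteq> S \<Longrightarrow> smooth_on T f"
  using ck_on_subset unfolding smooth_on_def by blast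

text \<open>Smoothness as a property of a germ. Chart domains and the sets on which compositions are defined then
disappear behind \<open>eventually\<close>.\<close>

definition smooth_near :: "'a::euclidean_space \<Rightarrow> ('a \<Rightarrow> 'b::real_normed_vector) \<Rightarrow> bool" where
  "smooth_near x f \<longleftrightarrow> (\<exists>U. open U \<and> x \<in> U \<and> smooth_on U f)"

lemma smooth_nearI: "open U \<Longrightarrow> x \<in> U \<Longrightarrow> smooth_on U f \<Longrightarrow> smooth_near x f"
  by (auto simp: smooth_near_def)

lemma ck_on_local:
  assumes "open S" "\<And>x. x \<in> S \<Longrightarrow> \<exists>U. open U \<and> x \<in> U \<and> ck_on k U f"
  shows "ck_on k S f"
  using assms(2)
proof (induction k arbitrary: f)
  case 0
  then show ?case
    by (metis ck_on.simps(1) continuous_at_imp_continuous_on continuous_on_eq_continuous_at)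
next
  case (Suc k)
  have "f differentiable (at x)" if "x \<in> S" for x
    using Suc.prems[OF that] by auto
  moreover have "ck_on k S (\<lambda>x. fd f x v)" for v
    using Suc.prems by (intro Suc.IH) fastforce
  ultimately show ?case by simp
qed

lemma smooth_on_local:
  assumes "open S" "\<And>x. x \<in> S \<Longrightarrow> smooth_near x f"
  shows "smooth_on S f"
  unfolding smooth_on_def
  using assms by (intro allI ck_on_local) (auto simp: smooth_near_def smooth_on_def)

lemma smooth_near_eventually:
  assumes "smooth_near x f" shows "\<forall>\<^sub>F y in nhds x. smooth_near y f"
proof -
  obtain U where "open U" "x \<in> U" "smooth_on U f" using assms by (auto simp: smooth_near_def)
  then show ?thesis by (auto simp: eventually_nhds smooth_near_def)
qed

lemma smooth_near_cong:
  assumes "smooth_near x f" "\<forall>\<^sub>F y in nhds x. f y = g y"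
  shows "smooth_near x g"
proof -
  obtain U where U: "open U" "x \<in> U" "smooth_on U f" using assms by (auto simp: smooth_near_def)
  obtain V where V: "open V" "x \<in> V" "\<And>y. y \<in> V \<Longrightarrow> f y = g y"
    using assms(2) by (auto simp: eventually_nhds)
  have "ck_on k (U \<inter> V) g" for k
    by (rule ck_on_cong[of _ f]) (use U V in \<open>auto simp: smooth_on_def intro: ck_on_subset\<close>)
  then show ?thesis using U V by (auto intro!: smooth_nearI[of "U \<inter> V"] simp: smooth_on_def)
qed

lemma smooth_near_differentiable: "smooth_near x f \<Longrightarrow> f differentiable (at x)"
  unfolding smooth_near_def smooth_on_def by (metis ck_on.simps(2))

lemma smooth_near_has_derivative: "smooth_near x f \<Longrightarrow> (f has_derivative fd f x) (at x)"
  by (simp add: has_derivative_fd smooth_near_differentiable)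

lemma smooth_near_linear: "smooth_near x f \<Longrightarrow> linear (fd f x)"
  by (simp add: linear_fd smooth_near_differentiable)

lemma smooth_near_isCont: "smooth_near x f \<Longrightarrow> isCont f x"
  by (simp add: differentiable_imp_continuous_within smooth_near_differentiable)

lemma smooth_near_tendsto: "smooth_near x f \<Longrightarrow> filterlim f (nhds (f x)) (nhds x)"
  using smooth_near_isCont isCont_def tendsto_nhds_iff by blast

lemma smooth_near_compose:
  fixes g :: "'a::euclidean_space \<Rightarrow> 'b::euclidean_space"
  assumes "smooth_near (g x) f" "smooth_near x g"
  shows "smooth_near x (\<lambda>x. f (g x))"
proof -
  obtain T where T: "open T" "g x \<in> T" "smooth_on T f" using assms by (auto simp: smooth_near_def)
  obtain U where U: "open U" "x \<in> U" "smooth_on U g" using assms by (auto simp: smooth_near_def)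
  have c: "continuous_on U g" using U(3) by (metis ck_on.simps(1) smooth_on_def)
  have o: "open (U \<inter> g -` T)"
    using c U(1) T(1) by (simp add: continuous_on_open_vimage Int_commute)
  have "ck_on k (U \<inter> g -` T) (\<lambda>x. f (g x))" for k
    by (rule ck_on_compose[OF o T(1)]) (use T U in \<open>auto simp: smooth_on_def intro: ck_on_subset\<close>)
  then show ?thesis using o T U by (auto intro!: smooth_nearI[OF o] simp: smooth_on_def)
qed

lemma smooth_near_Int:
  assumes "smooth_near x f" "smooth_near x g"
  obtains U where "open U" "x \<in> U" "smooth_on U f" "smooth_on U g"
proof -
  obtain T where T: "open T" "x \<in> T" "smooth_on T f" using assms by (auto simp: smooth_near_def)
  obtain U where U: "open U" "x \<in> U" "smooth_on U g" using assms by (auto simp: smooth_near_def)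
  show thesis using T U by (intro that[of "T \<inter> U"]) (auto intro: smooth_on_subset)
qed

lemma smooth_near_Pair:
  assumes "smooth_near x f" "smooth_near x g"
  shows "smooth_near x (\<lambda>x. (f x, g x))"
  by (rule smooth_near_Int[OF assms]) (auto simp: smooth_on_def intro!: smooth_nearI ck_on_Pair)

lemma smooth_near_add:
  assumes "smooth_near x f" "smooth_near x g"
  shows "smooth_near x (\<lambda>x. f x + g x)"
  by (rule smooth_near_Int[OF assms]) (auto simp: smooth_on_def intro!: smooth_nearI ck_on_add)

lemma smooth_near_bilinear:
  assumes "bounded_bilinear B" "smooth_near x f" "smooth_near x g"
  shows "smooth_near x (\<lambda>x. B (f x) (g x))"
  by (rule smooth_near_Int[OF assms(2,3)])
     (auto simp: smooth_on_def intro!: smooth_nearI ck_on_bilinear[OF assms(1)])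

lemma smooth_near_bounded_linear:
  assumes "bounded_linear L" "smooth_near x f"
  shows "smooth_near x (\<lambda>x. L (f x))"
  using assms(2) by (auto simp: smooth_near_def smooth_on_def intro: ck_on_bounded_linear[OF assms(1)])

lemma smooth_near_linear_map:
  fixes L :: "'a::euclidean_space \<Rightarrow> 'b::real_normed_vector"
  shows "linear L \<Longrightarrow> smooth_near x f \<Longrightarrow> smooth_near x (\<lambda>x. L (f x))"
  by (simp add: linear_conv_bounded_linear smooth_near_bounded_linear)

lemma smooth_near_const: "smooth_near x (\<lambda>x. c)"
  by (rule smooth_nearI[of UNIV]) (auto simp: smooth_on_def ck_on_const)

lemma smooth_near_ident: "smooth_near x (\<lambda>x. x)"
  by (rule smooth_nearI[of UNIV]) (auto simp: smooth_on_def ck_on_ident)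

lemma smooth_near_fst: "smooth_near x fst" and smooth_near_snd: "smooth_near x snd"
  using smooth_near_bounded_linear[OF bounded_linear_fst smooth_near_ident, of x]
    smooth_near_bounded_linear[OF bounded_linear_snd smooth_near_ident, of x] by (auto simp: id_def)

lemma smooth_near_sum:
  assumes "finite I" "\<And>i. i \<in> I \<Longrightarrow> smooth_near x (f i)"
  shows "smooth_near x (\<lambda>x. \<Sum>i\<in>I. f i x)"
  using assms by (induction I) (auto intro: smooth_near_const smooth_near_add)

lemma smooth_near_fd_const: "smooth_near x f \<Longrightarrow> smooth_near x (\<lambda>x. fd f x v)"
  unfolding smooth_near_def smooth_on_def by (metis ck_on.simps(2))

text \<open>Not only \<open>x \<mapsto> D f x v\<close> for fixed \<open>v\<close>, but the derivative as a function of both arguments is smooth.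
This is what makes tangent maps of smooth maps smooth.\<close>

lemma smooth_near_fd:
  fixes q :: "'c::euclidean_space \<Rightarrow> 'a::euclidean_space"
  assumes "smooth_near (q x) f" "smooth_near x q" "smooth_near x r"
  shows "smooth_near x (\<lambda>x. fd f (q x) (r x))"
proof (rule smooth_near_cong)
  show "smooth_near x (\<lambda>x. \<Sum>b\<in>Basis. (r x \<bullet> b) *\<^sub>R fd f (q x) b)"
    by (intro smooth_near_sum smooth_near_bilinear[OF bounded_bilinear_scaleR]
         smooth_near_bounded_linear[OF bounded_linear_inner_left] assms
         smooth_near_compose[of q x "\<lambda>y. fd f y _"] smooth_near_fd_const) auto
  have "\<forall>\<^sub>F y in nhds x. smooth_near (q y) f"
    using eventually_compose_filterlim[OF smooth_near_eventually[OF assms(1)] smooth_near_tendsto[OF assms(2)]] .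
  then show "\<forall>\<^sub>F y in nhds x. (\<Sum>b\<in>Basis. (r y \<bullet> b) *\<^sub>R fd f (q y) b) = fd f (q y) (r y)"
    by eventually_elim (metis linear_basis_sum smooth_near_linear)
qed

lemma fd_chain:
  assumes "f differentiable (at (g x))" "g differentiable (at x)"
  shows "fd (\<lambda>x. f (g x)) x v = fd f (g x) (fd g x v)"
  using frechet_derivative_compose[OF assms(2,1)] by (simp add: o_def)

lemma fd_cong:
  assumes "\<forall>\<^sub>F y in nhds x. f y = g y"
  shows "fd f x = fd g x"
proof -
  have "(f has_derivative f') (at x) \<longleftrightarrow> (g has_derivative f') (at x)" for f'
    using has_derivative_transform_eventually[of f f' x UNIV g]
      has_derivative_transform_eventually[of g f' x UNIV f] assms
    by (auto simp: eventually_nhds_conv_at eq_commute)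
  then show ?thesis by (simp add: frechet_derivative_def)
qed

section \<open>Second derivatives\<close>

text \<open>The outer derivative is taken in the direction \<open>a\<close>, the inner one in the direction \<open>b\<close>.\<close>

abbreviation fd2 :: "('a::real_normed_vector \<Rightarrow> 'b::real_normed_vector) \<Rightarrow> 'a \<Rightarrow> 'a \<Rightarrow> 'a \<Rightarrow> 'b" where
  "fd2 f x a b \<equiv> fd (\<lambda>y. fd f y b) x a"

lemma fd2_basis_sum:
  fixes f :: "'a::euclidean_space \<Rightarrow> 'b::real_normed_vector"
  assumes "smooth_near x f"
  shows "fd2 f x a v = (\<Sum>b\<in>Basis. (v \<bullet> b) *\<^sub>R fd2 f x a b)"
proof -
  have "\<forall>\<^sub>F y in nhds x. fd f y v = (\<Sum>b\<in>Basis. (v \<bullet> b) *\<^sub>R fd f y b)"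
    using smooth_near_eventually[OF assms]
    by eventually_elim (rule linear_basis_sum[OF smooth_near_linear])
  then have "fd (\<lambda>y. fd f y v) x = fd (\<lambda>y. \<Sum>b\<in>Basis. (v \<bullet> b) *\<^sub>R fd f y b) x"
    by (rule fd_cong)
  also have "\<dots> = (\<lambda>a. \<Sum>b\<in>Basis. (v \<bullet> b) *\<^sub>R fd2 f x a b)"
    by (intro fd_eqI has_derivative_sum has_derivative_scaleR_right
        smooth_near_has_derivative smooth_near_fd_const assms)
  finally show ?thesis by simp
qed

lemma fd2_linear_right:
  fixes f :: "'a::euclidean_space \<Rightarrow> 'b::real_normed_vector"
  assumes "smooth_near x f"
  shows "linear (fd2 f x a)"
proof (rule linearI)
  show "fd2 f x a (u + v) = fd2 f x a u + fd2 f x a v" for u v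
    by (subst (1 2 3) fd2_basis_sum[OF assms]) (simp add: inner_add_left scaleR_add_left sum.distrib)
  show "fd2 f x a (r *\<^sub>R u) = r *\<^sub>R fd2 f x a u" for r u
    by (subst (1 2) fd2_basis_sum[OF assms]) (simp add: scaleR_sum_right)
qed

lemma fd2_linear_left:
  fixes f :: "'a::euclidean_space \<Rightarrow> 'b::real_normed_vector"
  assumes "smooth_near x f"
  shows "linear (\<lambda>a. fd2 f x a b)"
  by (rule smooth_near_linear[OF smooth_near_fd_const[OF assms]])

text \<open>The second order chain rule from which all derivatives of vector fields along curves, of prolonged
maps and of compositions are obtained.\<close>

lemma has_derivative_fd_along:
  fixes f :: "'a::euclidean_space \<Rightarrow> 'b::real_normed_vector" and q r :: "'c::real_normed_vector \<Rightarrow> 'a"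
  assumes f: "smooth_near (q x) f" and q: "(q has_derivative q') (at x)" and r: "(r has_derivative r') (at x)"
  shows "((\<lambda>x. fd f (q x) (r x)) has_derivative (\<lambda>a. fd2 f (q x) (q' a) (r x) + fd f (q x) (r' a))) (at x)"
proof -
  have ev: "\<forall>\<^sub>F y in at x. smooth_near (q y) f"
  proof -
    have "filterlim q (nhds (q x)) (at x)"
      using has_derivative_continuous[OF q] by (simp add: continuous_within)
    from eventually_compose_filterlim[OF smooth_near_eventually[OF f] this] show ?thesis .
  qed
  have "((\<lambda>y. \<Sum>b\<in>Basis. (r y \<bullet> b) *\<^sub>R fd f (q y) b) has_derivative
     (\<lambda>a. \<Sum>b\<in>Basis. (r x \<bullet> b) *\<^sub>R fd2 f (q x) (q' a) b + (r' a \<bullet> b) *\<^sub>R fd f (q x) b)) (at x)"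
  proof (intro has_derivative_sum has_derivative_scaleR)
    fix b :: 'a
    show "((\<lambda>y. r y \<bullet> b) has_derivative (\<lambda>a. r' a \<bullet> b)) (at x)"
      by (rule has_derivative_inner_left[OF r])
    show "((\<lambda>y. fd f (q y) b) has_derivative (\<lambda>a. fd2 f (q x) (q' a) b)) (at x)"
      using diff_chain_at[OF q smooth_near_has_derivative[OF smooth_near_fd_const[OF f]]]
      by (simp add: o_def)
  qed
  moreover have "(\<lambda>a. \<Sum>b\<in>Basis. (r x \<bullet> b) *\<^sub>R fd2 f (q x) (q' a) b + (r' a \<bullet> b) *\<^sub>R fd f (q x) b)
      = (\<lambda>a. fd2 f (q x) (q' a) (r x) + fd f (q x) (r' a))"
    using fd2_basis_sum[OF f, where v = "r x"] linear_basis_sum[OF smooth_near_linear[OF f], of "r' _"]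
    by (simp add: sum.distrib fun_eq_iff)
  ultimately have *: "((\<lambda>y. \<Sum>b\<in>Basis. (r y \<bullet> b) *\<^sub>R fd f (q y) b) has_derivative
     (\<lambda>a. fd2 f (q x) (q' a) (r x) + fd f (q x) (r' a))) (at x)" by simp
  show ?thesis
  proof (rule has_derivative_transform_eventually[OF *])
    show "\<forall>\<^sub>F y in at x. (\<Sum>b\<in>Basis. (r y \<bullet> b) *\<^sub>R fd f (q y) b) = fd f (q y) (r y)"
      using ev by eventually_elim (metis linear_basis_sum smooth_near_linear)
    show "(\<Sum>b\<in>Basis. (r x \<bullet> b) *\<^sub>R fd f (q x) b) = fd f (q x) (r x)"
      using linear_basis_sum[OF smooth_near_linear[OF f]] by metis
  qed simp
qed

text \<open>The second difference of \<open>f\<close> with steps \<open>h a\<close> and \<open>h b\<close> is the increment over \<open>[0, h]\<close> of the curve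
\<open>s \<mapsto> f (x + s a + h b) - f (x + s a)\<close>. Its derivative is a first difference of the directional
derivative of \<open>f\<close> along \<open>a\<close>, hence \<open>h D\<^sup>2f (b, a) + o(h)\<close>, and the mean value inequality applies.\<close>

lemma second_difference_bound:
  fixes f :: "'a::euclidean_space \<Rightarrow> 'b::real_normed_vector"
  assumes f: "smooth_near x f" and "e > 0"
  shows "\<forall>\<^sub>F h in at_right (0::real).
    norm (f (x + h *\<^sub>R a + h *\<^sub>R b) - f (x + h *\<^sub>R a) - f (x + h *\<^sub>R b) + f x - (h * h) *\<^sub>R fd2 f x b a) \<le> e * (h * h)"
proof -
  let ?F = "\<lambda>y. fd f y a"
  \<comment> \<open>The two points that occur differ from \<open>x\<close> by at most \<open>h (norm a + norm b)\<close> and \<open>h norm a\<close>;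
    the summand \<open>1\<close> keeps \<open>k\<close> positive.\<close>
  define k where "k = norm a + norm a + norm b + 1"
  have k: "k > 0" by (simp add: k_def add_nonneg_pos)
  have F: "(?F has_derivative fd ?F x) (at x)"
    by (rule smooth_near_has_derivative[OF smooth_near_fd_const[OF f]])
  have linF: "linear (fd ?F x)" using smooth_near_linear[OF smooth_near_fd_const[OF f]] .
  obtain d where d: "d > 0" "\<And>y. norm (y - x) < d \<Longrightarrow> norm (?F y - ?F x - fd ?F x (y - x)) \<le> e / k * norm (y - x)"
  proof -
    have "\<exists>d>0. \<forall>y. norm (y - x) < d \<longrightarrow> norm (?F y - ?F x - fd ?F x (y - x)) \<le> e / k * norm (y - x)"
      using F[unfolded has_derivative_at_alt, THEN conjunct2, rule_format, of "e / k"] \<open>e > 0\<close> k by simp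
    then show thesis using that by blast
  qed
  obtain U where U: "open U" "x \<in> U" "smooth_on U f" using f by (auto simp: smooth_near_def)
  obtain d' where d': "d' > 0" "ball x d' \<subseteq> U" using U open_contains_ball by blast
  define m where "m = min d d' / k"
  have m: "m > 0" using d d' k by (simp add: m_def)
  show ?thesis
    unfolding eventually_at_right_field
  proof (intro exI[of _ m] conjI allI impI m)
    fix h :: real assume h: "h > 0" "h < m"
    have hk: "h * k < min d d'" using h k by (simp add: m_def pos_less_divide_eq)
    have n1: "norm (s *\<^sub>R a + r *\<^sub>R b) \<le> h * (norm a + norm b)" if "s \<in> {0..h}" "r \<in> {0..h}" for s r
    proof -
      have "norm (s *\<^sub>R a + r *\<^sub>R b) \<le> s * norm a + r * norm b"
        using that by (intro norm_triangle_le) auto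
      also have "\<dots> \<le> h * norm a + h * norm b"
        using that by (intro add_mono mult_right_mono) auto
      finally show ?thesis by (simp add: algebra_simps)
    qed
    have hk2: "h * (norm a + norm b) < min d d'"
    proof -
      have "norm a + norm b \<le> k" by (simp add: k_def)
      then have "h * (norm a + norm b) \<le> h * k" using h by (intro mult_left_mono) auto
      with hk show ?thesis by simp
    qed
    define G where "G s = f (x + s *\<^sub>R a + h *\<^sub>R b) - f (x + s *\<^sub>R a) - s *\<^sub>R (h *\<^sub>R fd ?F x b)" for s
    define G' where "G' s = ?F (x + s *\<^sub>R a + h *\<^sub>R b) - ?F (x + s *\<^sub>R a) - h *\<^sub>R fd ?F x b" for s
    have dif: "(f has_derivative fd f (x + s *\<^sub>R a + r *\<^sub>R b)) (at (x + s *\<^sub>R a + r *\<^sub>R b))"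
      if "s \<in> {0..h}" "r \<in> {0..h}" for s r
    proof -
      have "x + s *\<^sub>R a + r *\<^sub>R b \<in> U"
      proof (intro subsetD[OF d'(2)])
        have "dist (x + s *\<^sub>R a + r *\<^sub>R b) x < d'"
          using n1[OF that] hk2 by (simp add: dist_norm add.assoc)
        then show "x + s *\<^sub>R a + r *\<^sub>R b \<in> ball x d'" by (simp add: dist_commute)
      qed
      then show ?thesis using U by (meson smooth_nearI smooth_near_has_derivative)
    qed
    have dG: "(G has_vector_derivative G' s) (at s within {0..h})" if s: "s \<in> {0..h}" for s
    proof -
      have 1: "((\<lambda>s. f (x + s *\<^sub>R a + r *\<^sub>R b)) has_vector_derivative ?F (x + s *\<^sub>R a + r *\<^sub>R b)) (at s within {0..h})"
        if "r \<in> {0..h}" for r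
      proof -
        have "((\<lambda>s. x + s *\<^sub>R a + r *\<^sub>R b) has_vector_derivative a) (at s within {0..h})"
          unfolding has_vector_derivative_def by (auto intro!: derivative_eq_intros)
        from vector_derivative_diff_chain_within[OF this has_derivative_at_withinI[OF dif[OF s that]]]
        show ?thesis by (simp add: o_def)
      qed
      from 1[of h] 1[of 0] h s show ?thesis
        unfolding G_def G'_def has_vector_derivative_def
        by (auto intro!: derivative_eq_intros simp: algebra_simps)
    qed
    have nG: "norm (G' s) \<le> e * h" if s: "s \<in> {0..h}" for s
    proof -
      have 1: "norm (?F (x + s *\<^sub>R a + r *\<^sub>R b) - ?F x - fd ?F x (s *\<^sub>R a + r *\<^sub>R b)) \<le> e / k * norm (s *\<^sub>R a + r *\<^sub>R b)"
        if "r \<in> {0..h}" for r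
        using d(2)[of "x + s *\<^sub>R a + r *\<^sub>R b"] n1[OF s that] hk2 by (simp add: add.assoc)
      have "G' s = (?F (x + s *\<^sub>R a + h *\<^sub>R b) - ?F x - fd ?F x (s *\<^sub>R a + h *\<^sub>R b)) -
          (?F (x + s *\<^sub>R a + 0 *\<^sub>R b) - ?F x - fd ?F x (s *\<^sub>R a + 0 *\<^sub>R b))"
        by (simp add: G'_def linear_add[OF linF] linear_scale[OF linF])
      then have "norm (G' s) \<le> e / k * norm (s *\<^sub>R a + h *\<^sub>R b) + e / k * norm (s *\<^sub>R a + 0 *\<^sub>R b)"
        using norm_triangle_ineq4 1[of h] 1[of 0] h by (smt (verit) atLeastAtMost_iff)
      also have "\<dots> = e / k * (norm (s *\<^sub>R a + h *\<^sub>R b) + norm (s *\<^sub>R a))" by (simp add: algebra_simps)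
      also have "\<dots> \<le> e / k * (h * k)"
      proof (intro mult_left_mono)
        have "norm (s *\<^sub>R a) \<le> h * norm a" using s by (auto intro: mult_right_mono)
        moreover have "norm (s *\<^sub>R a + h *\<^sub>R b) \<le> h * (norm a + norm b)" using n1[of s h] s h by auto
        moreover have "h * k = h * norm a + h * (norm a + norm b) + h" by (simp add: k_def algebra_simps)
        ultimately show "norm (s *\<^sub>R a + h *\<^sub>R b) + norm (s *\<^sub>R a) \<le> h * k" using h by linarith
      qed (use \<open>e > 0\<close> k in auto)
      also have "\<dots> = e * h" using k by simp
      finally show ?thesis .
    qed
    have "norm (G h - G 0) \<le> (e * h) * norm (h - 0)"
    proof (rule differentiable_bound[of "{0..h}" G "\<lambda>s t. t *\<^sub>R G' s"])
      fix s assume s: "s \<in> {0..h}"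
      show "(G has_derivative (\<lambda>t. t *\<^sub>R G' s)) (at s within {0..h})"
        using dG[OF s] by (simp add: has_vector_derivative_def)
      show "onorm (\<lambda>t. t *\<^sub>R G' s) \<le> e * h"
        using nG[OF s] by (intro onorm_le) (simp add: mult.commute mult_left_mono)
    qed (use h in auto)
    moreover have "G h - G 0 = f (x + h *\<^sub>R a + h *\<^sub>R b) - f (x + h *\<^sub>R a) - f (x + h *\<^sub>R b) + f x - (h * h) *\<^sub>R fd2 f x b a"
      by (simp add: G_def)
    ultimately show "norm (f (x + h *\<^sub>R a + h *\<^sub>R b) - f (x + h *\<^sub>R a) - f (x + h *\<^sub>R b) + f x - (h * h) *\<^sub>R fd2 f x b a)
       \<le> e * (h * h)" using h by (simp add: mult.assoc)
  qed
qed

text \<open>The second difference does not change when \<open>a\<close> and \<open>b\<close> are exchanged, but it approximates both mixed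
derivatives.\<close>

lemma fd2_commute:
  fixes f :: "'a::euclidean_space \<Rightarrow> 'b::real_normed_vector"
  assumes f: "smooth_near x f"
  shows "fd2 f x a b = fd2 f x b a"
proof (rule ccontr)
  assume ne: "fd2 f x a b \<noteq> fd2 f x b a"
  define e where "e = norm (fd2 f x a b - fd2 f x b a) / 3"
  have e: "e > 0" using ne by (simp add: e_def)
  have "\<forall>\<^sub>F h in at_right (0::real). h > 0 \<and>
     norm (f (x + h *\<^sub>R a + h *\<^sub>R b) - f (x + h *\<^sub>R a) - f (x + h *\<^sub>R b) + f x - (h * h) *\<^sub>R fd2 f x b a) \<le> e * (h * h) \<and>
     norm (f (x + h *\<^sub>R b + h *\<^sub>R a) - f (x + h *\<^sub>R b) - f (x + h *\<^sub>R a) + f x - (h * h) *\<^sub>R fd2 f x a b) \<le> e * (h * h)"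
    by (intro eventually_conj second_difference_bound[OF f e] eventually_at_right_less)
  then obtain h :: real where h: "h > 0"
     "norm (f (x + h *\<^sub>R a + h *\<^sub>R b) - f (x + h *\<^sub>R a) - f (x + h *\<^sub>R b) + f x - (h * h) *\<^sub>R fd2 f x b a) \<le> e * (h * h)"
     "norm (f (x + h *\<^sub>R b + h *\<^sub>R a) - f (x + h *\<^sub>R b) - f (x + h *\<^sub>R a) + f x - (h * h) *\<^sub>R fd2 f x a b) \<le> e * (h * h)"
    using eventually_happens[of _ "at_right (0::real)"] by auto
  define D where "D = f (x + h *\<^sub>R a + h *\<^sub>R b) - f (x + h *\<^sub>R a) - f (x + h *\<^sub>R b) + f x"
  have D: "norm (D - (h * h) *\<^sub>R fd2 f x b a) \<le> e * (h * h)" "norm (D - (h * h) *\<^sub>R fd2 f x a b) \<le> e * (h * h)"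
  proof -
    have "f (x + h *\<^sub>R b + h *\<^sub>R a) - f (x + h *\<^sub>R b) - f (x + h *\<^sub>R a) + f x = D"
      by (simp add: D_def algebra_simps)
    with h(2,3) show "norm (D - (h * h) *\<^sub>R fd2 f x b a) \<le> e * (h * h)" "norm (D - (h * h) *\<^sub>R fd2 f x a b) \<le> e * (h * h)"
      by (simp_all only: D_def)
  qed
  have "norm ((h * h) *\<^sub>R (fd2 f x a b - fd2 f x b a)) =
      norm ((D - (h * h) *\<^sub>R fd2 f x b a) - (D - (h * h) *\<^sub>R fd2 f x a b))"
    by (simp add: scaleR_diff_right)
  also have "\<dots> \<le> 2 * e * (h * h)" 
    using D norm_triangle_ineq4[of "D - (h * h) *\<^sub>R fd2 f x b a" "D - (h * h) *\<^sub>R fd2 f x a b"]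
    by linarith
  finally have "(h * h) * (3 * e) \<le> (h * h) * (2 * e)"
    by (simp add: e_def)
  then show False using h(1) e by simp
qed

section \<open>Ordinary differential equations with smooth right hand side\<close>

text \<open>A solution gains one derivative at a time, since its derivative is \<open>F\<close> composed with the solution.\<close>

lemma smooth_ode_bootstrap:
  fixes x :: "real \<Rightarrow> 'a::euclidean_space"
  assumes "open J" "open U" "smooth_on U F" "\<And>t. t \<in> J \<Longrightarrow> x t \<in> U"
    and x: "\<And>t. t \<in> J \<Longrightarrow> (x has_vector_derivative F (x t)) (at t)"
  shows "smooth_on J x"
proof -
  have c: "ck_on k J x" for k
  proof (induction k)
    case 0
    then show ?case
      using x by (auto intro!: continuous_at_imp_continuous_on has_vector_derivative_continuous)
  next
    case (Suc k)
    have "ck_on k J (\<lambda>t. fd x t v)" for v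
    proof (rule ck_on_cong[OF \<open>open J\<close>])
      show "ck_on k J (\<lambda>t. v *\<^sub>R F (x t))"
      proof (rule ck_on_bounded_linear[OF bounded_linear_scaleR_right \<open>open J\<close>])
        show "ck_on k J (\<lambda>t. F (x t))"
          by (rule ck_on_compose[OF \<open>open J\<close> \<open>open U\<close> _ _ Suc]) (use assms in \<open>auto simp: smooth_on_def\<close>)
      qed
      show "v *\<^sub>R F (x t) = fd x t v" if "t \<in> J" for t
        using fd_eqI[OF x[OF that, unfolded has_vector_derivative_def]] by simp
    qed
    moreover have "x differentiable (at t)" if "t \<in> J" for t
      using x[OF that] by (auto simp: has_vector_derivative_def differentiable_def)
    ultimately show ?case by simp
  qed
  then show ?thesis by (simp add: smooth_on_def)
qed

text \<open>The bounds that the contraction argument for differential equations needs.\<close>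

lemma smooth_lipschitz_cball:
  fixes F :: "'a::euclidean_space \<Rightarrow> 'b::real_normed_vector"
  assumes "smooth_near x F"
  obtains r L K where "r > 0" "L \<ge> 0" "K \<ge> 0" "\<And>u. u \<in> cball x r \<Longrightarrow> norm (F u) \<le> K"
    "\<And>u v. u \<in> cball x r \<Longrightarrow> v \<in> cball x r \<Longrightarrow> norm (F u - F v) \<le> L * norm (u - v)"
proof -
  obtain U where U: "open U" "x \<in> U" "smooth_on U F" using assms by (auto simp: smooth_near_def)
  obtain r where r: "r > 0" "cball x r \<subseteq> U" using U open_contains_cball by blast
  have c: "continuous_on (cball x r) F"
    using U(3) r by (metis ck_on.simps(1) smooth_on_def continuous_on_subset)
  have cb: "continuous_on (cball x r) (\<lambda>u. fd F u b)" for b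
    using U(3) r by (metis ck_on.simps smooth_on_def continuous_on_subset)
  have bd: "\<exists>K\<ge>0. \<forall>u\<in>cball x r. norm (g u) \<le> K" if "continuous_on (cball x r) g" for g :: "'a \<Rightarrow> 'b"
    using compact_imp_bounded[OF compact_continuous_image[OF that compact_cball]]
    unfolding bounded_pos by (metis imageI less_eq_real_def)
  obtain K where K: "K \<ge> 0" "\<And>u. u \<in> cball x r \<Longrightarrow> norm (F u) \<le> K" using bd[OF c] by auto
  obtain k where k: "\<And>b u. u \<in> cball x r \<Longrightarrow> norm (fd F u b) \<le> k b" "\<And>b. k b \<ge> 0"
    using bd[OF cb] by metis
  define L where "L = (\<Sum>b\<in>Basis. k b)"
  have L: "L \<ge> 0" using k by (simp add: L_def sum_nonneg)
  have dif: "F differentiable (at u)" if "u \<in> cball x r" for u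
    using that r U by (meson smooth_nearI smooth_near_differentiable subsetD)
  have on: "onorm (fd F u) \<le> L" if u: "u \<in> cball x r" for u
  proof (rule onorm_le)
    fix v
    have "norm (fd F u v) \<le> (\<Sum>b\<in>Basis. norm ((v \<bullet> b) *\<^sub>R fd F u b))"
      by (subst linear_basis_sum[OF linear_fd[OF dif[OF u]]]) (rule norm_sum)
    also have "\<dots> \<le> (\<Sum>b\<in>Basis. norm v * k b)"
      using k u by (intro sum_mono) (auto intro!: mult_mono Basis_le_norm)
    finally show "norm (fd F u v) \<le> L * norm v" by (simp add: L_def sum_distrib_left mult.commute)
  qed
  have "norm (F u - F v) \<le> L * norm (u - v)" if "u \<in> cball x r" "v \<in> cball x r" for u v
    by (rule differentiable_bound[OF convex_cball _ on that])
       (use dif in \<open>auto intro: has_derivative_at_withinI has_derivative_fd\<close>)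
  with r L K show thesis by (intro that[of r L K]) auto
qed

text \<open>Picard iteration: on a short interval the integral operator is a contraction of the complete space of
bounded continuous functions with values in a closed ball around the initial point.\<close>

lemma smooth_ode_local_solution:
  fixes F :: "'a::euclidean_space \<Rightarrow> 'a"
  assumes F: "smooth_near x0 F"
  obtains \<epsilon> x where "\<epsilon> > 0" "x 0 = x0" "\<And>t. t \<in> {-\<epsilon><..<\<epsilon>} \<Longrightarrow> (x has_vector_derivative F (x t)) (at t)"
proof -
  obtain r L K where rLK: "r > 0" "L \<ge> 0" "K \<ge> 0" "\<And>u. u \<in> cball x0 r \<Longrightarrow> norm (F u) \<le> K"
    "\<And>u v. u \<in> cball x0 r \<Longrightarrow> v \<in> cball x0 r \<Longrightarrow> norm (F u - F v) \<le> L * norm (u - v)"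
    using smooth_lipschitz_cball[OF F] by metis
  define \<epsilon> where "\<epsilon> = min (r / (3 * (K + 1))) (1 / (6 * (L + 1)))"
  have \<epsilon>: "\<epsilon> > 0" using rLK by (simp add: \<epsilon>_def)
  have eK: "3 * \<epsilon> * K \<le> r"
  proof -
    have "3 * \<epsilon> * K \<le> 3 * \<epsilon> * (K + 1)" using \<epsilon> by simp
    also have "\<dots> \<le> r"
      using rLK(1,3) min.cobounded1[of "r / (3 * (K + 1))" "1 / (6 * (L + 1))"]
      unfolding \<epsilon>_def[symmetric] by (simp add: field_simps)
    finally show ?thesis .
  qed
  have eL: "3 * \<epsilon> * L \<le> 1 / 2"
  proof -
    have "3 * \<epsilon> * L \<le> 3 * \<epsilon> * (L + 1)" using \<epsilon> by simp
    also have "\<dots> \<le> 1 / 2"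
      using rLK(2) min.cobounded2[of "r / (3 * (K + 1))" "1 / (6 * (L + 1))"]
      unfolding \<epsilon>_def[symmetric] by (simp add: field_simps)
    finally show ?thesis .
  qed
  define S :: "(real \<Rightarrow>\<^sub>C 'a) set" where "S = PiC UNIV (\<lambda>_. cball x0 r)"
  \<comment> \<open>Functions are extended by constants beyond the interval, which makes them bounded and continuous on
    the whole line.\<close>
  define cl where "cl t = max (-\<epsilon>) (min \<epsilon> t)" for t :: real
  have cl: "cl t \<in> {-\<epsilon>..\<epsilon>}" for t using \<epsilon> by (auto simp: cl_def)
  \<comment> \<open>The integral from \<open>0\<close> to \<open>t\<close>, for \<open>t\<close> of either sign. The crude bound by three halves of the
    interval length accounts for the factor \<open>3\<close> in the choice of \<open>\<epsilon>\<close>.\<close>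
  define I where "I g t = integral {-\<epsilon>..t} g - integral {-\<epsilon>..0} g" for g :: "real \<Rightarrow> 'a" and t
  have I_bound: "norm (I g t) \<le> 3 * \<epsilon> * B"
    if "continuous_on {-\<epsilon>..\<epsilon>} g" "\<And>s. norm (g s) \<le> B" "t \<in> {-\<epsilon>..\<epsilon>}" for g t B
  proof -
    have B: "B \<ge> 0" using that(2)[of 0] norm_ge_zero order_trans by blast
    have "norm (integral {-\<epsilon>..t} g) \<le> B * (t - (-\<epsilon>))"
      using that by (intro integral_bound) (auto intro: continuous_on_subset)
    also have "\<dots> \<le> B * (2 * \<epsilon>)" using that B by (intro mult_left_mono) auto
    finally have 1: "norm (integral {-\<epsilon>..t} g) \<le> B * (2 * \<epsilon>)" .
    have "norm (integral {-\<epsilon>..0} g) \<le> B * (0 - (-\<epsilon>))"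
      using that \<epsilon> by (intro integral_bound) (auto intro: continuous_on_subset)
    with 1 show ?thesis unfolding I_def
      using norm_triangle_ineq4[of "integral {-\<epsilon>..t} g" "integral {-\<epsilon>..0} g"] by (simp add: algebra_simps)
  qed
  have contF: "continuous_on (cball x0 r) F"
    by (rule lipschitz_on_continuous_on[of L]) (use rLK in \<open>auto intro!: lipschitz_onI simp: dist_norm\<close>)
  have cF: "continuous_on A (\<lambda>s. F (u s))" if "u \<in> S" for u :: "real \<Rightarrow>\<^sub>C 'a" and A
    using that by (intro continuous_on_compose2[OF contF]) (auto simp: S_def mem_PiC_iff)
  define T where "T u = Bcontfun (\<lambda>t. x0 + I (\<lambda>s. F (apply_bcontfun u s)) (cl t))" for u
  have in_S: "apply_bcontfun u s \<in> cball x0 r" if "u \<in> S" for u s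
    using that by (auto simp: S_def mem_PiC_iff)
  have TI: "apply_bcontfun (T u) t = x0 + I (\<lambda>s. F (apply_bcontfun u s)) (cl t)" if u: "u \<in> S" for u t
  proof -
    have "continuous_on {-\<epsilon>..\<epsilon>} (I (\<lambda>s. F (apply_bcontfun u s)))"
      unfolding I_def by (intro continuous_intros indefinite_integral_continuous_1
          integrable_continuous_real cF[OF u])
    then have "continuous_on UNIV (\<lambda>t. I (\<lambda>s. F (apply_bcontfun u s)) (cl t))"
      by (rule continuous_on_compose2) (use cl in \<open>auto simp: cl_def[abs_def] intro!: continuous_intros\<close>)
    moreover have "norm (x0 + I (\<lambda>s. F (apply_bcontfun u s)) (cl t)) \<le> norm x0 + 3 * \<epsilon> * K" for t
      using I_bound[OF cF[OF u] rLK(4)[OF in_S[OF u]] cl[of t]] by (intro norm_triangle_le) auto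
    ultimately have "(\<lambda>t. x0 + I (\<lambda>s. F (apply_bcontfun u s)) (cl t)) \<in> bcontfun"
      by (intro bcontfun_normI continuous_intros)
    then show ?thesis by (simp add: T_def Bcontfun_inverse)
  qed
  have "\<exists>!u\<in>S. T u = u"
  proof (rule Banach_fix)
    show "complete S" unfolding S_def complete_eq_closed by (intro closed_PiC) simp
    have "const_bcontfun x0 \<in> S" using rLK by (simp add: S_def mem_PiC_iff)
    then show "S \<noteq> {}" by blast
    show "T ` S \<subseteq> S"
    proof safe
      fix u assume u: "u \<in> S"
      have "norm (I (\<lambda>s. F (apply_bcontfun u s)) (cl t)) \<le> r" for t
        using I_bound[OF cF[OF u] rLK(4)[OF in_S[OF u]] cl[of t]] eK by linarith
      then show "T u \<in> S" by (simp add: S_def mem_PiC_iff TI[OF u] dist_norm Pi_iff)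
    qed
    fix u v assume u: "u \<in> S" and v: "v \<in> S"
    show "dist (T u) (T v) \<le> 1 / 2 * dist u v"
    proof (rule dist_bound)
      fix t
      let ?d = "\<lambda>s. F (apply_bcontfun u s) - F (apply_bcontfun v s)"
      have int: "(\<lambda>s. F (apply_bcontfun w s)) integrable_on A" if "w \<in> S" "A = {-\<epsilon>..b}" for w A b
        using cF[OF that(1)] that(2) by (auto intro: integrable_continuous_real)
      have "apply_bcontfun (T u) t - apply_bcontfun (T v) t = I ?d (cl t)"
        unfolding TI[OF u] TI[OF v] I_def
        by (subst (1 2) integral_diff) (auto intro: int u v)
      moreover have "norm (I ?d (cl t)) \<le> 3 * \<epsilon> * (L * dist u v)"
      proof (rule I_bound[OF _ _ cl])
        show "continuous_on {-\<epsilon>..\<epsilon>} ?d" by (intro continuous_intros cF u v)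
        fix s
        have "norm (?d s) \<le> L * norm (apply_bcontfun u s - apply_bcontfun v s)"
          by (rule rLK(5)[OF in_S[OF u] in_S[OF v]])
        also have "\<dots> \<le> L * dist u v"
          using dist_bounded[of u s v] rLK(2) by (intro mult_left_mono) (auto simp: dist_norm)
        finally show "norm (?d s) \<le> L * dist u v" .
      qed
      moreover have "3 * \<epsilon> * (L * dist u v) \<le> 1 / 2 * dist u v"
        using mult_right_mono[OF eL, of "dist u v"] by (simp add: mult.assoc)
      ultimately show "dist (apply_bcontfun (T u) t) (apply_bcontfun (T v) t) \<le> 1 / 2 * dist u v"
        by (simp add: dist_norm)
    qed
  qed auto
  then obtain u where u: "u \<in> S" "T u = u" by blast
  have eq: "apply_bcontfun u t = x0 + I (\<lambda>s. F (apply_bcontfun u s)) (cl t)" for t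
    using TI[OF u(1)] u(2) by metis
  show thesis
  proof (rule that[OF \<epsilon>, of "apply_bcontfun u"])
    show "apply_bcontfun u 0 = x0" using \<epsilon> by (simp add: eq[of 0] I_def cl_def)
    fix t assume t: "t \<in> {-\<epsilon><..<\<epsilon>}"
    have "((\<lambda>t. integral {-\<epsilon>..t} (\<lambda>s. F (apply_bcontfun u s))) has_vector_derivative F (apply_bcontfun u t)) (at t within {-\<epsilon>..\<epsilon>})"
      by (rule integral_has_vector_derivative[OF cF[OF u(1)]]) (use t in auto)
    then have "((\<lambda>t. integral {-\<epsilon>..t} (\<lambda>s. F (apply_bcontfun u s))) has_vector_derivative F (apply_bcontfun u t)) (at t)"
      using t by (metis at_within_interior interior_atLeastAtMost_real)
    then have d: "((\<lambda>t. x0 + I (\<lambda>s. F (apply_bcontfun u s)) t) has_vector_derivative F (apply_bcontfun u t)) (at t)"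
      unfolding I_def by (auto simp: has_vector_derivative_def intro!: derivative_eq_intros)
    show "(apply_bcontfun u has_vector_derivative F (apply_bcontfun u t)) (at t)"
    proof (rule has_vector_derivative_transform_within_open[OF d open_greaterThanLessThan t])
      fix s assume "s \<in> {-\<epsilon><..<\<epsilon>}"
      then have "cl s = s" by (auto simp: cl_def)
      then show "x0 + I (\<lambda>s. F (apply_bcontfun u s)) s = apply_bcontfun u s" using eq[of s] by simp
    qed
  qed
qed

section \<open>Charts and plots\<close>

text \<open>The purely differential part of \<open>smooth_manifold\<close>, which passes on to the slit tangent bundle by
differentiating transition maps.\<close>

definition smooth_atlas :: "('p, 'e::euclidean_space) manifold \<Rightarrow> bool" where
  "smooth_atlas M \<longleftrightarrow> (\<forall>\<kappa>\<in>atlas M. inj_on (snd \<kappa>) (fst \<kappa>) \<and> open (snd \<kappa> ` fst \<kappa>) \<and>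
     (\<forall>\<mu>\<in>atlas M. open (snd \<kappa> ` (fst \<kappa> \<inter> fst \<mu>)) \<and> compatible \<kappa> \<mu>))"

text \<open>A chart of the maximal atlas, again in terms that do not mention the topology.\<close>

definition admissible :: "('p, 'e::euclidean_space) manifold \<Rightarrow> ('p, 'e) chart \<Rightarrow> bool" where
  "admissible M \<kappa> \<longleftrightarrow> inj_on (snd \<kappa>) (fst \<kappa>) \<and> open (snd \<kappa> ` fst \<kappa>) \<and> fst \<kappa> \<subseteq> (\<Union>\<mu>\<in>atlas M. fst \<mu>) \<and>
     (\<forall>\<mu>\<in>atlas M. open (snd \<kappa> ` (fst \<kappa> \<inter> fst \<mu>)) \<and> open (snd \<mu> ` (fst \<mu> \<inter> fst \<kappa>)) \<and> compatible \<kappa> \<mu>)"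

text \<open>The compatibility between topology and atlas by which continuous smooth maps are turned into maps of
plots, and families of plots into smooth curves.\<close>

definition open_charts :: "('p, 'e::euclidean_space) manifold \<Rightarrow> bool" where
  "open_charts M \<longleftrightarrow> (\<forall>\<kappa>\<in>atlas M. inj_on (snd \<kappa>) (fst \<kappa>) \<and> fst \<kappa> \<subseteq> topspace (mtop M) \<and>
     (\<forall>U. openin (mtop M) U \<longrightarrow> open (snd \<kappa> ` (fst \<kappa> \<inter> U))))"

lemma admissible_atlas: "smooth_atlas M \<Longrightarrow> \<kappa> \<in> atlas M \<Longrightarrow> admissible M \<kappa>"
  unfolding smooth_atlas_def admissible_def by blast

lemma is_chart_open_image:
  assumes "is_chart T \<kappa>" "openin T U"
  shows "open (snd \<kappa> ` (fst \<kappa> \<inter> U))"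
proof -
  have "openin (subtopology T (fst \<kappa>)) (fst \<kappa> \<inter> U)"
    using assms by (auto simp: is_chart_def openin_subtopology Int_commute)
  then have "openin (top_of_set (snd \<kappa> ` fst \<kappa>)) (snd \<kappa> ` (fst \<kappa> \<inter> U))"
    using assms(1) homeomorphic_imp_open_map unfolding is_chart_def open_map_def by blast
  then show ?thesis using assms(1) openin_open_trans unfolding is_chart_def by blast
qed

lemma is_chart_inj: "is_chart T \<kappa> \<Longrightarrow> inj_on (snd \<kappa>) (fst \<kappa>)"
  unfolding is_chart_def
  by (metis homeomorphic_imp_injective_map openin_subset topspace_subtopology_subset)

lemma open_charts_smooth_manifold: "smooth_manifold M \<Longrightarrow> open_charts M"
  unfolding smooth_manifold_def open_charts_def
  by (meson is_chart_def is_chart_inj is_chart_open_image openin_subset)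

lemma smooth_manifold_openin_chart: "smooth_manifold M \<Longrightarrow> \<kappa> \<in> atlas M \<Longrightarrow> openin (mtop M) (fst \<kappa>)"
  unfolding smooth_manifold_def is_chart_def by blast

lemma smooth_atlas_smooth_manifold: "smooth_manifold M \<Longrightarrow> smooth_atlas M"
  unfolding smooth_manifold_def smooth_atlas_def
  by (meson is_chart_def is_chart_inj is_chart_open_image)

lemma admissible_charts:
  assumes "smooth_manifold M" "\<kappa> \<in> charts M"
  shows "admissible M \<kappa>"
proof -
  have k: "is_chart (mtop M) \<kappa>" "\<forall>\<mu>\<in>atlas M. compatible \<kappa> \<mu>" using assms(2) by (auto simp: charts_def)
  have m: "is_chart (mtop M) \<mu>" if "\<mu> \<in> atlas M" for \<mu> using that assms(1) by (auto simp: smooth_manifold_def)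
  have "fst \<kappa> \<subseteq> (\<Union>\<mu>\<in>atlas M. fst \<mu>)"
    using k(1) assms(1) openin_subset unfolding is_chart_def smooth_manifold_def by metis
  with k m show ?thesis
    unfolding admissible_def
    by (meson is_chart_def is_chart_inj is_chart_open_image)
qed

lemma atlas_subset_charts: "smooth_manifold M \<Longrightarrow> atlas M \<subseteq> charts M"
  unfolding smooth_manifold_def charts_def by auto

lemma chart_inv_chart: "inj_on (snd \<kappa>) (fst \<kappa>) \<Longrightarrow> p \<in> fst \<kappa> \<Longrightarrow> chart_inv \<kappa> (snd \<kappa> p) = p"
  unfolding chart_inv_def by (rule inv_into_f_f)

lemma chart_chart_inv: "x \<in> snd \<kappa> ` fst \<kappa> \<Longrightarrow> snd \<kappa> (chart_inv \<kappa> x) = x"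
  unfolding chart_inv_def by (rule f_inv_into_f)

lemma chart_inv_in: "x \<in> snd \<kappa> ` fst \<kappa> \<Longrightarrow> chart_inv \<kappa> x \<in> fst \<kappa>"
  unfolding chart_inv_def by (rule inv_into_into)

text \<open>A parametrised map into the manifold that is smooth near the point \<open>x\<close>. One chart suffices as witness;
the condition then holds in all admissible charts.\<close>

definition plot :: "('p, 'e::euclidean_space) manifold \<Rightarrow> ('u::euclidean_space \<Rightarrow> 'p) \<Rightarrow> 'u \<Rightarrow> bool" where
  "plot M f x \<longleftrightarrow> (\<exists>\<kappa>\<in>atlas M. (\<forall>\<^sub>F y in nhds x. f y \<in> fst \<kappa>) \<and> smooth_near x (\<lambda>y. snd \<kappa> (f y)))"

text \<open>The tangent vector represented by a plot, in the encoding of tangent vectors by components in the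
reference chart of the base point.\<close>

definition dplot :: "('p, 'e::euclidean_space) manifold \<Rightarrow> ('u::euclidean_space \<Rightarrow> 'p) \<Rightarrow> 'u \<Rightarrow> 'u \<Rightarrow> 'e" where
  "dplot M f x v = fd (\<lambda>y. snd (base_chart M (f x)) (f y)) x v"

text \<open>Smoothness of a map between manifolds, tested on one plot only: the inverse of the reference chart.
Both the image of a plot and the tangent map can be read off from it.\<close>

definition smooth_at ::
  "('p, 'e::euclidean_space) manifold \<Rightarrow> ('q, 'f::euclidean_space) manifold \<Rightarrow> ('p \<Rightarrow> 'q) \<Rightarrow> 'p \<Rightarrow> bool" where
  "smooth_at M N h p \<longleftrightarrow> plot N (\<lambda>x. h (chart_inv (base_chart M p) x)) (snd (base_chart M p) p)"

lemma base_chart: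
  assumes "p \<in> (\<Union>\<kappa>\<in>atlas M. fst \<kappa>)"
  shows "base_chart M p \<in> atlas M" "p \<in> fst (base_chart M p)"
proof -
  have "\<exists>\<kappa>. \<kappa> \<in> atlas M \<and> p \<in> fst \<kappa>" using assms by blast
  from someI_ex[OF this] show "base_chart M p \<in> atlas M" "p \<in> fst (base_chart M p)"
    unfolding base_chart_def by blast+
qed

lemma plot_in_atlas: "plot M f x \<Longrightarrow> f x \<in> (\<Union>\<kappa>\<in>atlas M. fst \<kappa>)"
  unfolding plot_def by (auto dest: eventually_nhds_x_imp_x)

lemma plot_chart:
  assumes M: "smooth_atlas M" and f: "plot M f x" and \<mu>: "admissible M \<mu>" "f x \<in> fst \<mu>"
  shows "\<forall>\<^sub>F y in nhds x. f y \<in> fst \<mu>" "smooth_near x (\<lambda>y. snd \<mu> (f y))"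
proof -
  obtain \<kappa> where k: "\<kappa> \<in> atlas M" "\<forall>\<^sub>F y in nhds x. f y \<in> fst \<kappa>" "smooth_near x (\<lambda>y. snd \<kappa> (f y))"
    using f by (auto simp: plot_def)
  have x: "f x \<in> fst \<kappa>" using k(2) eventually_nhds_x_imp_x by fast
  have inj: "inj_on (snd \<kappa>) (fst \<kappa>)" using k(1) M by (auto simp: smooth_atlas_def)
  let ?O = "snd \<kappa> ` (fst \<kappa> \<inter> fst \<mu>)"
  have O: "open ?O" "smooth_on ?O (snd \<mu> \<circ> chart_inv \<kappa>)"
    using \<mu>(1) k(1) by (auto simp: admissible_def compatible_def Int_commute)
  have "\<forall>\<^sub>F y in nhds x. snd \<kappa> (f y) \<in> ?O"
    using smooth_near_tendsto[OF k(3)] O(1) x \<mu>(2) topological_tendstoD by blast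
  with k(2) show ev: "\<forall>\<^sub>F y in nhds x. f y \<in> fst \<mu>"
    by eventually_elim (use inj in \<open>auto dest: inj_onD\<close>)
  have "smooth_near x (\<lambda>y. (snd \<mu> \<circ> chart_inv \<kappa>) (snd \<kappa> (f y)))"
    by (rule smooth_near_compose[OF smooth_nearI[OF O(1) _ O(2)] k(3)]) (use x \<mu>(2) in auto)
  then show "smooth_near x (\<lambda>y. snd \<mu> (f y))"
  proof (rule smooth_near_cong)
    show "\<forall>\<^sub>F y in nhds x. (snd \<mu> \<circ> chart_inv \<kappa>) (snd \<kappa> (f y)) = snd \<mu> (f y)"
      using k(2) by eventually_elim (simp add: chart_inv_chart[OF inj])
  qed
qed

lemma plot_cong: "plot M f x \<Longrightarrow> \<forall>\<^sub>F y in nhds x. f y = g y \<Longrightarrow> plot M g x"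
proof -
  assume f: "plot M f x" and e: "\<forall>\<^sub>F y in nhds x. f y = g y"
  obtain \<kappa> where k: "\<kappa> \<in> atlas M" "\<forall>\<^sub>F y in nhds x. f y \<in> fst \<kappa>" "smooth_near x (\<lambda>y. snd \<kappa> (f y))"
    using f by (auto simp: plot_def)
  have "\<forall>\<^sub>F y in nhds x. g y \<in> fst \<kappa>" using k(2) e by eventually_elim simp
  moreover have "smooth_near x (\<lambda>y. snd \<kappa> (g y))"
    by (rule smooth_near_cong[OF k(3)]) (use e in eventually_elim, simp)
  ultimately show ?thesis using k(1) by (auto simp: plot_def)
qed

lemma dplot_cong: "\<forall>\<^sub>F y in nhds x. f y = g y \<Longrightarrow> dplot M f x = dplot M g x"
proof -
  assume e: "\<forall>\<^sub>F y in nhds x. f y = g y"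
  then have x: "f x = g x" by (rule eventually_nhds_x_imp_x)
  have "fd (\<lambda>y. snd (base_chart M (f x)) (f y)) x = fd (\<lambda>y. snd (base_chart M (f x)) (g y)) x"
    by (rule fd_cong) (use e in eventually_elim, simp)
  then show ?thesis unfolding dplot_def fun_eq_iff x by simp
qed

lemma plot_eventually:
  assumes "plot M f x" shows "\<forall>\<^sub>F y in nhds x. plot M f y"
proof -
  obtain \<kappa> where k: "\<kappa> \<in> atlas M" "\<forall>\<^sub>F y in nhds x. f y \<in> fst \<kappa>" "smooth_near x (\<lambda>y. snd \<kappa> (f y))"
    using assms by (auto simp: plot_def)
  from k(2) have "\<forall>\<^sub>F y in nhds x. \<forall>\<^sub>F z in nhds y. f z \<in> fst \<kappa>"
    by (simp add: eventually_eventually)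
  with smooth_near_eventually[OF k(3)] show ?thesis
    by eventually_elim (use k(1) in \<open>auto simp: plot_def\<close>)
qed

lemma plot_reparam:
  assumes "plot M f (g x)" "smooth_near x g"
  shows "plot M (\<lambda>y. f (g y)) x"
proof -
  obtain \<kappa> where k: "\<kappa> \<in> atlas M" "\<forall>\<^sub>F y in nhds (g x). f y \<in> fst \<kappa>" "smooth_near (g x) (\<lambda>y. snd \<kappa> (f y))"
    using assms(1) by (auto simp: plot_def)
  have "\<forall>\<^sub>F y in nhds x. f (g y) \<in> fst \<kappa>"
    using eventually_compose_filterlim[OF k(2) smooth_near_tendsto[OF assms(2)]] .
  with smooth_near_compose[OF k(3) assms(2)] k(1) show ?thesis by (auto simp: plot_def)
qed

lemma plot_base_chart:
  assumes "smooth_atlas M" "plot M f x"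
  shows "\<forall>\<^sub>F y in nhds x. f y \<in> fst (base_chart M (f x))" "smooth_near x (\<lambda>y. snd (base_chart M (f x)) (f y))"
  using plot_chart[OF assms] admissible_atlas[OF assms(1)] base_chart[OF plot_in_atlas[OF assms(2)]] by auto

lemma dplot_reparam:
  assumes "smooth_atlas M" "plot M f (g x)" "smooth_near x g"
  shows "dplot M (\<lambda>y. f (g y)) x v = dplot M f (g x) (fd g x v)"
  unfolding dplot_def
  by (rule fd_chain) (intro smooth_near_differentiable plot_base_chart assms)+

lemma dplot_linear: "smooth_atlas M \<Longrightarrow> plot M f x \<Longrightarrow> linear (dplot M f x)"
  using smooth_near_linear[OF plot_base_chart(2)] unfolding dplot_def[abs_def] by blast

lemma plot_chart_inv:
  assumes "smooth_atlas M" "admissible M \<kappa>" "x \<in> snd \<kappa> ` fst \<kappa>"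
  shows "plot M (chart_inv \<kappa>) x"
proof -
  let ?p = "chart_inv \<kappa> x"
  have p: "?p \<in> fst \<kappa>" using chart_inv_in[OF assms(3)] .
  then obtain \<mu> where m: "\<mu> \<in> atlas M" "?p \<in> fst \<mu>" using assms(2) by (auto simp: admissible_def)
  let ?O = "snd \<kappa> ` (fst \<kappa> \<inter> fst \<mu>)"
  have O: "open ?O" "smooth_on ?O (snd \<mu> \<circ> chart_inv \<kappa>)"
    using assms(2) m(1) by (auto simp: admissible_def compatible_def)
  have x: "x \<in> ?O" using p m(2) chart_chart_inv[OF assms(3)] by (metis IntI imageI)
  have "\<forall>\<^sub>F y in nhds x. y \<in> ?O" using O(1) x eventually_nhds by blast
  then have "\<forall>\<^sub>F y in nhds x. chart_inv \<kappa> y \<in> fst \<mu>"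
    by eventually_elim (use assms(2) in \<open>auto simp: admissible_def chart_inv_chart\<close>)
  with m(1) smooth_nearI[OF O(1) x O(2)] show ?thesis by (auto simp: plot_def o_def)
qed

lemma eventually_chart_chart_inv:
  assumes "admissible M \<kappa>" "x \<in> snd \<kappa> ` fst \<kappa>"
  shows "\<forall>\<^sub>F y in nhds x. snd \<kappa> (chart_inv \<kappa> y) = y"
proof -
  have "\<forall>\<^sub>F y in nhds x. y \<in> snd \<kappa> ` fst \<kappa>" using assms eventually_nhds by (auto simp: admissible_def)
  then show ?thesis by eventually_elim (rule chart_chart_inv)
qed

text \<open>Reference charts enter through the encoding of tangent vectors. By the chain rule for the transition from
the reference chart to \<open>\<mu>\<close>, this rule eliminates them from all later computations.\<close>

lemma comps_dplot:
  assumes M: "smooth_atlas M" and f: "plot M f x" and \<mu>: "admissible M \<mu>" "f x \<in> fst \<mu>"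
  shows "comps M \<mu> (f x) (dplot M f x v) = fd (\<lambda>y. snd \<mu> (f y)) x v"
proof -
  let ?b = "base_chart M (f x)"
  have b: "?b \<in> atlas M" "f x \<in> fst ?b" using base_chart[OF plot_in_atlas[OF f]] by auto
  have ab: "admissible M ?b" using admissible_atlas[OF M b(1)] .
  then have inj: "inj_on (snd ?b) (fst ?b)" by (simp add: admissible_def)
  have xb: "snd ?b (f x) \<in> snd ?b ` fst ?b" using b(2) by blast
  have s: "smooth_near (snd ?b (f x)) (\<lambda>y. snd \<mu> (chart_inv ?b y))"
    using plot_chart(2)[OF M plot_chart_inv[OF M ab xb] \<mu>(1)] \<mu>(2) chart_inv_chart[OF inj b(2)] by simp
  have "fd (\<lambda>y. snd \<mu> (f y)) x v = fd (\<lambda>y. (\<lambda>z. snd \<mu> (chart_inv ?b z)) (snd ?b (f y))) x v"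
    by (rule fun_cong[OF fd_cong])
       (use plot_base_chart(1)[OF M f] in eventually_elim, simp add: chart_inv_chart[OF inj])
  also have "\<dots> = fd (\<lambda>z. snd \<mu> (chart_inv ?b z)) (snd ?b (f x)) (fd (\<lambda>y. snd ?b (f y)) x v)"
    by (rule fd_chain[OF smooth_near_differentiable[OF s] smooth_near_differentiable[OF plot_base_chart(2)[OF M f]]])
  finally show ?thesis by (simp add: comps_def dplot_def o_def)
qed

lemma smooth_at_plot:
  assumes M: "smooth_atlas M" and f: "plot M f x" and h: "smooth_at M N h (f x)"
  shows "plot N (\<lambda>y. h (f y)) x"
proof (rule plot_cong)
  let ?b = "base_chart M (f x)"
  show "plot N (\<lambda>y. h (chart_inv ?b (snd ?b (f y)))) x"
    by (rule plot_reparam[OF h[unfolded smooth_at_def] plot_base_chart(2)[OF M f]])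
  have inj: "inj_on (snd ?b) (fst ?b)"
    using M base_chart(1)[OF plot_in_atlas[OF f]] by (simp add: smooth_atlas_def)
  show "\<forall>\<^sub>F y in nhds x. h (chart_inv ?b (snd ?b (f y))) = h (f y)"
    using plot_base_chart(1)[OF M f] by eventually_elim (simp add: chart_inv_chart[OF inj])
qed

lemma tangent_map_eq_dplot:
  assumes M: "smooth_atlas M" and p: "p \<in> (\<Union>\<kappa>\<in>atlas M. fst \<kappa>)"
  shows "tangent_map M N h p v =
    dplot N (\<lambda>x. h (chart_inv (base_chart M p) x)) (snd (base_chart M p) p) v"
proof -
  have "chart_inv (base_chart M p) (snd (base_chart M p) p) = p"
    using base_chart[OF p] M by (auto simp: smooth_atlas_def intro: chart_inv_chart)
  then show ?thesis by (simp add: tangent_map_def dplot_def o_def)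
qed

text \<open>The chain rule; only the plot in \<open>smooth_at\<close> has to be differentiated.\<close>

lemma tangent_map_dplot:
  assumes M: "smooth_atlas M" and N: "smooth_atlas N" and f: "plot M f x" and h: "smooth_at M N h (f x)"
  shows "tangent_map M N h (f x) (dplot M f x v) = dplot N (\<lambda>y. h (f y)) x v"
proof -
  let ?b = "base_chart M (f x)"
  have inj: "inj_on (snd ?b) (fst ?b)"
    using M base_chart(1)[OF plot_in_atlas[OF f]] by (simp add: smooth_atlas_def)
  have "tangent_map M N h (f x) (dplot M f x v)
      = dplot N (\<lambda>x. h (chart_inv ?b x)) (snd ?b (f x)) (fd (\<lambda>y. snd ?b (f y)) x v)"
    by (simp add: tangent_map_eq_dplot[OF M plot_in_atlas[OF f]] dplot_def[of M])
  also have "\<dots> = dplot N (\<lambda>y. h (chart_inv ?b (snd ?b (f y)))) x v"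
    by (rule dplot_reparam[symmetric, OF N h[unfolded smooth_at_def] plot_base_chart(2)[OF M f]])
  also have "\<dots> = dplot N (\<lambda>y. h (f y)) x v"
    by (rule fun_cong[OF dplot_cong])
       (use plot_base_chart(1)[OF M f] in eventually_elim, simp add: chart_inv_chart[OF inj])
  finally show ?thesis .
qed

lemma dplot_base_chart_inv:
  assumes M: "smooth_atlas M" and p: "p \<in> (\<Union>\<kappa>\<in>atlas M. fst \<kappa>)"
  shows "dplot M (chart_inv (base_chart M p)) (snd (base_chart M p) p) v = v"
proof -
  let ?b = "base_chart M p"
  have b: "?b \<in> atlas M" "p \<in> fst ?b" using base_chart[OF p] by auto
  then have ab: "admissible M ?b" using admissible_atlas[OF M] by blast
  then have i: "chart_inv ?b (snd ?b p) = p" using b(2) by (auto simp: admissible_def chart_inv_chart)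
  have "fd (\<lambda>x. snd ?b (chart_inv ?b x)) (snd ?b p) = fd (\<lambda>x. x) (snd ?b p)"
    by (rule fd_cong[OF eventually_chart_chart_inv[OF ab]]) (use b(2) in auto)
  then show ?thesis by (simp add: dplot_def i)
qed

lemma comps_dplot_chart_inv:
  assumes M: "smooth_atlas M" and \<kappa>: "admissible M \<kappa>" "x \<in> snd \<kappa> ` fst \<kappa>"
  shows "comps M \<kappa> (chart_inv \<kappa> x) (dplot M (chart_inv \<kappa>) x v) = v"
proof -
  have "comps M \<kappa> (chart_inv \<kappa> x) (dplot M (chart_inv \<kappa>) x v) = fd (\<lambda>y. snd \<kappa> (chart_inv \<kappa> y)) x v"
    by (rule comps_dplot[OF M plot_chart_inv[OF M \<kappa>] \<kappa>(1) chart_inv_in[OF \<kappa>(2)]])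
  also have "fd (\<lambda>y. snd \<kappa> (chart_inv \<kappa> y)) x = fd (\<lambda>y. y) x"
    by (rule fd_cong[OF eventually_chart_chart_inv[OF \<kappa>]])
  finally show ?thesis by simp
qed

text \<open>With this rule an arbitrary tangent vector can be treated as the derivative of a plot.\<close>

lemma dplot_chart_inv_comps:
  assumes M: "smooth_atlas M" and \<kappa>: "admissible M \<kappa>" "p \<in> fst \<kappa>"
  shows "dplot M (chart_inv \<kappa>) (snd \<kappa> p) (comps M \<kappa> p v) = v"
proof -
  let ?b = "base_chart M p"
  have p: "p \<in> (\<Union>\<kappa>\<in>atlas M. fst \<kappa>)" using \<kappa> by (auto simp: admissible_def)
  have b: "?b \<in> atlas M" "p \<in> fst ?b" using base_chart[OF p] by auto
  then have ab: "admissible M ?b" using admissible_atlas[OF M] by blast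
  have ib: "chart_inv ?b (snd ?b p) = p" using ab b(2) by (auto simp: admissible_def chart_inv_chart)
  have inj: "inj_on (snd \<kappa>) (fst \<kappa>)" using \<kappa>(1) by (simp add: admissible_def)
  have pb: "plot M (chart_inv ?b) (snd ?b p)" using plot_chart_inv[OF M ab] b(2) by blast
  have s: "smooth_near (snd ?b p) (\<lambda>x. snd \<kappa> (chart_inv ?b x))"
    and e: "\<forall>\<^sub>F x in nhds (snd ?b p). chart_inv ?b x \<in> fst \<kappa>"
    using plot_chart[OF M pb \<kappa>(1)] ib \<kappa>(2) by auto
  have pk: "plot M (chart_inv \<kappa>) (snd \<kappa> (chart_inv ?b (snd ?b p)))"
    using plot_chart_inv[OF M \<kappa>(1)] \<kappa>(2) ib by auto
  have "dplot M (chart_inv \<kappa>) (snd \<kappa> p) (comps M \<kappa> p v) =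
     dplot M (\<lambda>x. chart_inv \<kappa> (snd \<kappa> (chart_inv ?b x))) (snd ?b p) v"
    using dplot_reparam[OF M pk s, of v] by (simp add: ib comps_def o_def)
  also have "dplot M (\<lambda>x. chart_inv \<kappa> (snd \<kappa> (chart_inv ?b x))) (snd ?b p) = dplot M (chart_inv ?b) (snd ?b p)"
    by (rule dplot_cong) (use e in eventually_elim, simp add: chart_inv_chart[OF inj])
  finally show ?thesis using dplot_base_chart_inv[OF M p] by simp
qed

lemma comps_linear:
  assumes M: "smooth_atlas M" and \<kappa>: "admissible M \<kappa>" "p \<in> fst \<kappa>"
  shows "linear (comps M \<kappa> p)"
proof -
  let ?b = "base_chart M p"
  have p: "p \<in> (\<Union>\<kappa>\<in>atlas M. fst \<kappa>)" using \<kappa> by (auto simp: admissible_def)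
  have b: "?b \<in> atlas M" "p \<in> fst ?b" using base_chart[OF p] by auto
  then have ab: "admissible M ?b" using admissible_atlas[OF M] by blast
  have ib: "chart_inv ?b (snd ?b p) = p" using ab b(2) by (auto simp: admissible_def chart_inv_chart)
  have pb: "plot M (chart_inv ?b) (snd ?b p)" using plot_chart_inv[OF M ab] b(2) by blast
  have "smooth_near (snd ?b p) (\<lambda>x. snd \<kappa> (chart_inv ?b x))"
    using plot_chart[OF M pb \<kappa>(1)] ib \<kappa>(2) by auto
  from smooth_near_linear[OF this] show ?thesis by (simp add: comps_def[abs_def] o_def)
qed

lemma comps_inj:
  assumes "smooth_atlas M" "admissible M \<kappa>" "p \<in> fst \<kappa>" "comps M \<kappa> p u = comps M \<kappa> p v"
  shows "u = v"
  using dplot_chart_inv_comps[OF assms(1-3)] assms(4) by metis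

lemma smooth_map_plot:
  assumes h: "smooth_map M N h" and M: "open_charts M"
    and N: "\<Union>(fst ` atlas N) = topspace (mtop N)" "\<And>\<mu>. \<mu> \<in> atlas N \<Longrightarrow> openin (mtop N) (fst \<mu>)"
    and f: "plot M f x"
  shows "plot N (\<lambda>y. h (f y)) x"
proof -
  obtain \<kappa> where k: "\<kappa> \<in> atlas M" "\<forall>\<^sub>F y in nhds x. f y \<in> fst \<kappa>" "smooth_near x (\<lambda>y. snd \<kappa> (f y))"
    using f by (auto simp: plot_def)
  have x: "f x \<in> fst \<kappa>" using k(2) eventually_nhds_x_imp_x by fast
  have inj: "inj_on (snd \<kappa>) (fst \<kappa>)" "fst \<kappa> \<subseteq> topspace (mtop M)"
    using k(1) M by (auto simp: open_charts_def)
  have cont: "continuous_map (mtop M) (mtop N) h" using h by (simp add: smooth_map_def)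
  then have "h (f x) \<in> topspace (mtop N)" using x inj(2) continuous_map_image_subset_topspace by blast
  then obtain \<mu> where m: "\<mu> \<in> atlas N" "h (f x) \<in> fst \<mu>" using N(1) by blast
  let ?O = "snd \<kappa> ` (fst \<kappa> \<inter> h -` fst \<mu>)"
  have "openin (mtop M) {p \<in> topspace (mtop M). h p \<in> fst \<mu>}"
    using cont N(2)[OF m(1)] openin_continuous_map_preimage by blast
  moreover have "fst \<kappa> \<inter> {p \<in> topspace (mtop M). h p \<in> fst \<mu>} = fst \<kappa> \<inter> h -` fst \<mu>" using inj(2) by auto
  ultimately have O: "open ?O" using M k(1) unfolding open_charts_def by metis
  have sO: "smooth_on ?O (snd \<mu> \<circ> h \<circ> chart_inv \<kappa>)" using h k(1) m(1) by (auto simp: smooth_map_def)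
  have xO: "snd \<kappa> (f x) \<in> ?O" using x m(2) by auto
  have ev: "\<forall>\<^sub>F y in nhds x. snd \<kappa> (f y) \<in> ?O"
    using smooth_near_tendsto[OF k(3)] O xO topological_tendstoD by blast
  have "\<forall>\<^sub>F y in nhds x. h (f y) \<in> fst \<mu>"
    using ev k(2) by eventually_elim (use inj in \<open>auto dest: inj_onD\<close>)
  moreover have "smooth_near x (\<lambda>y. snd \<mu> (h (f y)))"
  proof (rule smooth_near_cong)
    show "smooth_near x (\<lambda>y. (snd \<mu> \<circ> h \<circ> chart_inv \<kappa>) (snd \<kappa> (f y)))"
      by (rule smooth_near_compose[OF smooth_nearI[OF O xO sO] k(3)])
    show "\<forall>\<^sub>F y in nhds x. (snd \<mu> \<circ> h \<circ> chart_inv \<kappa>) (snd \<kappa> (f y)) = snd \<mu> (h (f y))"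
      using k(2) by eventually_elim (simp add: chart_inv_chart[OF inj(1)])
  qed
  ultimately show ?thesis using m(1) by (auto simp: plot_def)
qed

lemma smooth_manifold_cover: "smooth_manifold M \<Longrightarrow> \<Union>(fst ` atlas M) = topspace (mtop M)"
  by (simp add: smooth_manifold_def)

lemma smooth_map_plot_manifold:
  assumes "smooth_map M N h" "smooth_manifold M" "smooth_manifold N" "plot M f x"
  shows "plot N (\<lambda>y. h (f y)) x"
  by (rule smooth_map_plot[OF assms(1) open_charts_smooth_manifold[OF assms(2)]
     smooth_manifold_cover[OF assms(3)] smooth_manifold_openin_chart[OF assms(3)] assms(4)])

lemma smooth_map_smooth_at:
  assumes "smooth_map M N h" "smooth_manifold M" "smooth_manifold N" "p \<in> topspace (mtop M)"
  shows "smooth_at M N h p"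
proof -
  have p: "p \<in> (\<Union>\<kappa>\<in>atlas M. fst \<kappa>)" using assms(2,4) smooth_manifold_cover by blast
  have M: "smooth_atlas M" using assms(2) by (rule smooth_atlas_smooth_manifold)
  show ?thesis unfolding smooth_at_def
    by (rule smooth_map_plot_manifold[OF assms(1-3)], rule plot_chart_inv[OF M admissible_atlas[OF M]])
       (use base_chart[OF p] in auto)
qed

lemma open_charts_euclid: "open J \<Longrightarrow> open_charts (euclid J)"
  by (auto simp: open_charts_def euclid_def openin_subtopology intro!: open_Int)

lemma plot_euclid: "open J \<Longrightarrow> t \<in> J \<Longrightarrow> plot (euclid J) (\<lambda>s. s) t"
  unfolding plot_def euclid_def by (auto simp: smooth_near_ident eventually_nhds)

lemma smooth_curve_plot:
  assumes "smooth_curve M J c" "open J" "t \<in> J"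
    and "\<Union>(fst ` atlas M) = topspace (mtop M)" "\<And>\<mu>. \<mu> \<in> atlas M \<Longrightarrow> openin (mtop M) (fst \<mu>)"
  shows "plot M c t"
  using smooth_map_plot[OF assms(1)[unfolded smooth_curve_def]
    open_charts_euclid[OF assms(2)] assms(4,5) plot_euclid[OF assms(2,3)]] .

lemma smooth_curve_plot_manifold:
  "smooth_curve M J c \<Longrightarrow> open J \<Longrightarrow> t \<in> J \<Longrightarrow> smooth_manifold M \<Longrightarrow> plot M c t"
  by (rule smooth_curve_plot) (auto simp: smooth_manifold_cover smooth_manifold_openin_chart)

text \<open>The curve is continuous because each plot is continuous in a chart and the chart images of open sets
are open.\<close>

lemma plot_smooth_curve:
  assumes M: "smooth_atlas M" "open_charts M" and J: "open J" and c: "\<And>t. t \<in> J \<Longrightarrow> plot M c t"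
  shows "smooth_curve M J c"
  unfolding smooth_curve_def smooth_map_def
proof (intro conjI ballI)
  have inM: "c t \<in> topspace (mtop M)" if "t \<in> J" for t
    using plot_in_atlas[OF c[OF that]] M(2) by (auto simp: open_charts_def)
  have op: "open {t \<in> J. c t \<in> U}" if U: "openin (mtop M) U" for U
  proof (subst open_subopen, safe)
    fix t assume t: "t \<in> J" "c t \<in> U"
    obtain \<kappa> where k: "\<kappa> \<in> atlas M" "\<forall>\<^sub>F y in nhds t. c y \<in> fst \<kappa>" "smooth_near t (\<lambda>y. snd \<kappa> (c y))"
      using c[OF t(1)] by (auto simp: plot_def)
    have x: "c t \<in> fst \<kappa>" using k(2) eventually_nhds_x_imp_x by fast
    have O: "open (snd \<kappa> ` (fst \<kappa> \<inter> U))" "inj_on (snd \<kappa>) (fst \<kappa>)" using M(2) k(1) U by (auto simp: open_charts_def)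
    have "\<forall>\<^sub>F y in nhds t. snd \<kappa> (c y) \<in> snd \<kappa> ` (fst \<kappa> \<inter> U)"
      using smooth_near_tendsto[OF k(3)] O(1) x t(2) topological_tendstoD by blast
    moreover have "\<forall>\<^sub>F y in nhds t. y \<in> J" using J t(1) eventually_nhds by blast
    ultimately have "\<forall>\<^sub>F y in nhds t. y \<in> J \<and> c y \<in> U"
      using k(2) by eventually_elim (use O(2) in \<open>auto dest: inj_onD\<close>)
    then show "\<exists>T. open T \<and> t \<in> T \<and> T \<subseteq> {t \<in> J. c t \<in> U}" unfolding eventually_nhds by blast
  qed
  have "openin (top_of_set J) {t \<in> J. c t \<in> U}" if "openin (mtop M) U" for U
    using op[OF that] J by (auto simp: openin_open_eq)
  then show "continuous_map (mtop (euclid J)) (mtop M) c"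
    using inM by (auto simp: continuous_map_def euclid_def)
  fix \<kappa> \<mu> assume k: "\<kappa> \<in> atlas (euclid J)" and m: "\<mu> \<in> atlas M"
  have k: "\<kappa> = (J, id)" using k by (simp add: euclid_def)
  have am: "admissible M \<mu>" using admissible_atlas[OF M(1) m] .
  let ?O = "J \<inter> c -` fst \<mu>"
  have "\<exists>T. open T \<and> t \<in> T \<and> T \<subseteq> ?O" if "t \<in> ?O" for t
  proof -
    have "\<forall>\<^sub>F y in nhds t. c y \<in> fst \<mu>" using plot_chart(1)[OF M(1) c am] that by blast
    moreover have "\<forall>\<^sub>F y in nhds t. y \<in> J" using J that eventually_nhds by blast
    ultimately have "\<forall>\<^sub>F y in nhds t. y \<in> ?O" by eventually_elim simp
    then show ?thesis unfolding eventually_nhds by blast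
  qed
  then have O: "open ?O" by (subst open_subopen) blast
  have "smooth_on ?O (snd \<mu> \<circ> c \<circ> chart_inv (J, id))"
  proof (rule smooth_on_local[OF O])
    fix t assume t: "t \<in> ?O"
    show "smooth_near t (snd \<mu> \<circ> c \<circ> chart_inv (J, id))"
    proof (rule smooth_near_cong)
      show "smooth_near t (\<lambda>y. snd \<mu> (c y))" using plot_chart(2)[OF M(1) c am] t by blast
      have "\<forall>\<^sub>F y in nhds t. y \<in> J" using J t eventually_nhds by blast
      then show "\<forall>\<^sub>F y in nhds t. snd \<mu> (c y) = (snd \<mu> \<circ> c \<circ> chart_inv (J, id)) y"
        by eventually_elim (use inv_into_f_f[of id J] in \<open>simp add: chart_inv_def\<close>)
    qed
  qed
  then show "smooth_on (snd \<kappa> ` (fst \<kappa> \<inter> c -` fst \<mu>)) (snd \<mu> \<circ> c \<circ> chart_inv \<kappa>)" by (simp add: k)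
qed

lemma fd_vector_derivative: "f differentiable (at t) \<Longrightarrow> fd f t v = v *\<^sub>R vector_derivative f (at t)"
  using frechet_derivative_eq_vector_derivative[of f t] by simp

lemma velocity_eq_dplot:
  assumes "smooth_atlas M" "plot M c t"
  shows "velocity M c t = dplot M c t 1"
  using fd_vector_derivative[OF smooth_near_differentiable[OF plot_base_chart(2)[OF assms]], of 1]
  by (simp add: velocity_def dplot_def o_def)

section \<open>The slit tangent bundle and the transformation law of sprays\<close>

text \<open>The tangent charts cut down to nonzero vectors; for \<open>\<kappa>\<close> in the atlas these form the atlas of the slit
tangent bundle.\<close>

definition slit_chart :: "('p, 'e::euclidean_space) manifold \<Rightarrow> ('p, 'e) chart \<Rightarrow> ('p \<times> 'e, 'e \<times> 'e) chart" where
  "slit_chart M \<kappa> = (fst \<kappa> \<times> (UNIV - {0}), snd (tangent_chart M \<kappa>))"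

text \<open>The lift of a plot to the tangent bundle. Its coordinate expression is the prolongation of the
coordinate expression of the plot, as \<open>slit_chart_tplot\<close> shows below.\<close>

definition tplot :: "('p, 'e::euclidean_space) manifold \<Rightarrow> ('u::euclidean_space \<Rightarrow> 'p) \<Rightarrow> 'u \<times> 'u \<Rightarrow> 'p \<times> 'e" where
  "tplot M f = (\<lambda>(x, w). (f x, dplot M f x w))"

definition prolong :: "('u::real_normed_vector \<Rightarrow> 'e::real_normed_vector) \<Rightarrow> 'u \<times> 'u \<Rightarrow> 'e \<times> 'e" where
  "prolong f = (\<lambda>(x, w). (f x, fd f x w))"

lemma snd_slit_chart: "snd (slit_chart M \<kappa>) (p, v) = (snd \<kappa> p, comps M \<kappa> p v)"
  by (simp add: slit_chart_def tangent_chart_def)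

lemma fst_slit_chart: "fst (slit_chart M \<kappa>) = fst \<kappa> \<times> (UNIV - {0})"
  by (simp add: slit_chart_def)

lemma atlas_slit_tangent_bundle:
  assumes "open_charts M"
  shows "atlas (slit_tangent_bundle M) = slit_chart M ` atlas M"
proof -
  have "(fst (tangent_chart M \<kappa>) \<inter> topspace (mtop M) \<times> (UNIV - {0}), snd (tangent_chart M \<kappa>)) = slit_chart M \<kappa>"
    if "\<kappa> \<in> atlas M" for \<kappa>
    using assms that by (auto simp: open_charts_def slit_chart_def tangent_chart_def)
  then show ?thesis
    by (auto simp: slit_tangent_bundle_def open_submanifold_def tangent_bundle_def image_image)
qed

lemma smooth_near_prolong:
  fixes f :: "'u::euclidean_space \<Rightarrow> 'e::euclidean_space"
  assumes "smooth_near x f"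
  shows "smooth_near (x, w) (prolong f)"
proof -
  have "smooth_near (x, w) (\<lambda>z. (f (fst z), fd f (fst z) (snd z)))"
    by (intro smooth_near_Pair smooth_near_compose[of fst _ f] smooth_near_fd smooth_near_fst smooth_near_snd)
       (use assms in auto)
  then show ?thesis by (simp add: prolong_def case_prod_beta')
qed

text \<open>The second derivative that appears here is the source of the inhomogeneous term in the transformation
law of spray coefficients.\<close>

lemma prolong_has_derivative:
  fixes f :: "'u::euclidean_space \<Rightarrow> 'e::euclidean_space"
  assumes "smooth_near x f"
  shows "(prolong f has_derivative (\<lambda>(a, b). (fd f x a, fd2 f x a w + fd f x b))) (at (x, w))"
proof -
  have 1: "((\<lambda>z. fd f (fst z) (snd z)) has_derivative (\<lambda>z. fd2 f (fst (x, w)) (fst z) (snd (x, w)) + fd f (fst (x, w)) (snd z))) (at (x, w))"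
    by (rule has_derivative_fd_along) (use assms in \<open>auto intro!: derivative_eq_intros\<close>)
  have 2: "((\<lambda>z. f (fst z)) has_derivative (\<lambda>z. fd f x (fst z))) (at (x, w))"
    using diff_chain_at[OF bounded_linear_imp_has_derivative[OF bounded_linear_fst], of f "fd f x" "(x, w)"]
      smooth_near_has_derivative[OF assms]
    by (simp add: o_def)
  show ?thesis using has_derivative_Pair[OF 2 1] by (simp add: prolong_def case_prod_beta')
qed

lemma admissible_overlap_open:
  assumes M: "smooth_atlas M" and \<kappa>: "admissible M \<kappa>" and \<mu>: "admissible M \<mu>"
  shows "open (snd \<kappa> ` (fst \<kappa> \<inter> fst \<mu>))"
proof (subst open_subopen, safe)
  fix p assume p: "p \<in> fst \<kappa>" "p \<in> fst \<mu>"
  have i: "inj_on (snd \<kappa>) (fst \<kappa>)" "open (snd \<kappa> ` fst \<kappa>)" using \<kappa> by (auto simp: admissible_def)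
  have "\<forall>\<^sub>F y in nhds (snd \<kappa> p). chart_inv \<kappa> y \<in> fst \<mu>"
    using plot_chart(1)[OF M plot_chart_inv[OF M \<kappa>] \<mu>, of "snd \<kappa> p"] p chart_inv_chart[OF i(1)] by auto
  moreover have "\<forall>\<^sub>F y in nhds (snd \<kappa> p). y \<in> snd \<kappa> ` fst \<kappa>"
    using i(2) p eventually_nhds by blast
  ultimately have "\<forall>\<^sub>F y in nhds (snd \<kappa> p). y \<in> snd \<kappa> ` (fst \<kappa> \<inter> fst \<mu>)"
    by eventually_elim (metis IntI chart_chart_inv chart_inv_in imageI)
  then show "\<exists>T. open T \<and> snd \<kappa> p \<in> T \<and> T \<subseteq> snd \<kappa> ` (fst \<kappa> \<inter> fst \<mu>)"
    unfolding eventually_nhds by blast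
qed

lemma comps_eq_0_iff:
  assumes "smooth_atlas M" "admissible M \<kappa>" "p \<in> fst \<kappa>"
  shows "comps M \<kappa> p v = 0 \<longleftrightarrow> v = 0"
  using comps_inj[OF assms, of v 0] linear_0[OF comps_linear[OF assms]] by auto

lemma tplot_chart_inv_in:
  assumes M: "smooth_atlas M" and \<kappa>: "admissible M \<kappa>" and x: "x \<in> snd \<kappa> ` fst \<kappa>" and w: "w \<noteq> 0"
  shows "tplot M (chart_inv \<kappa>) (x, w) \<in> fst (slit_chart M \<kappa>)"
    "snd (slit_chart M \<kappa>) (tplot M (chart_inv \<kappa>) (x, w)) = (x, w)"
  using comps_dplot_chart_inv[OF M \<kappa> x, of w] comps_eq_0_iff[OF M \<kappa> chart_inv_in[OF x], of 0] w
    chart_inv_in[OF x] chart_chart_inv[OF x]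
  by (auto simp: tplot_def snd_slit_chart fst_slit_chart)

lemma slit_chart_inj:
  assumes M: "smooth_atlas M" and \<kappa>: "admissible M \<kappa>"
  shows "inj_on (snd (slit_chart M \<kappa>)) (fst \<kappa> \<times> UNIV)"
proof -
  have "inj_on (snd \<kappa>) (fst \<kappa>)" using \<kappa> by (auto simp: admissible_def)
  then show ?thesis
    by (auto simp: inj_on_def snd_slit_chart dest: comps_inj[OF M \<kappa>])
qed

lemma slit_chart_image:
  assumes M: "smooth_atlas M" and \<kappa>: "admissible M \<kappa>" and A: "A \<subseteq> fst \<kappa>"
  shows "snd (slit_chart M \<kappa>) ` (A \<times> (UNIV - {0})) = (snd \<kappa> ` A) \<times> (UNIV - {0})"
proof (intro equalityI subsetI)
  fix z assume "z \<in> snd (slit_chart M \<kappa>) ` (A \<times> (UNIV - {0}))"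
  then show "z \<in> (snd \<kappa> ` A) \<times> (UNIV - {0})"
    using A comps_eq_0_iff[OF M \<kappa>] by (auto simp: snd_slit_chart)
next
  fix z assume "z \<in> (snd \<kappa> ` A) \<times> (UNIV - {0::'b})"
  then obtain p w where z: "z = (snd \<kappa> p, w)" "p \<in> A" "w \<noteq> 0" by auto
  have "inj_on (snd \<kappa>) (fst \<kappa>)" using \<kappa> by (auto simp: admissible_def)
  then have "chart_inv \<kappa> (snd \<kappa> p) = p" by (rule chart_inv_chart) (use A z(2) in blast)
  then have t: "tplot M (chart_inv \<kappa>) (snd \<kappa> p, w) = (p, dplot M (chart_inv \<kappa>) (snd \<kappa> p) w)"
    by (simp add: tplot_def)
  have sp: "snd \<kappa> p \<in> snd \<kappa> ` fst \<kappa>" using z(2) A by blast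
  note in_s = tplot_chart_inv_in[OF M \<kappa> sp z(3), unfolded t]
  show "z \<in> snd (slit_chart M \<kappa>) ` (A \<times> (UNIV - {0}))"
  proof (rule image_eqI)
    show "z = snd (slit_chart M \<kappa>) (p, dplot M (chart_inv \<kappa>) (snd \<kappa> p) w)" using in_s(2) z(1) by simp
    show "(p, dplot M (chart_inv \<kappa>) (snd \<kappa> p) w) \<in> A \<times> (UNIV - {0})"
      using in_s(1) z(2) by (simp add: fst_slit_chart)
  qed
qed

lemma chart_inv_slit_chart:
  assumes M: "smooth_atlas M" and \<kappa>: "admissible M \<kappa>" and x: "x \<in> snd \<kappa> ` fst \<kappa>" and w: "w \<noteq> 0"
  shows "chart_inv (slit_chart M \<kappa>) (x, w) = tplot M (chart_inv \<kappa>) (x, w)"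
proof -
  have "inj_on (snd (slit_chart M \<kappa>)) (fst (slit_chart M \<kappa>))"
    using slit_chart_inj[OF M \<kappa>] by (rule inj_on_subset) (auto simp: fst_slit_chart)
  from chart_inv_chart[OF this tplot_chart_inv_in(1)[OF assms]] show ?thesis
    by (simp add: tplot_chart_inv_in(2)[OF assms])
qed

lemma chart_inv_slit_chart_prod:
  assumes "smooth_atlas M" "admissible M \<kappa>" "z \<in> snd \<kappa> ` fst \<kappa> \<times> (UNIV - {0})"
  shows "chart_inv (slit_chart M \<kappa>) z = tplot M (chart_inv \<kappa>) z"
  using chart_inv_slit_chart[OF assms(1,2), of "fst z" "snd z"] assms(3) by (auto simp: mem_Times_iff)

lemma chart_inv_tangent_chart:
  assumes M: "smooth_atlas M" and \<kappa>: "admissible M \<kappa>" and x: "x \<in> snd \<kappa> ` fst \<kappa>" and w: "w \<noteq> 0"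
  shows "chart_inv (tangent_chart M \<kappa>) (x, w) = tplot M (chart_inv \<kappa>) (x, w)"
proof -
  have e: "snd (tangent_chart M \<kappa>) = snd (slit_chart M \<kappa>)" "fst (tangent_chart M \<kappa>) = fst \<kappa> \<times> UNIV"
    by (auto simp: slit_chart_def tangent_chart_def)
  have "inj_on (snd (tangent_chart M \<kappa>)) (fst (tangent_chart M \<kappa>))"
    unfolding e using slit_chart_inj[OF M \<kappa>] by (rule inj_on_subset) auto
  from chart_inv_chart[OF this, of "tplot M (chart_inv \<kappa>) (x, w)"] tplot_chart_inv_in[OF assms]
  show ?thesis by (auto simp: e fst_slit_chart)
qed

lemma slit_chart_tplot:
  assumes M: "smooth_atlas M" and f: "plot M f x" and \<mu>: "admissible M \<mu>" "f x \<in> fst \<mu>"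
  shows "snd (slit_chart M \<mu>) (tplot M f (x, w)) = prolong (\<lambda>y. snd \<mu> (f y)) (x, w)"
  by (simp add: tplot_def prolong_def snd_slit_chart comps_dplot[OF assms])

lemma eventually_nhds_fst:
  fixes x :: "'u::euclidean_space" and w :: "'v::euclidean_space"
  assumes "\<forall>\<^sub>F y in nhds x. P y"
  shows "\<forall>\<^sub>F z in nhds (x, w). P (fst z)"
proof -
  have "filterlim fst (nhds x) (nhds (x, w))"
    using smooth_near_tendsto[OF smooth_near_fst[of "(x, w)"]] by simp
  from eventually_compose_filterlim[OF assms this] show ?thesis .
qed

lemma eventually_slit_chart_tplot:
  assumes M: "smooth_atlas M" and f: "plot M f x" and \<mu>: "admissible M \<mu>" "f x \<in> fst \<mu>"
  shows "\<forall>\<^sub>F z in nhds (x, w). f (fst z) \<in> fst \<mu> \<and> snd (slit_chart M \<mu>) (tplot M f z) = prolong (\<lambda>y. snd \<mu> (f y)) z"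
proof -
  have "\<forall>\<^sub>F y in nhds x. f y \<in> fst \<mu> \<and> (\<forall>w. snd (slit_chart M \<mu>) (tplot M f (y, w)) = prolong (\<lambda>y. snd \<mu> (f y)) (y, w))"
    using plot_chart(1)[OF assms] plot_eventually[OF f]
    by eventually_elim (use slit_chart_tplot[OF M _ \<mu>(1)] in blast)
  from eventually_nhds_fst[OF this, of w] show ?thesis by eventually_elim auto
qed

lemma smooth_near_slit_chart_tplot:
  assumes M: "smooth_atlas M" and f: "plot M f x" and \<mu>: "admissible M \<mu>" "f x \<in> fst \<mu>"
  shows "smooth_near (x, w) (\<lambda>z. snd (slit_chart M \<mu>) (tplot M f z))"
proof (rule smooth_near_cong[OF smooth_near_prolong])
  show "smooth_near x (\<lambda>y. snd \<mu> (f y))" by (rule plot_chart(2)[OF assms])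
  show "\<forall>\<^sub>F z in nhds (x, w). prolong (\<lambda>y. snd \<mu> (f y)) z = snd (slit_chart M \<mu>) (tplot M f z)"
    using eventually_slit_chart_tplot[OF assms] by eventually_elim simp
qed

text \<open>All smoothness statements on the slit tangent bundle are reduced to this one.\<close>

lemma plot_tplot:
  assumes M: "smooth_atlas M" "open_charts M" and f: "plot M f x" and w: "dplot M f x w \<noteq> 0"
  shows "plot (slit_tangent_bundle M) (tplot M f) (x, w)"
proof -
  let ?b = "base_chart M (f x)"
  have b: "?b \<in> atlas M" "f x \<in> fst ?b" using base_chart[OF plot_in_atlas[OF f]] by auto
  have ab: "admissible M ?b" using admissible_atlas[OF M(1) b(1)] .
  have s: "smooth_near (x, w) (\<lambda>z. snd (slit_chart M ?b) (tplot M f z))"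
    by (rule smooth_near_slit_chart_tplot[OF M(1) f ab b(2)])
  have "snd (snd (slit_chart M ?b) (tplot M f (x, w))) \<noteq> 0"
    using comps_eq_0_iff[OF M(1) ab b(2)] w by (simp add: tplot_def snd_slit_chart)
  then have "\<forall>\<^sub>F z in nhds (x, w). snd (snd (slit_chart M ?b) (tplot M f z)) \<noteq> 0"
    using tendsto_imp_eventually_ne[OF tendsto_snd[OF smooth_near_tendsto[OF s]]] by blast
  moreover have "\<forall>\<^sub>F z in nhds (x, w). f (fst z) \<in> fst ?b"
    using eventually_slit_chart_tplot[OF M(1) f ab b(2)] by eventually_elim simp
  ultimately have "\<forall>\<^sub>F z in nhds (x, w). tplot M f z \<in> fst (slit_chart M ?b)"
    by eventually_elim
      (use comps_eq_0_iff[OF M(1) ab] in \<open>auto simp: tplot_def snd_slit_chart fst_slit_chart split: prod.splits\<close>)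
  with s b(1) show ?thesis
    unfolding plot_def atlas_slit_tangent_bundle[OF M(2)] by auto
qed

text \<open>Transition maps of the slit tangent bundle are prolongations of transition maps of the base.\<close>

lemma slit_chart_transition:
  assumes M: "smooth_atlas M" and \<kappa>: "admissible M \<kappa>" and \<mu>: "admissible M \<mu>"
  shows "open (snd (slit_chart M \<kappa>) ` (fst (slit_chart M \<kappa>) \<inter> fst (slit_chart M \<mu>)))"
    "smooth_on (snd (slit_chart M \<kappa>) ` (fst (slit_chart M \<kappa>) \<inter> fst (slit_chart M \<mu>)))
       (snd (slit_chart M \<mu>) \<circ> chart_inv (slit_chart M \<kappa>))"
proof -
  let ?A = "snd \<kappa> ` (fst \<kappa> \<inter> fst \<mu>)"
  have d: "fst (slit_chart M \<kappa>) \<inter> fst (slit_chart M \<mu>) = (fst \<kappa> \<inter> fst \<mu>) \<times> (UNIV - {0})"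
    by (auto simp: fst_slit_chart)
  have O: "open (?A \<times> (UNIV - {0::'b}))"
    by (intro open_Times admissible_overlap_open[OF assms]) auto
  have i: "snd (slit_chart M \<kappa>) ` (fst (slit_chart M \<kappa>) \<inter> fst (slit_chart M \<mu>)) = ?A \<times> (UNIV - {0})"
    unfolding d by (rule slit_chart_image[OF M \<kappa>]) auto
  show "open (snd (slit_chart M \<kappa>) ` (fst (slit_chart M \<kappa>) \<inter> fst (slit_chart M \<mu>)))"
    unfolding i by (rule O)
  show "smooth_on (snd (slit_chart M \<kappa>) ` (fst (slit_chart M \<kappa>) \<inter> fst (slit_chart M \<mu>)))
       (snd (slit_chart M \<mu>) \<circ> chart_inv (slit_chart M \<kappa>))"
    unfolding i
  proof (rule smooth_on_local[OF O])
    fix z assume z: "z \<in> ?A \<times> (UNIV - {0::'b})"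
    then obtain x w where z': "z = (x, w)" "x \<in> ?A" by auto
    have inj: "inj_on (snd \<kappa>) (fst \<kappa>)" using \<kappa> by (auto simp: admissible_def)
    have x: "x \<in> snd \<kappa> ` fst \<kappa>" "chart_inv \<kappa> x \<in> fst \<mu>" using z'(2) chart_inv_chart[OF inj] by auto
    have s: "smooth_near z (\<lambda>z. snd (slit_chart M \<mu>) (tplot M (chart_inv \<kappa>) z))"
      unfolding z'(1) by (rule smooth_near_slit_chart_tplot[OF M plot_chart_inv[OF M \<kappa> x(1)] \<mu> x(2)])
    show "smooth_near z (snd (slit_chart M \<mu>) \<circ> chart_inv (slit_chart M \<kappa>))"
    proof (rule smooth_near_cong[OF s])
      have "\<forall>\<^sub>F y in nhds z. y \<in> ?A \<times> (UNIV - {0::'b})" using O z eventually_nhds by blast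
      then show "\<forall>\<^sub>F y in nhds z. snd (slit_chart M \<mu>) (tplot M (chart_inv \<kappa>) y) =
          (snd (slit_chart M \<mu>) \<circ> chart_inv (slit_chart M \<kappa>)) y"
        by eventually_elim (subst o_apply, subst chart_inv_slit_chart_prod[OF M \<kappa>], auto)
    qed
  qed
qed

lemma admissible_slit_chart:
  assumes M: "smooth_atlas M" "open_charts M" and \<kappa>: "admissible M \<kappa>"
  shows "admissible (slit_tangent_bundle M) (slit_chart M \<kappa>)"
  unfolding admissible_def atlas_slit_tangent_bundle[OF M(2)]
proof (intro conjI)
  show "inj_on (snd (slit_chart M \<kappa>)) (fst (slit_chart M \<kappa>))"
    using slit_chart_inj[OF M(1) \<kappa>] by (rule inj_on_subset) (auto simp: fst_slit_chart)
  show "open (snd (slit_chart M \<kappa>) ` fst (slit_chart M \<kappa>))"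
    unfolding fst_slit_chart slit_chart_image[OF M(1) \<kappa> subset_refl]
    using \<kappa> by (intro open_Times) (auto simp: admissible_def)
  show "fst (slit_chart M \<kappa>) \<subseteq> (\<Union>\<mu>\<in>slit_chart M ` atlas M. fst \<mu>)"
    using \<kappa> by (auto simp: fst_slit_chart admissible_def)
  show "\<forall>\<mu>\<in>slit_chart M ` atlas M. open (snd (slit_chart M \<kappa>) ` (fst (slit_chart M \<kappa>) \<inter> fst \<mu>)) \<and>
       open (snd \<mu> ` (fst \<mu> \<inter> fst (slit_chart M \<kappa>))) \<and> compatible (slit_chart M \<kappa>) \<mu>"
  proof (intro ballI)
    fix \<nu> assume "\<nu> \<in> slit_chart M ` atlas M"
    then obtain \<mu> where \<nu>: "\<nu> = slit_chart M \<mu>" and \<mu>: "admissible M \<mu>"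
      using admissible_atlas[OF M(1)] by blast
    show "open (snd (slit_chart M \<kappa>) ` (fst (slit_chart M \<kappa>) \<inter> fst \<nu>)) \<and>
       open (snd \<nu> ` (fst \<nu> \<inter> fst (slit_chart M \<kappa>))) \<and> compatible (slit_chart M \<kappa>) \<nu>"
      using slit_chart_transition[OF M(1) \<kappa> \<mu>] slit_chart_transition[OF M(1) \<mu> \<kappa>]
      by (simp add: compatible_def Int_commute \<nu>)
  qed
qed

lemma smooth_atlas_slit_tangent_bundle:
  assumes M: "smooth_atlas M" "open_charts M"
  shows "smooth_atlas (slit_tangent_bundle M)"
  unfolding smooth_atlas_def
proof (intro ballI conjI)
  fix \<kappa> assume "\<kappa> \<in> atlas (slit_tangent_bundle M)"
  then have a: "admissible (slit_tangent_bundle M) \<kappa>"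
    using admissible_slit_chart[OF M admissible_atlas[OF M(1)]] by (auto simp: atlas_slit_tangent_bundle[OF M(2)])
  show "inj_on (snd \<kappa>) (fst \<kappa>)" "open (snd \<kappa> ` fst \<kappa>)" using a by (auto simp: admissible_def)
  fix \<mu> assume "\<mu> \<in> atlas (slit_tangent_bundle M)"
  then show "open (snd \<kappa> ` (fst \<kappa> \<inter> fst \<mu>))" "compatible \<kappa> \<mu>" using a by (auto simp: admissible_def)
qed

text \<open>It is enough to look at the sets that generate the topology: in a chart they become preimages of open sets
under transition maps. Injectivity of the chart takes care of finite intersections.\<close>

lemma open_charts_slit_tangent_bundle:
  assumes M: "smooth_atlas M" "open_charts M"
  shows "open_charts (slit_tangent_bundle M)"
proof -
  define B where "B = {fst (tangent_chart M \<kappa>) \<inter> snd (tangent_chart M \<kappa>) -` B | \<kappa> B. \<kappa> \<in> atlas M \<and> open B}"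
  have top: "mtop (slit_tangent_bundle M) = subtopology (topology_generated_by B) (topspace (mtop M) \<times> (UNIV - {0}))"
    by (simp add: slit_tangent_bundle_def open_submanifold_def tangent_bundle_def B_def)
  have inB: "fst \<kappa> \<times> UNIV \<subseteq> \<Union>B" if "\<kappa> \<in> atlas M" for \<kappa>
  proof -
    have "fst (tangent_chart M \<kappa>) \<inter> snd (tangent_chart M \<kappa>) -` UNIV \<in> B"
      using that unfolding B_def by blast
    then show ?thesis by (auto simp: tangent_chart_def)
  qed
  have gen: "open (snd (slit_chart M \<kappa>) ` (fst (slit_chart M \<kappa>) \<inter> V))"
    if "generate_topology_on B V" and k: "\<kappa> \<in> atlas M" for V \<kappa>
    using that(1)
  proof induction
    case Empty
    then show ?case by simp
  next
    case (Int a b)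
    have "inj_on (snd (slit_chart M \<kappa>)) (fst (slit_chart M \<kappa>))"
      using slit_chart_inj[OF M(1) admissible_atlas[OF M(1) k]] by (rule inj_on_subset) (auto simp: fst_slit_chart)
    then have "snd (slit_chart M \<kappa>) ` (fst (slit_chart M \<kappa>) \<inter> (a \<inter> b)) =
       snd (slit_chart M \<kappa>) ` (fst (slit_chart M \<kappa>) \<inter> a) \<inter> snd (slit_chart M \<kappa>) ` (fst (slit_chart M \<kappa>) \<inter> b)"
      by (subst inj_on_image_Int[symmetric]) (auto intro: arg_cong[where f = "\<lambda>X. _ ` X"])
    then show ?case using Int by auto
  next
    case (UN K)
    have "snd (slit_chart M \<kappa>) ` (fst (slit_chart M \<kappa>) \<inter> \<Union>K) =
      (\<Union>k\<in>K. snd (slit_chart M \<kappa>) ` (fst (slit_chart M \<kappa>) \<inter> k))" by blast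
    then show ?case using UN by auto
  next
    case (Basis s)
    then obtain \<mu> C where s: "s = fst (tangent_chart M \<mu>) \<inter> snd (tangent_chart M \<mu>) -` C" "\<mu> \<in> atlas M" "open C"
      by (auto simp: B_def)
    have \<kappa>: "admissible M \<kappa>" and \<mu>: "admissible M \<mu>" using admissible_atlas[OF M(1)] k s(2) by auto
    let ?O = "snd (slit_chart M \<kappa>) ` (fst (slit_chart M \<kappa>) \<inter> fst (slit_chart M \<mu>))"
    let ?t = "snd (slit_chart M \<mu>) \<circ> chart_inv (slit_chart M \<kappa>)"
    have inj: "inj_on (snd (slit_chart M \<kappa>)) (fst (slit_chart M \<kappa>))"
      using slit_chart_inj[OF M(1) \<kappa>] by (rule inj_on_subset) (auto simp: fst_slit_chart)
    have "continuous_on ?O ?t"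
      using slit_chart_transition(2)[OF M(1) \<kappa> \<mu>] unfolding smooth_on_def by (metis ck_on.simps(1))
    then have "open (?O \<inter> ?t -` C)"
      using slit_chart_transition(1)[OF M(1) \<kappa> \<mu>] s(3) by (simp add: continuous_on_open_vimage Int_commute o_def)
    moreover have "snd (slit_chart M \<kappa>) ` (fst (slit_chart M \<kappa>) \<inter> s) = ?O \<inter> ?t -` C"
    proof -
      have "snd (tangent_chart M \<mu>) = snd (slit_chart M \<mu>)" by (simp add: slit_chart_def)
      then have "fst (slit_chart M \<kappa>) \<inter> s = {z \<in> fst (slit_chart M \<kappa>) \<inter> fst (slit_chart M \<mu>). snd (slit_chart M \<mu>) z \<in> C}"
        unfolding s(1) by (auto simp: fst_slit_chart tangent_chart_def)
      then show ?thesis using chart_inv_chart[OF inj] by auto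
    qed
    ultimately show ?case by simp
  qed
  show ?thesis
    unfolding open_charts_def
  proof (intro ballI conjI allI impI)
    fix \<kappa>' assume "\<kappa>' \<in> atlas (slit_tangent_bundle M)"
    then obtain \<kappa> where k: "\<kappa> \<in> atlas M" "\<kappa>' = slit_chart M \<kappa>" by (auto simp: atlas_slit_tangent_bundle[OF M(2)])
    show "inj_on (snd \<kappa>') (fst \<kappa>')"
      unfolding k(2) using slit_chart_inj[OF M(1) admissible_atlas[OF M(1) k(1)]]
      by (rule inj_on_subset) (auto simp: fst_slit_chart)
    have kt: "fst \<kappa> \<subseteq> topspace (mtop M)" using k(1) M(2) by (auto simp: open_charts_def)
    show "fst \<kappa>' \<subseteq> topspace (mtop (slit_tangent_bundle M))"
      unfolding top k(2) using inB[OF k(1)] kt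
      by (auto simp: fst_slit_chart topology_generated_by_topspace)
    fix U assume "openin (mtop (slit_tangent_bundle M)) U"
    then obtain V where V: "openin (topology_generated_by B) V" "U = V \<inter> topspace (mtop M) \<times> (UNIV - {0})"
      unfolding top openin_subtopology by blast
    have "fst \<kappa>' \<inter> U = fst (slit_chart M \<kappa>) \<inter> V"
      using kt unfolding k(2) V(2) by (auto simp: fst_slit_chart)
    then show "open (snd \<kappa>' ` (fst \<kappa>' \<inter> U))"
      using gen[OF _ k(1), of V] V(1) k(2) by (simp add: openin_topology_generated_by_iff)
  qed
qed

lemma topspace_slit_tangent_bundle:
  assumes M: "smooth_atlas M" "open_charts M" "\<Union>(fst ` atlas M) = topspace (mtop M)"
  shows "topspace (mtop (slit_tangent_bundle M)) = topspace (mtop M) \<times> (UNIV - {0})"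
proof
  show "topspace (mtop (slit_tangent_bundle M)) \<subseteq> topspace (mtop M) \<times> (UNIV - {0})"
    by (auto simp: slit_tangent_bundle_def open_submanifold_def)
  show "topspace (mtop M) \<times> (UNIV - {0}) \<subseteq> topspace (mtop (slit_tangent_bundle M))"
  proof
    fix z assume "z \<in> topspace (mtop M) \<times> (UNIV - {0::'b})"
    then obtain \<kappa> where "\<kappa> \<in> atlas M" "z \<in> fst (slit_chart M \<kappa>)" using M(3) by (fastforce simp: fst_slit_chart)
    then show "z \<in> topspace (mtop (slit_tangent_bundle M))"
      using open_charts_slit_tangent_bundle[OF M(1,2)]
      unfolding open_charts_def atlas_slit_tangent_bundle[OF M(2)] by blast
  qed
qed

lemma tangent_lift_tplot:
  assumes M: "smooth_atlas M" and f: "plot M f x" and h: "smooth_at M M h (f x)"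
  shows "tangent_lift M h (tplot M f (x, w)) = tplot M (\<lambda>y. h (f y)) (x, w)"
  by (simp add: tangent_lift_def tplot_def tangent_map_dplot[OF M M f h])

lemma eventually_tangent_lift_tplot:
  assumes M: "smooth_atlas M" and f: "plot M f x" and h: "\<And>p. p \<in> (\<Union>\<kappa>\<in>atlas M. fst \<kappa>) \<Longrightarrow> smooth_at M M h p"
  shows "\<forall>\<^sub>F z in nhds (x, w). tangent_lift M h (tplot M f z) = tplot M (\<lambda>y. h (f y)) z"
proof -
  have "\<forall>\<^sub>F y in nhds x. \<forall>w. tangent_lift M h (tplot M f (y, w)) = tplot M (\<lambda>y. h (f y)) (y, w)"
    using plot_eventually[OF f] by eventually_elim (use tangent_lift_tplot[OF M _ h] plot_in_atlas in blast)
  from eventually_nhds_fst[OF this, of w] show ?thesis by eventually_elim auto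
qed

lemma smooth_at_tangent_lift:
  assumes M: "smooth_atlas M" "open_charts M"
    and h: "\<And>p. p \<in> (\<Union>\<kappa>\<in>atlas M. fst \<kappa>) \<Longrightarrow> smooth_at M M h p"
    and p: "p \<in> (\<Union>\<kappa>\<in>atlas M. fst \<kappa>)" "v \<noteq> 0" "tangent_map M M h p v \<noteq> 0"
  shows "smooth_at (slit_tangent_bundle M) (slit_tangent_bundle M) (tangent_lift M h) (p, v)"
proof -
  let ?SB = "slit_tangent_bundle M"
  let ?b = "base_chart ?SB (p, v)"
  have "(p, v) \<in> (\<Union>\<kappa>\<in>atlas ?SB. fst \<kappa>)"
    using p by (auto simp: atlas_slit_tangent_bundle[OF M(2)] fst_slit_chart)
  from base_chart[OF this] obtain \<kappa> where k: "\<kappa> \<in> atlas M" "?b = slit_chart M \<kappa>" "p \<in> fst \<kappa>"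
    by (auto simp: atlas_slit_tangent_bundle[OF M(2)] fst_slit_chart)
  have \<kappa>: "admissible M \<kappa>" using admissible_atlas[OF M(1) k(1)] .
  have inj: "inj_on (snd \<kappa>) (fst \<kappa>)" using \<kappa> by (simp add: admissible_def)
  define x w where "x = snd \<kappa> p" and "w = comps M \<kappa> p v"
  have x: "x \<in> snd \<kappa> ` fst \<kappa>" "chart_inv \<kappa> x = p" using k(3) chart_inv_chart[OF inj] by (auto simp: x_def)
  have w: "w \<noteq> 0" using comps_eq_0_iff[OF M(1) \<kappa> k(3)] p(2) by (simp add: w_def)
  have bz: "snd ?b (p, v) = (x, w)" by (simp add: k(2) snd_slit_chart x_def w_def)
  have d: "dplot M (chart_inv \<kappa>) x w = v" unfolding x_def w_def by (rule dplot_chart_inv_comps[OF M(1) \<kappa> k(3)])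
  have pk: "plot M (chart_inv \<kappa>) x" by (rule plot_chart_inv[OF M(1) \<kappa> x(1)])
  have hp: "smooth_at M M h (chart_inv \<kappa> x)" using h p(1) x(2) by simp
  have "dplot M (\<lambda>y. h (chart_inv \<kappa> y)) x w \<noteq> 0"
    using tangent_map_dplot[OF M(1) M(1) pk hp, of w] p(3) by (simp add: d x(2))
  then have "plot ?SB (tplot M (\<lambda>y. h (chart_inv \<kappa> y))) (x, w)"
    by (rule plot_tplot[OF M smooth_at_plot[OF M(1) pk hp]])
  then have "plot ?SB (\<lambda>z. tangent_lift M h (chart_inv ?b z)) (x, w)"
  proof (rule plot_cong)
    have O: "open (snd \<kappa> ` fst \<kappa> \<times> (UNIV - {0::'b}))" using \<kappa> by (intro open_Times) (auto simp: admissible_def)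
    have "\<forall>\<^sub>F z in nhds (x, w). z \<in> snd \<kappa> ` fst \<kappa> \<times> (UNIV - {0})"
      by (rule eventually_nhds_in_open[OF O]) (use x w in auto)
    then have "\<forall>\<^sub>F z in nhds (x, w). chart_inv ?b z = tplot M (chart_inv \<kappa>) z"
      unfolding k(2) by eventually_elim (rule chart_inv_slit_chart_prod[OF M(1) \<kappa>])
    moreover have "\<forall>\<^sub>F z in nhds (x, w). tangent_lift M h (tplot M (chart_inv \<kappa>) z) = tplot M (\<lambda>y. h (chart_inv \<kappa> y)) z"
      by (rule eventually_tangent_lift_tplot[OF M(1) pk]) (rule h)
    ultimately show "\<forall>\<^sub>F z in nhds (x, w). tplot M (\<lambda>y. h (chart_inv \<kappa> y)) z = tangent_lift M h (chart_inv ?b z)"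
      by eventually_elim simp
  qed
  then show ?thesis by (simp add: smooth_at_def bz)
qed

text \<open>The lifted plot has the prolongation as its coordinate expression, whose derivative is known.\<close>

lemma comps_slit_tplot:
  assumes M: "smooth_atlas M" "open_charts M" and f: "plot M f x" and w: "dplot M f x w \<noteq> 0"
    and \<mu>: "admissible M \<mu>" "f x \<in> fst \<mu>"
  shows "comps (slit_tangent_bundle M) (slit_chart M \<mu>) (tplot M f (x, w))
     (dplot (slit_tangent_bundle M) (tplot M f) (x, w) (a, b)) =
     (fd (\<lambda>y. snd \<mu> (f y)) x a, fd2 (\<lambda>y. snd \<mu> (f y)) x a w + fd (\<lambda>y. snd \<mu> (f y)) x b)"
proof -
  have "comps (slit_tangent_bundle M) (slit_chart M \<mu>) (tplot M f (x, w))
     (dplot (slit_tangent_bundle M) (tplot M f) (x, w) (a, b)) =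
     fd (\<lambda>z. snd (slit_chart M \<mu>) (tplot M f z)) (x, w) (a, b)"
    by (rule comps_dplot[OF smooth_atlas_slit_tangent_bundle[OF M] plot_tplot[OF M f w] admissible_slit_chart[OF M \<mu>(1)]])
       (use w \<mu>(2) in \<open>auto simp: tplot_def fst_slit_chart\<close>)
  also have "fd (\<lambda>z. snd (slit_chart M \<mu>) (tplot M f z)) (x, w) = fd (prolong (\<lambda>y. snd \<mu> (f y))) (x, w)"
    by (rule fd_cong) (use eventually_slit_chart_tplot[OF M(1) f \<mu>] in eventually_elim, simp)
  also have "\<dots> = (\<lambda>(a, b). (fd (\<lambda>y. snd \<mu> (f y)) x a, fd2 (\<lambda>y. snd \<mu> (f y)) x a w + fd (\<lambda>y. snd \<mu> (f y)) x b))"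
    by (rule fd_eqI[OF prolong_has_derivative[OF plot_chart(2)[OF M(1) f \<mu>]]])
  finally show ?thesis by simp
qed

text \<open>The definition of a spray, restated for vectors at a lifted plot.\<close>

lemma comps_spray:
  assumes M: "smooth_manifold M" and S: "spray M S" and \<kappa>: "\<kappa> \<in> charts M"
    and x: "x \<in> snd \<kappa> ` fst \<kappa>" and w: "w \<noteq> 0"
  shows "comps (slit_tangent_bundle M) (slit_chart M \<kappa>) (tplot M (chart_inv \<kappa>) (x, w)) (S (tplot M (chart_inv \<kappa>) (x, w)))
    = (w, - 2 *\<^sub>R spray_coeff M S \<kappa> x w)"
proof -
  have e: "comps N (tangent_chart M \<kappa>) = comps N (slit_chart M \<kappa>)" for N
    by (simp add: comps_def[abs_def] slit_chart_def)
  have "bundle_field_comps M S \<kappa> x w = (w, - 2 *\<^sub>R spray_coeff M S \<kappa> x w)"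
    using S \<kappa> x w by (auto simp: spray_def)
  then show ?thesis
    by (simp add: bundle_field_comps_def field_comps_def e
        chart_inv_tangent_chart[OF smooth_atlas_smooth_manifold[OF M] admissible_charts[OF M \<kappa>] x w])
qed

text \<open>The value of the spray at a nonzero vector is the derivative of the lifted plot \<open>chart_inv \<kappa>\<close> in the
direction \<open>(w, - 2 G)\<close>. By invariance, its image under the tangent map of the lifted map,
which is the derivative of the lifted plot \<open>h \<circ> chart_inv \<kappa>\<close> in the same direction, is again a value of
the spray. Comparing the vertical components in the chart \<open>\<mu>\<close> gives the law.\<close>

lemma spray_transform:
  assumes M: "smooth_manifold M" and S: "spray M S" and \<kappa>: "\<kappa> \<in> charts M" and \<mu>: "\<mu> \<in> charts M"
    and x: "x \<in> snd \<kappa> ` fst \<kappa>" and w: "w \<noteq> 0"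
    and h: "\<And>p. p \<in> topspace (mtop M) \<Longrightarrow> smooth_at M M h p"
    and hx: "h (chart_inv \<kappa> x) \<in> fst \<mu>"
    and ne: "fd (\<lambda>x. snd \<mu> (h (chart_inv \<kappa> x))) x w \<noteq> 0"
    and inv: "\<And>z. z \<in> topspace (mtop (slit_tangent_bundle M)) \<Longrightarrow>
      S (tangent_lift M h z) = tangent_map (slit_tangent_bundle M) (slit_tangent_bundle M) (tangent_lift M h) z (S z)"
  defines "\<tau> \<equiv> \<lambda>x. snd \<mu> (h (chart_inv \<kappa> x))"
  shows "2 *\<^sub>R spray_coeff M S \<mu> (\<tau> x) (fd \<tau> x w) = 2 *\<^sub>R fd \<tau> x (spray_coeff M S \<kappa> x w) - fd2 \<tau> x w w"
proof -
  let ?SB = "slit_tangent_bundle M"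
  note A = smooth_atlas_smooth_manifold[OF M] open_charts_smooth_manifold[OF M]
  note cov = smooth_manifold_cover[OF M]
  have ak: "admissible M \<kappa>" and am: "admissible M \<mu>" using admissible_charts[OF M] \<kappa> \<mu> by auto
  let ?z = "tplot M (chart_inv \<kappa>) (x, w)"
  have pk: "plot M (chart_inv \<kappa>) x" by (rule plot_chart_inv[OF A(1) ak x])
  have hp: "smooth_at M M h (chart_inv \<kappa> x)" using h plot_in_atlas[OF pk] cov by auto
  have ph: "plot M (\<lambda>y. h (chart_inv \<kappa> y)) x" by (rule smooth_at_plot[OF A(1) pk hp])
  have z: "?z \<in> fst (slit_chart M \<kappa>)" by (rule tplot_chart_inv_in(1)[OF A(1) ak x w])
  then have dk: "dplot M (chart_inv \<kappa>) x w \<noteq> 0" by (auto simp: tplot_def fst_slit_chart)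
  let ?V = "(w, - 2 *\<^sub>R spray_coeff M S \<kappa> x w)"
  \<comment> \<open>In the chart \<open>\<kappa>\<close> the prolongation of \<open>chart_inv \<kappa>\<close> is the identity, so this only restates that the
    components of the spray are \<open>(w, - 2 G)\<close>.\<close>
  have Sz: "S ?z = dplot ?SB (tplot M (chart_inv \<kappa>)) (x, w) ?V"
  proof (rule comps_inj[OF smooth_atlas_slit_tangent_bundle[OF A] admissible_slit_chart[OF A ak] z])
    have cc: "\<forall>\<^sub>F y in nhds x. snd \<kappa> (chart_inv \<kappa> y) = y" by (rule eventually_chart_chart_inv[OF ak x])
    have f1: "\<forall>\<^sub>F z in nhds x. fd (\<lambda>y. snd \<kappa> (chart_inv \<kappa> y)) z = (\<lambda>v. v)"
    proof -
      have "\<forall>\<^sub>F z in nhds x. \<forall>\<^sub>F y in nhds z. snd \<kappa> (chart_inv \<kappa> y) = y"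
        using cc by (simp add: eventually_eventually)
      then show ?thesis by eventually_elim (drule fd_cong, simp)
    qed
    have "fd2 (\<lambda>y. snd \<kappa> (chart_inv \<kappa> y)) x w w = fd (\<lambda>_. w) x w"
      by (rule fun_cong[OF fd_cong]) (use f1 in eventually_elim, simp)
    then show "comps ?SB (slit_chart M \<kappa>) ?z (S ?z) =
      comps ?SB (slit_chart M \<kappa>) ?z (dplot ?SB (tplot M (chart_inv \<kappa>)) (x, w) ?V)"
      unfolding comps_spray[OF M S \<kappa> x w] comps_slit_tplot[OF A pk dk ak chart_inv_in[OF x]]
      using eventually_nhds_x_imp_x[OF f1] by simp
  qed
  have zt: "?z \<in> topspace (mtop ?SB)"
    using plot_in_atlas[OF pk] cov dk
    by (auto simp: topspace_slit_tangent_bundle[OF A cov] tplot_def)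
  have tne: "dplot M (\<lambda>y. h (chart_inv \<kappa> y)) x w \<noteq> 0"
    using comps_dplot[OF A(1) ph am hx, of w] ne linear_0[OF comps_linear[OF A(1) am hx]] by auto
  have st: "smooth_at ?SB ?SB (tangent_lift M h) ?z"
    unfolding tplot_def prod.case
    by (rule smooth_at_tangent_lift[OF A h plot_in_atlas[OF pk] dk])
      (use cov tangent_map_dplot[OF A(1) A(1) pk hp] tne in auto)
  have "S (tangent_lift M h ?z) = dplot ?SB (\<lambda>z. tangent_lift M h (tplot M (chart_inv \<kappa>) z)) (x, w) ?V"
    unfolding inv[OF zt] unfolding Sz
    by (rule tangent_map_dplot[OF smooth_atlas_slit_tangent_bundle[OF A] smooth_atlas_slit_tangent_bundle[OF A]
        plot_tplot[OF A pk dk] st])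
  also have "\<dots> = dplot ?SB (tplot M (\<lambda>y. h (chart_inv \<kappa> y))) (x, w) ?V"
  proof (rule fun_cong[OF dplot_cong])
    show "\<forall>\<^sub>F z in nhds (x, w). tangent_lift M h (tplot M (chart_inv \<kappa>) z) = tplot M (\<lambda>y. h (chart_inv \<kappa> y)) z"
      by (rule eventually_tangent_lift_tplot[OF A(1) pk]) (use h cov in auto)
  qed
  finally have S2: "S (tplot M (\<lambda>y. h (chart_inv \<kappa> y)) (x, w)) = dplot ?SB (tplot M (\<lambda>y. h (chart_inv \<kappa> y))) (x, w) ?V"
    by (simp add: tangent_lift_tplot[OF A(1) pk hp])
  have tx: "\<tau> x \<in> snd \<mu> ` fst \<mu>" using hx by (auto simp: \<tau>_def)
  have tw: "fd \<tau> x w \<noteq> 0" using ne by (simp add: \<tau>_def)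
  have im: "inj_on (snd \<mu>) (fst \<mu>)" using am by (simp add: admissible_def)
  have "tplot M (\<lambda>y. h (chart_inv \<kappa> y)) (x, w) = tplot M (chart_inv \<mu>) (\<tau> x, fd \<tau> x w)"
  proof -
    have "dplot M (\<lambda>y. h (chart_inv \<kappa> y)) x w = dplot M (chart_inv \<mu>) (\<tau> x) (fd \<tau> x w)"
      using dplot_chart_inv_comps[OF A(1) am hx, of "dplot M (\<lambda>y. h (chart_inv \<kappa> y)) x w"]
        comps_dplot[OF A(1) ph am hx, of w] by (simp add: \<tau>_def)
    then show ?thesis using chart_inv_chart[OF im hx] by (simp add: tplot_def \<tau>_def)
  qed
  then have "(fd \<tau> x w, - 2 *\<^sub>R spray_coeff M S \<mu> (\<tau> x) (fd \<tau> x w)) =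
     comps ?SB (slit_chart M \<mu>) (tplot M (\<lambda>y. h (chart_inv \<kappa> y)) (x, w)) (S (tplot M (\<lambda>y. h (chart_inv \<kappa> y)) (x, w)))"
    using comps_spray[OF M S \<mu> tx tw] by simp
  also have "\<dots> = (fd \<tau> x w, fd2 \<tau> x w w + fd \<tau> x (- 2 *\<^sub>R spray_coeff M S \<kappa> x w))"
    unfolding S2 \<tau>_def by (rule comps_slit_tplot[OF A ph tne am hx])
  finally have "- 2 *\<^sub>R spray_coeff M S \<mu> (\<tau> x) (fd \<tau> x w) = fd2 \<tau> x w w + fd \<tau> x (- 2 *\<^sub>R spray_coeff M S \<kappa> x w)"
    by simp
  moreover have "linear (fd \<tau> x)"
    unfolding \<tau>_def by (rule smooth_near_linear[OF plot_chart(2)[OF A(1) ph am hx]])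
  ultimately show ?thesis by (simp add: linear_scale linear_neg algebra_simps neg_eq_iff_add_eq_0)
qed

section \<open>Products and open submanifolds\<close>

lemma open_charts_prod:
  assumes "open_charts M" "open_charts N"
  shows "open_charts (prod_manifold M N)"
  unfolding open_charts_def
proof (intro ballI conjI allI impI)
  fix \<nu> assume "\<nu> \<in> atlas (prod_manifold M N)"
  then obtain \<kappa> \<mu> where n: "\<nu> = (fst \<kappa> \<times> fst \<mu>, map_prod (snd \<kappa>) (snd \<mu>))" "\<kappa> \<in> atlas M" "\<mu> \<in> atlas N"
    by (auto simp: prod_manifold_def)
  have k: "inj_on (snd \<kappa>) (fst \<kappa>)" "fst \<kappa> \<subseteq> topspace (mtop M)" "\<And>U. openin (mtop M) U \<Longrightarrow> open (snd \<kappa> ` (fst \<kappa> \<inter> U))"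
    and m: "inj_on (snd \<mu>) (fst \<mu>)" "fst \<mu> \<subseteq> topspace (mtop N)" "\<And>U. openin (mtop N) U \<Longrightarrow> open (snd \<mu> ` (fst \<mu> \<inter> U))"
    using assms n by (auto simp: open_charts_def)
  show "inj_on (snd \<nu>) (fst \<nu>)" using k(1) m(1) by (simp add: n map_prod_inj_on)
  show "fst \<nu> \<subseteq> topspace (mtop (prod_manifold M N))" using k(2) m(2) by (auto simp: n prod_manifold_def)
  fix U assume "openin (mtop (prod_manifold M N)) U"
  then have U: "openin (prod_topology (mtop M) (mtop N)) U" by (simp add: prod_manifold_def)
  show "open (snd \<nu> ` (fst \<nu> \<inter> U))"
  proof (subst open_subopen, intro ballI)
    fix z assume "z \<in> snd \<nu> ` (fst \<nu> \<inter> U)"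
    then obtain a b where z: "z = snd \<nu> (a, b)" and ab: "(a, b) \<in> fst \<nu>" "(a, b) \<in> U" by auto
    obtain A B where AB: "openin (mtop M) A" "openin (mtop N) B" "a \<in> A" "b \<in> B" "A \<times> B \<subseteq> U"
      using openin_prod_topology_alt[THEN iffD1, OF U, rule_format, OF ab(2)] by blast
    have "open (snd \<kappa> ` (fst \<kappa> \<inter> A) \<times> snd \<mu> ` (fst \<mu> \<inter> B))"
      by (intro open_Times k m AB)
    moreover have "snd \<nu> (a, b) \<in> snd \<kappa> ` (fst \<kappa> \<inter> A) \<times> snd \<mu> ` (fst \<mu> \<inter> B)"
      using ab AB by (auto simp: n)
    moreover have "snd \<kappa> ` (fst \<kappa> \<inter> A) \<times> snd \<mu> ` (fst \<mu> \<inter> B) \<subseteq> snd \<nu> ` (fst \<nu> \<inter> U)"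
    proof
      fix z assume "z \<in> snd \<kappa> ` (fst \<kappa> \<inter> A) \<times> snd \<mu> ` (fst \<mu> \<inter> B)"
      then obtain p q where pq: "p \<in> fst \<kappa> \<inter> A" "q \<in> fst \<mu> \<inter> B" "z = (snd \<kappa> p, snd \<mu> q)" by auto
      then have "(p, q) \<in> fst \<nu> \<inter> U" "z = snd \<nu> (p, q)" using AB(5) by (auto simp: n)
      then show "z \<in> snd \<nu> ` (fst \<nu> \<inter> U)" by (intro image_eqI)
    qed
    ultimately show "\<exists>T. open T \<and> z \<in> T \<and> T \<subseteq> snd \<nu> ` (fst \<nu> \<inter> U)"
      unfolding z by (intro exI conjI)
  qed
qed

lemma plot_prod:
  assumes "plot M f x" "plot N g x"
  shows "plot (prod_manifold M N) (\<lambda>y. (f y, g y)) x"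
proof -
  obtain \<kappa> where k: "\<kappa> \<in> atlas M" "\<forall>\<^sub>F y in nhds x. f y \<in> fst \<kappa>" "smooth_near x (\<lambda>y. snd \<kappa> (f y))"
    using assms(1) by (auto simp: plot_def)
  obtain \<mu> where m: "\<mu> \<in> atlas N" "\<forall>\<^sub>F y in nhds x. g y \<in> fst \<mu>" "smooth_near x (\<lambda>y. snd \<mu> (g y))"
    using assms(2) by (auto simp: plot_def)
  have "(fst \<kappa> \<times> fst \<mu>, map_prod (snd \<kappa>) (snd \<mu>)) \<in> atlas (prod_manifold M N)"
    unfolding prod_manifold_def manifold.select_convs using k(1) m(1) by blast
  moreover have "\<forall>\<^sub>F y in nhds x. (f y, g y) \<in> fst \<kappa> \<times> fst \<mu>"
    using k(2) m(2) by eventually_elim simp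
  ultimately show ?thesis
    using smooth_near_Pair[OF k(3) m(3)] unfolding plot_def by (intro bexI) auto
qed

lemma plot_open_submanifold:
  assumes M: "open_charts M" and W: "openin (mtop M) W" and f: "plot M f x" "f x \<in> W"
  shows "plot (open_submanifold M W) f x"
proof -
  obtain \<kappa> where k: "\<kappa> \<in> atlas M" "\<forall>\<^sub>F y in nhds x. f y \<in> fst \<kappa>" "smooth_near x (\<lambda>y. snd \<kappa> (f y))"
    using f(1) by (auto simp: plot_def)
  have x: "f x \<in> fst \<kappa>" using k(2) eventually_nhds_x_imp_x by fast
  have O: "open (snd \<kappa> ` (fst \<kappa> \<inter> W))" "inj_on (snd \<kappa>) (fst \<kappa>)" using M k(1) W by (auto simp: open_charts_def)
  have "\<forall>\<^sub>F y in nhds x. snd \<kappa> (f y) \<in> snd \<kappa> ` (fst \<kappa> \<inter> W)"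
    using smooth_near_tendsto[OF k(3)] O(1) x f(2) topological_tendstoD by blast
  then have "\<forall>\<^sub>F y in nhds x. f y \<in> fst \<kappa> \<inter> W"
    using k(2) by eventually_elim (use O(2) in \<open>auto dest: inj_onD\<close>)
  moreover have "(fst \<kappa> \<inter> W, snd \<kappa>) \<in> atlas (open_submanifold M W)"
    using k(1) by (auto simp: open_submanifold_def)
  ultimately show ?thesis using k(3) unfolding plot_def by (intro bexI) auto
qed

lemma open_charts_open_submanifold:
  assumes M: "open_charts M" and W: "openin (mtop M) W"
  shows "open_charts (open_submanifold M W)"
  unfolding open_charts_def
proof (intro ballI conjI allI impI)
  fix \<nu> assume "\<nu> \<in> atlas (open_submanifold M W)"
  then obtain \<kappa> where n: "\<nu> = (fst \<kappa> \<inter> W, snd \<kappa>)" "\<kappa> \<in> atlas M" by (auto simp: open_submanifold_def)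
  have k: "inj_on (snd \<kappa>) (fst \<kappa>)" "fst \<kappa> \<subseteq> topspace (mtop M)" "\<And>U. openin (mtop M) U \<Longrightarrow> open (snd \<kappa> ` (fst \<kappa> \<inter> U))"
    using M n(2) by (auto simp: open_charts_def)
  show "inj_on (snd \<nu>) (fst \<nu>)" using k(1) by (simp add: n inj_on_Int)
  show "fst \<nu> \<subseteq> topspace (mtop (open_submanifold M W))" using k(2) by (auto simp: n open_submanifold_def)
  fix U assume "openin (mtop (open_submanifold M W)) U"
  then have "openin (mtop M) U" "U \<subseteq> W"
    using openin_open_subtopology[OF W] by (auto simp: open_submanifold_def)
  moreover from this have "fst \<nu> \<inter> U = fst \<kappa> \<inter> U" by (auto simp: n)
  ultimately show "open (snd \<nu> ` (fst \<nu> \<inter> U))" using k(3) by (simp add: n)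
qed

lemma fd2_compose:
  fixes f :: "'b::euclidean_space \<Rightarrow> 'c::euclidean_space" and q :: "'a::euclidean_space \<Rightarrow> 'b"
  assumes f: "smooth_near (q z) f" and q: "smooth_near z q"
  shows "fd2 (\<lambda>z. f (q z)) z a b = fd2 f (q z) (fd q z a) (fd q z b) + fd f (q z) (fd2 q z a b)"
proof -
  have "\<forall>\<^sub>F y in nhds z. smooth_near (q y) f"
    using eventually_compose_filterlim[OF smooth_near_eventually[OF f] smooth_near_tendsto[OF q]] .
  then have "\<forall>\<^sub>F y in nhds z. fd (\<lambda>z. f (q z)) y b = fd f (q y) (fd q y b)"
    using smooth_near_eventually[OF q]
    by eventually_elim (rule fd_chain[OF smooth_near_differentiable smooth_near_differentiable])
  then have "fd (\<lambda>y. fd (\<lambda>z. f (q z)) y b) z = fd (\<lambda>y. fd f (q y) (fd q y b)) z"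
    by (rule fd_cong)
  also have "\<dots> = (\<lambda>a. fd2 f (q z) (fd q z a) (fd q z b) + fd f (q z) (fd2 q z a b))"
    by (rule fd_eqI, rule has_derivative_fd_along[OF f smooth_near_has_derivative[OF q]
        smooth_near_has_derivative[OF smooth_near_fd_const[OF q]]])
  finally show ?thesis by simp
qed

lemma fd_partial_snd:
  fixes f :: "'a::euclidean_space \<times> 'b::euclidean_space \<Rightarrow> 'c::euclidean_space"
  assumes "smooth_near (x, y) f"
  shows "fd (\<lambda>y. f (x, y)) y v = fd f (x, y) (0, v)"
proof -
  have "fd (\<lambda>y. (x, y)) y = (\<lambda>v. (0, v))"
    by (rule fd_eqI) (auto intro!: derivative_eq_intros)
  moreover have "fd (\<lambda>y. f (x, y)) y v = fd f (x, y) (fd (\<lambda>y. (x, y)) y v)"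
    by (rule fd_chain[of f "\<lambda>y. (x, y)" y v, OF smooth_near_differentiable[OF assms]])
       (intro smooth_near_differentiable smooth_near_Pair smooth_near_const smooth_near_ident)
  ultimately show ?thesis by simp
qed

lemma fd_partial_fst:
  fixes f :: "'a::euclidean_space \<times> 'b::euclidean_space \<Rightarrow> 'c::euclidean_space"
  assumes "smooth_near (x, y) f"
  shows "fd (\<lambda>x. f (x, y)) x v = fd f (x, y) (v, 0)"
proof -
  have "fd (\<lambda>x. (x, y)) x = (\<lambda>v. (v, 0))"
    by (rule fd_eqI) (auto intro!: derivative_eq_intros)
  moreover have "fd (\<lambda>x. f (x, y)) x v = fd f (x, y) (fd (\<lambda>x. (x, y)) x v)"
    by (rule fd_chain[of f "\<lambda>x. (x, y)" x v, OF smooth_near_differentiable[OF assms]])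
       (intro smooth_near_differentiable smooth_near_Pair smooth_near_const smooth_near_ident)
  ultimately show ?thesis by simp
qed

section \<open>Lie groups and coset manifolds\<close>

text \<open>Computations on the group take place in the chart \<open>\<phi>\<close> at the identity, to which left translations move
them; \<open>e\<close> is the inverse of this chart.\<close>

locale homogeneous_space =
  fixes G :: "('g, 'z) monoid_scheme"
    and MG :: "('g, 'a::euclidean_space) manifold"
    and H :: "'g set"
    and M :: "('g set, 'e::euclidean_space) manifold"
  assumes lie: "lie_group G MG" and sub: "closed_subgroup G MG H" and cos: "coset_manifold G MG H M"
begin

abbreviation mul (infixl "\<cdot>" 70) where "g \<cdot> h \<equiv> g \<otimes>\<^bsub>G\<^esub> h"
abbreviation act (infixr "\<bullet>\<^sub>M" 65) where "g \<bullet>\<^sub>M p \<equiv> g <#\<^bsub>G\<^esub> p"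
abbreviation \<pi> where "\<pi> g \<equiv> g <#\<^bsub>G\<^esub> H"
abbreviation \<phi> where "\<phi> \<equiv> base_chart MG \<one>\<^bsub>G\<^esub>"
abbreviation x0 where "x0 \<equiv> snd \<phi> \<one>\<^bsub>G\<^esub>"
abbreviation e where "e \<equiv> chart_inv \<phi>"

sublocale group G using lie by (simp add: lie_group_def)

lemma MG: "smooth_manifold MG" and topMG: "topspace (mtop MG) = carrier G"
  using lie by (auto simp: lie_group_def)

lemma M: "smooth_manifold M" and topM: "topspace (mtop M) = \<pi> ` carrier G"
  using cos by (auto simp: coset_manifold_def)

lemmas atlas_G = smooth_atlas_smooth_manifold[OF MG] and open_G = open_charts_smooth_manifold[OF MG]
  and cover_G = smooth_manifold_cover[OF MG] and dom_G = smooth_manifold_openin_chart[OF MG]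
lemmas atlas_M = smooth_atlas_smooth_manifold[OF M] and open_M = open_charts_smooth_manifold[OF M]
  and cover_M = smooth_manifold_cover[OF M]

lemma Hsub: "H \<subseteq> carrier G" and subH: "subgroup H G"
  using sub subgroup.subset by (auto simp: closed_subgroup_def)

lemma plot_carrier: "plot MG f x \<Longrightarrow> f x \<in> carrier G"
  using plot_in_atlas cover_G topMG by fast

lemma plot_top: "plot M f x \<Longrightarrow> f x \<in> topspace (mtop M)"
  using plot_in_atlas cover_M by fast

lemma plot_mult:
  assumes "plot MG f x" "plot MG g x"
  shows "plot MG (\<lambda>y. f y \<cdot> g y) x"
proof -
  have "smooth_map (prod_manifold MG MG) MG (\<lambda>(g, h). g \<cdot> h)" using lie by (simp add: lie_group_def)
  from smooth_map_plot[OF this open_charts_prod[OF open_G open_G] cover_G dom_G plot_prod[OF assms]]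
  show ?thesis by simp
qed

lemma plot_inv:
  assumes "plot MG f x"
  shows "plot MG (\<lambda>y. inv\<^bsub>G\<^esub> (f y)) x"
proof -
  have "smooth_map MG MG (\<lambda>g. inv\<^bsub>G\<^esub> g)" using lie by (simp add: lie_group_def)
  from smooth_map_plot_manifold[OF this MG MG assms] show ?thesis by simp
qed

lemma plot_const:
  assumes "g \<in> carrier G" shows "plot MG (\<lambda>_. g) x"
proof -
  obtain \<kappa> where "\<kappa> \<in> atlas MG" "g \<in> fst \<kappa>" using assms cover_G topMG by blast
  then show ?thesis unfolding plot_def by (auto simp: smooth_near_const)
qed

lemma plot_proj:
  assumes "plot MG f x" shows "plot M (\<lambda>y. \<pi> (f y)) x"
proof -
  have "smooth_map MG M (\<lambda>g. \<pi> g)" using cos by (simp add: coset_manifold_def)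
  from smooth_map_plot_manifold[OF this MG M assms] show ?thesis by simp
qed

lemma one_atlas: "\<one>\<^bsub>G\<^esub> \<in> (\<Union>\<kappa>\<in>atlas MG. fst \<kappa>)"
  using cover_G topMG by auto

lemma \<phi>: "\<phi> \<in> atlas MG" "\<one>\<^bsub>G\<^esub> \<in> fst \<phi>" "admissible MG \<phi>" "inj_on (snd \<phi>) (fst \<phi>)"
  using base_chart[OF one_atlas] admissible_atlas[OF atlas_G] by (auto simp: admissible_def)

lemma x0_in: "x0 \<in> snd \<phi> ` fst \<phi>" using \<phi>(2) by blast

lemma open_\<phi>: "open (snd \<phi> ` fst \<phi>)" using \<phi>(3) by (simp add: admissible_def)

lemma e_x0: "e x0 = \<one>\<^bsub>G\<^esub>" by (rule chart_inv_chart[OF \<phi>(4,2)])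

lemma plot_e: "x \<in> snd \<phi> ` fst \<phi> \<Longrightarrow> plot MG e x" by (rule plot_chart_inv[OF atlas_G \<phi>(3)])

lemma e_carrier: "x \<in> snd \<phi> ` fst \<phi> \<Longrightarrow> e x \<in> carrier G" by (rule plot_carrier[OF plot_e])

lemma \<phi>_e: "x \<in> snd \<phi> ` fst \<phi> \<Longrightarrow> snd \<phi> (e x) = x" by (rule chart_chart_inv)

lemma e_in: "x \<in> snd \<phi> ` fst \<phi> \<Longrightarrow> e x \<in> fst \<phi>" by (rule chart_inv_in)

lemma act_proj: "g \<in> carrier G \<Longrightarrow> a \<in> carrier G \<Longrightarrow> g \<bullet>\<^sub>M \<pi> a = \<pi> (g \<cdot> a)"
  by (rule lcos_m_assoc[OF Hsub])

lemma proj_one: "\<pi> \<one>\<^bsub>G\<^esub> = H" by (rule lcos_mult_one[OF Hsub])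

lemma H_top: "H \<in> topspace (mtop M)" using topM proj_one one_closed by (metis imageI)

lemma proj_H: "h \<in> H \<Longrightarrow> \<pi> h = H"
  using lcos_mult_one Hsub subH by (metis coset_join3 subsetD)

lemma proj_eq_H: "g \<in> carrier G \<Longrightarrow> \<pi> g = H \<Longrightarrow> g \<in> H"
proof -
  assume g: "g \<in> carrier G" "\<pi> g = H"
  have "g \<cdot> \<one>\<^bsub>G\<^esub> \<in> \<pi> g" using subgroup.one_closed[OF subH] unfolding l_coset_def by blast
  then show "g \<in> H" using g by simp
qed

lemma act_top: "g \<in> carrier G \<Longrightarrow> p \<in> topspace (mtop M) \<Longrightarrow> g \<bullet>\<^sub>M p \<in> topspace (mtop M)"
  using topM act_proj by auto

lemma act_act: "g \<in> carrier G \<Longrightarrow> h \<in> carrier G \<Longrightarrow> p \<in> topspace (mtop M) \<Longrightarrow> g \<bullet>\<^sub>M (h \<bullet>\<^sub>M p) = (g \<cdot> h) \<bullet>\<^sub>M p"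
  using topM act_proj by (auto simp: m_assoc)

lemma act_one: "p \<in> topspace (mtop M) \<Longrightarrow> \<one>\<^bsub>G\<^esub> \<bullet>\<^sub>M p = p"
  using topM act_proj by auto

lemma act_inv_act: "g \<in> carrier G \<Longrightarrow> p \<in> topspace (mtop M) \<Longrightarrow> inv\<^bsub>G\<^esub> g \<bullet>\<^sub>M (g \<bullet>\<^sub>M p) = p"
  using act_act[of "inv\<^bsub>G\<^esub> g" g p] act_one by simp

text \<open>The local sections of the projection, in the form in which they are used: they lift plots.\<close>

lemma local_section:
  assumes "p \<in> topspace (mtop M)"
  obtains s where "\<And>(f :: 'u::euclidean_space \<Rightarrow> 'g set) x. plot M f x \<Longrightarrow> f x = p \<Longrightarrow>
      plot MG (\<lambda>y. s (f y)) x \<and> (\<forall>\<^sub>F y in nhds x. \<pi> (s (f y)) = f y)"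
proof -
  obtain W s where W: "openin (mtop M) W" "p \<in> W" "smooth_map (open_submanifold M W) MG s" "\<forall>q\<in>W. \<pi> (s q) = q"
    using cos assms unfolding coset_manifold_def by meson
  have "plot MG (\<lambda>y. s (f y)) x \<and> (\<forall>\<^sub>F y in nhds x. \<pi> (s (f y)) = f y)" if f: "plot M f x" "f x = p"
    for f :: "'u \<Rightarrow> 'g set" and x
  proof
    have p: "plot (open_submanifold M W) f x" using plot_open_submanifold[OF open_M W(1) f(1)] f(2) W(2) by simp
    show "plot MG (\<lambda>y. s (f y)) x"
      by (rule smooth_map_plot[OF W(3) open_charts_open_submanifold[OF open_M W(1)] cover_G dom_G p])
    have "\<forall>\<^sub>F y in nhds x. f y \<in> W"
      using p unfolding plot_def open_submanifold_def by (auto elim: eventually_mono)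
    then show "\<forall>\<^sub>F y in nhds x. \<pi> (s (f y)) = f y" by eventually_elim (use W(4) in blast)
  qed
  then show thesis using that by blast
qed

text \<open>The action is smooth because the point can be lifted to the group by a local section, multiplied there
and projected back.\<close>

lemma plot_act_plot:
  fixes f :: "'u::euclidean_space \<Rightarrow> 'g set"
  assumes a: "plot MG a x" and f: "plot M f x"
  shows "plot M (\<lambda>y. a y \<bullet>\<^sub>M f y) x"
proof -
  obtain s where "plot MG (\<lambda>y. s (f y)) x \<and> (\<forall>\<^sub>F y in nhds x. \<pi> (s (f y)) = f y)"
    using local_section[OF plot_top[OF f]] f by metis
  then have s: "plot MG (\<lambda>y. s (f y)) x" "\<forall>\<^sub>F y in nhds x. \<pi> (s (f y)) = f y" by auto
  have "plot M (\<lambda>y. \<pi> (a y \<cdot> s (f y))) x" by (intro plot_proj plot_mult a s)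
  then show ?thesis
  proof (rule plot_cong)
    show "\<forall>\<^sub>F y in nhds x. \<pi> (a y \<cdot> s (f y)) = a y \<bullet>\<^sub>M f y"
      using s(2) plot_eventually[OF s(1)] plot_eventually[OF a]
      by eventually_elim (metis act_proj plot_carrier)
  qed
qed

lemma plot_act:
  fixes f :: "'u::euclidean_space \<Rightarrow> 'g set"
  shows "plot M f x \<Longrightarrow> g \<in> carrier G \<Longrightarrow> plot M (\<lambda>y. g \<bullet>\<^sub>M f y) x"
  by (intro plot_act_plot plot_const)

lemma smooth_at_act:
  assumes g: "g \<in> carrier G" and p: "p \<in> topspace (mtop M)"
  shows "smooth_at M M (\<lambda>q. g \<bullet>\<^sub>M q) p"
proof -
  have p': "p \<in> (\<Union>\<kappa>\<in>atlas M. fst \<kappa>)" using cover_M p by blast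
  show ?thesis unfolding smooth_at_def
    by (intro plot_act g plot_chart_inv[OF atlas_M admissible_atlas[OF atlas_M]]) (use base_chart[OF p'] in auto)
qed

lemma smooth_at_proj: "g \<in> carrier G \<Longrightarrow> smooth_at MG M (\<lambda>g. \<pi> g) g"
  using cos by (intro smooth_map_smooth_at[OF _ MG M]) (auto simp: coset_manifold_def topMG)

lemma tangent_act_linear:
  assumes g: "g \<in> carrier G" and p: "p \<in> topspace (mtop M)"
  shows "linear (tangent_map M M (\<lambda>q. g \<bullet>\<^sub>M q) p)"
proof -
  have p': "p \<in> (\<Union>\<kappa>\<in>atlas M. fst \<kappa>)" using cover_M p by blast
  show ?thesis
    using dplot_linear[OF atlas_M smooth_at_act[OF assms, unfolded smooth_at_def]]
    by (simp add: tangent_map_eq_dplot[OF atlas_M p', abs_def])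
qed

lemma tangent_act_inverse:
  assumes g: "g \<in> carrier G" and p: "p \<in> topspace (mtop M)"
  shows "tangent_map M M (\<lambda>q. inv\<^bsub>G\<^esub> g \<bullet>\<^sub>M q) (g \<bullet>\<^sub>M p) (tangent_map M M (\<lambda>q. g \<bullet>\<^sub>M q) p v) = v"
proof -
  let ?b = "base_chart M p"
  have p': "p \<in> (\<Union>\<kappa>\<in>atlas M. fst \<kappa>)" using cover_M p by blast
  have b: "?b \<in> atlas M" "p \<in> fst ?b" using base_chart[OF p'] by auto
  have ab: "admissible M ?b" using admissible_atlas[OF atlas_M b(1)] .
  have ib: "chart_inv ?b (snd ?b p) = p" using ab b(2) by (auto simp: admissible_def chart_inv_chart)
  have pb: "plot M (chart_inv ?b) (snd ?b p)" by (rule plot_chart_inv[OF atlas_M ab]) (use b in auto)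
  have "tangent_map M M (\<lambda>q. inv\<^bsub>G\<^esub> g \<bullet>\<^sub>M q) (g \<bullet>\<^sub>M p) (tangent_map M M (\<lambda>q. g \<bullet>\<^sub>M q) p v) =
     dplot M (\<lambda>x. inv\<^bsub>G\<^esub> g \<bullet>\<^sub>M (g \<bullet>\<^sub>M chart_inv ?b x)) (snd ?b p) v"
    using tangent_map_dplot[OF atlas_M atlas_M plot_act[OF pb g] smooth_at_act, of "inv\<^bsub>G\<^esub> g" v] g act_top[OF g p]
    by (simp add: tangent_map_eq_dplot[OF atlas_M p'] ib)
  also have "dplot M (\<lambda>x. inv\<^bsub>G\<^esub> g \<bullet>\<^sub>M (g \<bullet>\<^sub>M chart_inv ?b x)) (snd ?b p) = dplot M (chart_inv ?b) (snd ?b p)"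
    by (rule dplot_cong)
       (use plot_eventually[OF pb] in eventually_elim, use act_inv_act[OF g] plot_top in blast)
  finally show ?thesis using dplot_base_chart_inv[OF atlas_M p'] by simp
qed

lemma tangent_act_eq_0:
  assumes g: "g \<in> carrier G" and p: "p \<in> topspace (mtop M)"
  shows "tangent_map M M (\<lambda>q. g \<bullet>\<^sub>M q) p v = 0 \<longleftrightarrow> v = 0"
proof
  assume "tangent_map M M (\<lambda>q. g \<bullet>\<^sub>M q) p v = 0"
  then have "tangent_map M M (\<lambda>q. inv\<^bsub>G\<^esub> g \<bullet>\<^sub>M q) (g \<bullet>\<^sub>M p) 0 = v" using tangent_act_inverse[OF assms, of v] by simp
  moreover have "tangent_map M M (\<lambda>q. inv\<^bsub>G\<^esub> g \<bullet>\<^sub>M q) (g \<bullet>\<^sub>M p) 0 = 0"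
    using linear_0[OF tangent_act_linear] g act_top[OF assms] by blast
  ultimately show "v = 0" by simp
qed (use linear_0[OF tangent_act_linear[OF assms]] in simp)

lemma tangent_act_surj:
  assumes g: "g \<in> carrier G" and p: "p \<in> topspace (mtop M)"
  shows "\<exists>v. tangent_map M M (\<lambda>q. g \<bullet>\<^sub>M q) p v = u"
proof -
  have "tangent_map M M (\<lambda>q. inv\<^bsub>G\<^esub> (inv\<^bsub>G\<^esub> g) \<bullet>\<^sub>M q) (inv\<^bsub>G\<^esub> g \<bullet>\<^sub>M (g \<bullet>\<^sub>M p))
    (tangent_map M M (\<lambda>q. inv\<^bsub>G\<^esub> g \<bullet>\<^sub>M q) (g \<bullet>\<^sub>M p) u) = u"
    by (rule tangent_act_inverse) (use g act_top[OF assms] in auto)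
  then show ?thesis using g act_inv_act[OF assms] by auto
qed

definition mul_chart :: "'a \<times> 'a \<Rightarrow> 'a" where
  "mul_chart = (\<lambda>(x, x'). snd \<phi> (e x \<cdot> e x'))"

lemma plot_e_fst: "x \<in> snd \<phi> ` fst \<phi> \<Longrightarrow> plot MG (\<lambda>z. e (fst z)) (x, x')"
  by (rule plot_reparam[OF _ smooth_near_fst]) (simp add: plot_e)

lemma plot_e_snd: "x' \<in> snd \<phi> ` fst \<phi> \<Longrightarrow> plot MG (\<lambda>z. e (snd z)) (x, x')"
  by (rule plot_reparam[OF _ smooth_near_snd]) (simp add: plot_e)

lemma plot_mul_chart: "x \<in> snd \<phi> ` fst \<phi> \<Longrightarrow> x' \<in> snd \<phi> ` fst \<phi> \<Longrightarrow> plot MG (\<lambda>z. e (fst z) \<cdot> e (snd z)) (x, x')"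
  by (intro plot_mult plot_e_fst plot_e_snd)

lemma mul_chart_smooth:
  assumes "x \<in> snd \<phi> ` fst \<phi>"
  shows "smooth_near (x, x0) mul_chart" "\<forall>\<^sub>F z in nhds (x, x0). e (fst z) \<cdot> e (snd z) \<in> fst \<phi>"
proof -
  have "e x \<cdot> e x0 \<in> fst \<phi>" using e_x0 e_carrier[OF assms] e_in[OF assms] by simp
  then show "smooth_near (x, x0) mul_chart" "\<forall>\<^sub>F z in nhds (x, x0). e (fst z) \<cdot> e (snd z) \<in> fst \<phi>"
    using plot_chart[OF atlas_G plot_mul_chart[OF assms x0_in] \<phi>(3)] by (auto simp: mul_chart_def case_prod_beta')
qed

lemma mul_chart_x0_right: "x \<in> snd \<phi> ` fst \<phi> \<Longrightarrow> mul_chart (x, x0) = x"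
  by (simp add: mul_chart_def e_x0 e_carrier \<phi>_e)

lemma mul_chart_x0_left: "x \<in> snd \<phi> ` fst \<phi> \<Longrightarrow> mul_chart (x0, x) = x"
  by (simp add: mul_chart_def e_x0 e_carrier \<phi>_e)

lemma eventually_\<phi>: "\<forall>\<^sub>F x in nhds x0. x \<in> snd \<phi> ` fst \<phi>"
  by (rule eventually_nhds_in_open[OF open_\<phi> x0_in])

lemma fd_mul_chart_snd: "fd mul_chart (x0, x0) (0, u) = u"
proof -
  have "fd (\<lambda>x. mul_chart (x0, x)) x0 = fd (\<lambda>x. x) x0"
    by (rule fd_cong) (use eventually_\<phi> in eventually_elim, rule mul_chart_x0_left)
  then show ?thesis using fd_partial_snd[OF mul_chart_smooth(1)[OF x0_in], of u] by simp
qed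

lemma fd_mul_chart_fst: "fd mul_chart (x0, x0) (u, 0) = u"
proof -
  have "fd (\<lambda>x. mul_chart (x, x0)) x0 = fd (\<lambda>x. x) x0"
    by (rule fd_cong) (use eventually_\<phi> in eventually_elim, rule mul_chart_x0_right)
  then show ?thesis using fd_partial_fst[OF mul_chart_smooth(1)[OF x0_in], of u] by simp
qed

lemma dplot_mult_one:
  assumes a: "plot MG a x" "a x = \<one>\<^bsub>G\<^esub>" and b: "plot MG b x" "b x = \<one>\<^bsub>G\<^esub>"
  shows "dplot MG (\<lambda>y. a y \<cdot> b y) x v = dplot MG a x v + dplot MG b x v"
proof -
  let ?z = "\<lambda>y. (snd \<phi> (a y), snd \<phi> (b y))"
  have a': "\<forall>\<^sub>F y in nhds x. a y \<in> fst \<phi>" "smooth_near x (\<lambda>y. snd \<phi> (a y))"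
    using plot_base_chart[OF atlas_G a(1)] a(2) by auto
  have b': "\<forall>\<^sub>F y in nhds x. b y \<in> fst \<phi>" "smooth_near x (\<lambda>y. snd \<phi> (b y))"
    using plot_base_chart[OF atlas_G b(1)] b(2) by auto
  have z: "(?z has_derivative (\<lambda>v. (fd (\<lambda>y. snd \<phi> (a y)) x v, fd (\<lambda>y. snd \<phi> (b y)) x v))) (at x)"
    by (intro has_derivative_Pair smooth_near_has_derivative a' b')
  have "dplot MG (\<lambda>y. a y \<cdot> b y) x v = fd (\<lambda>y. snd \<phi> (a y \<cdot> b y)) x v"
    by (simp add: dplot_def a b)
  also have "fd (\<lambda>y. snd \<phi> (a y \<cdot> b y)) x = fd (\<lambda>y. mul_chart (?z y)) x"
    by (rule fd_cong) (use a'(1) b'(1) in eventually_elim, simp add: mul_chart_def chart_inv_chart[OF \<phi>(4)])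
  also have "fd (\<lambda>y. mul_chart (?z y)) x v = fd mul_chart (x0, x0) (fd ?z x v)"
    using fd_chain[of mul_chart ?z x v] smooth_near_differentiable[OF mul_chart_smooth(1)[OF x0_in]] z a(2) b(2)
    by (auto simp: differentiable_def)
  also have "\<dots> = fd mul_chart (x0, x0) ((fd (\<lambda>y. snd \<phi> (a y)) x v, 0) + (0, fd (\<lambda>y. snd \<phi> (b y)) x v))"
    by (simp add: fd_eqI[OF z])
  also have "\<dots> = fd (\<lambda>y. snd \<phi> (a y)) x v + fd (\<lambda>y. snd \<phi> (b y)) x v"
    by (simp only: linear_add[OF smooth_near_linear[OF mul_chart_smooth(1)[OF x0_in]]] fd_mul_chart_fst fd_mul_chart_snd)
  finally show ?thesis by (simp add: dplot_def a b)
qed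

lemma iota_dplot:
  assumes "plot MG f x" "f x = \<one>\<^bsub>G\<^esub>"
  shows "iota G MG H M (dplot MG f x v) = dplot M (\<lambda>y. \<pi> (f y)) x v"
  using tangent_map_dplot[OF atlas_G atlas_M assms(1) smooth_at_proj] assms(2) by (simp add: iota_def)

lemma iota_eq: "iota G MG H M u = dplot M (\<lambda>x. \<pi> (e x)) x0 u"
  by (simp add: iota_def tangent_map_eq_dplot[OF atlas_G one_atlas])

lemma iota_linear: "linear (iota G MG H M)"
  unfolding iota_eq[abs_def] by (rule dplot_linear[OF atlas_M plot_proj[OF plot_e[OF x0_in]]])

text \<open>A section near the base point can be made to start at the identity by a right translation with an
element of \<open>H\<close>.\<close>

lemma base_section:
  obtains s where "\<And>(f :: 'u::euclidean_space \<Rightarrow> 'g set) x. plot M f x \<Longrightarrow> f x = H \<Longrightarrow>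
      plot MG (\<lambda>y. s (f y)) x \<and> (\<forall>\<^sub>F y in nhds x. \<pi> (s (f y)) = f y)" "s H = \<one>\<^bsub>G\<^esub>"
proof -
  obtain s where s: "\<And>(f :: 'u \<Rightarrow> 'g set) x. plot M f x \<Longrightarrow> f x = H \<Longrightarrow>
      plot MG (\<lambda>y. s (f y)) x \<and> (\<forall>\<^sub>F y in nhds x. \<pi> (s (f y)) = f y)"
    using local_section[OF H_top] by metis
  have pH: "plot M (\<lambda>_ :: 'u. H) 0" using plot_proj[OF plot_const[OF one_closed]] by (simp add: proj_one)
  have sH: "s H \<in> H"
  proof (rule proj_eq_H)
    show "s H \<in> carrier G" using s[OF pH] plot_carrier by blast
    show "\<pi> (s H) = H" using s[OF pH] eventually_nhds_x_imp_x by fast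
  qed
  then have iH: "inv\<^bsub>G\<^esub> (s H) \<in> H" using subH by (simp add: subgroup.m_inv_closed)
  show thesis
  proof (rule that[of "\<lambda>q. s q \<cdot> inv\<^bsub>G\<^esub> (s H)"])
    show "s H \<cdot> inv\<^bsub>G\<^esub> (s H) = \<one>\<^bsub>G\<^esub>" using sH Hsub by (intro r_inv) auto
    fix f :: "'u \<Rightarrow> 'g set" and x assume f: "plot M f x" "f x = H"
    have p: "plot MG (\<lambda>y. s (f y)) x" "\<forall>\<^sub>F y in nhds x. \<pi> (s (f y)) = f y" using s[OF f] by auto
    have "plot MG (\<lambda>y. s (f y) \<cdot> inv\<^bsub>G\<^esub> (s H)) x"
      using iH Hsub by (intro plot_mult p plot_const) auto
    moreover have "\<forall>\<^sub>F y in nhds x. \<pi> (s (f y) \<cdot> inv\<^bsub>G\<^esub> (s H)) = f y"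
      using p(2) plot_eventually[OF p(1)]
      by eventually_elim (metis act_proj iH Hsub plot_carrier proj_H subsetD)
    ultimately show "plot MG (\<lambda>y. s (f y) \<cdot> inv\<^bsub>G\<^esub> (s H)) x \<and> (\<forall>\<^sub>F y in nhds x. \<pi> (s (f y) \<cdot> inv\<^bsub>G\<^esub> (s H)) = f y)"
      by blast
  qed
qed

text \<open>The derivative of a section is a right inverse.\<close>

lemma iota_surj: "\<exists>u. iota G MG H M u = v"
proof -
  let ?b = "base_chart M H"
  have p': "H \<in> (\<Union>\<kappa>\<in>atlas M. fst \<kappa>)" using cover_M H_top by blast
  have b: "?b \<in> atlas M" "H \<in> fst ?b" using base_chart[OF p'] by auto
  have ab: "admissible M ?b" using admissible_atlas[OF atlas_M b(1)] .
  have ib: "chart_inv ?b (snd ?b H) = H" using ab b(2) by (auto simp: admissible_def chart_inv_chart)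
  have pb: "plot M (chart_inv ?b) (snd ?b H)" by (rule plot_chart_inv[OF atlas_M ab]) (use b in auto)
  obtain s where s: "\<And>(f :: 'e \<Rightarrow> 'g set) x. plot M f x \<Longrightarrow> f x = H \<Longrightarrow>
      plot MG (\<lambda>y. s (f y)) x \<and> (\<forall>\<^sub>F y in nhds x. \<pi> (s (f y)) = f y)" "s H = \<one>\<^bsub>G\<^esub>"
    using base_section by metis
  have "iota G MG H M (dplot MG (\<lambda>y. s (chart_inv ?b y)) (snd ?b H) v) =
     dplot M (\<lambda>y. \<pi> (s (chart_inv ?b y))) (snd ?b H) v"
    by (rule iota_dplot) (use s pb ib in auto)
  also have "\<dots> = dplot M (chart_inv ?b) (snd ?b H) v"
    by (rule fun_cong[OF dplot_cong]) (use s(1)[OF pb ib] in auto)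
  also have "\<dots> = v" by (rule dplot_base_chart_inv[OF atlas_M p'])
  finally show ?thesis by blast
qed

text \<open>Curves in \<open>H\<close> project to a constant. Conversely, a curve \<open>f\<close> in \<open>G\<close> can be pushed into \<open>H\<close> by multiplying
with the inverse of \<open>a = s \<circ> \<pi> \<circ> f\<close> for a section \<open>s\<close>. If the initial velocity \<open>u\<close> of \<open>f\<close> is in the kernel
of \<open>iota\<close>, the velocity of \<open>a\<close> vanishes, so the corrected curve still has initial velocity \<open>u\<close>.\<close>

lemma lie_subalgebra_eq: "lie_subalgebra G MG H = {u. iota G MG H M u = 0}"
proof (intro equalityI subsetI CollectI)
  fix u assume "u \<in> lie_subalgebra G MG H"
  then obtain \<gamma> J where g: "u = velocity MG \<gamma> 0" "open J" "0 \<in> J" "smooth_curve MG J \<gamma>" "\<gamma> ` J \<subseteq> H" "\<gamma> 0 = \<one>\<^bsub>G\<^esub>"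
    by (auto simp: lie_subalgebra_def open_interval_def)
  have p: "plot MG \<gamma> 0" by (rule smooth_curve_plot_manifold[OF g(4,2,3) MG])
  have "iota G MG H M u = dplot M (\<lambda>y. \<pi> (\<gamma> y)) 0 1"
    unfolding g(1) velocity_eq_dplot[OF atlas_G p] by (rule iota_dplot[OF p g(6)])
  also have "\<dots> = dplot M (\<lambda>y. H) (0::real) 1"
  proof (rule fun_cong[OF dplot_cong])
    have "\<forall>\<^sub>F y in nhds 0. y \<in> J" by (rule eventually_nhds_in_open[OF g(2,3)])
    then show "\<forall>\<^sub>F y in nhds 0. \<pi> (\<gamma> y) = H" by eventually_elim (use g(5) proj_H in blast)
  qed
  also have "\<dots> = 0" by (simp add: dplot_def)
  finally show "iota G MG H M u = 0" .
next
  fix u assume "u \<in> {u. iota G MG H M u = 0}"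
  then have u: "iota G MG H M u = 0" by simp
  define f where "f t = e (x0 + t *\<^sub>R u)" for t :: real
  have line: "smooth_near 0 (\<lambda>t. x0 + t *\<^sub>R u)"
    by (intro smooth_near_add smooth_near_const smooth_near_bounded_linear[OF bounded_linear_scaleR_left] smooth_near_ident)
  have pf: "plot MG f 0" unfolding f_def by (rule plot_reparam[OF _ line]) (simp add: plot_e[OF x0_in])
  have f0: "f 0 = \<one>\<^bsub>G\<^esub>" by (simp add: f_def e_x0)
  have df: "dplot MG f 0 1 = u"
  proof -
    have "fd (\<lambda>t. x0 + t *\<^sub>R u) 0 = (\<lambda>t. t *\<^sub>R u)" by (rule fd_eqI) (auto intro!: derivative_eq_intros)
    moreover have "dplot MG f 0 1 = dplot MG e (x0 + 0 *\<^sub>R u) (fd (\<lambda>t. x0 + t *\<^sub>R u) 0 1)"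
      unfolding f_def by (rule dplot_reparam[OF atlas_G _ line]) (simp add: plot_e[OF x0_in])
    ultimately show ?thesis using dplot_base_chart_inv[OF atlas_G one_atlas] by simp
  qed
  obtain s' where s': "\<And>(f :: 'e \<Rightarrow> 'g set) x. plot M f x \<Longrightarrow> f x = H \<Longrightarrow>
      plot MG (\<lambda>y. s' (f y)) x \<and> (\<forall>\<^sub>F y in nhds x. \<pi> (s' (f y)) = f y)" "s' H = \<one>\<^bsub>G\<^esub>"
    using base_section by metis
  have p': "H \<in> (\<Union>\<kappa>\<in>atlas M. fst \<kappa>)" using cover_M H_top by blast
  have sat: "smooth_at M MG s' H"
    unfolding smooth_at_def
    by (rule conjunct1[OF s'(1)], rule plot_chart_inv[OF atlas_M admissible_atlas[OF atlas_M]])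
       (use base_chart[OF p'] admissible_atlas[OF atlas_M] in \<open>auto simp: admissible_def intro!: chart_inv_chart\<close>)
  have ppf: "plot M (\<lambda>t. \<pi> (f t)) 0" "\<pi> (f 0) = H" using plot_proj[OF pf] by (auto simp: f0 proj_one)
  \<comment> \<open>The section is tested on plots from the model space of \<open>M\<close>, since \<open>smooth_at\<close> refers to the inverse of a
    chart.\<close>
  define a where "a t = s' (\<pi> (f t))" for t
  have pa: "plot MG a 0" unfolding a_def using smooth_at_plot[OF atlas_M ppf(1)] sat ppf(2) by simp
  have a0: "a 0 = \<one>\<^bsub>G\<^esub>" by (simp add: a_def ppf(2) s'(2))
  have "dplot MG a 0 1 = tangent_map M MG s' H (dplot M (\<lambda>t. \<pi> (f t)) 0 1)"
    unfolding a_def using tangent_map_dplot[OF atlas_M atlas_G ppf(1), of s' 1] sat ppf(2) by simp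
  also have "dplot M (\<lambda>t. \<pi> (f t)) 0 1 = 0" using iota_dplot[OF pf f0, of 1] df u by simp
  also have "tangent_map M MG s' H 0 = 0"
    using linear_0[OF dplot_linear[OF atlas_G sat[unfolded smooth_at_def]]] by (simp add: tangent_map_eq_dplot[OF atlas_M p'])
  finally have da: "dplot MG a 0 1 = 0" .
  have api: "\<forall>\<^sub>F t in nhds 0. \<pi> (a t) = \<pi> (f t)"
  proof -
    let ?b = "base_chart M H"
    have b: "?b \<in> atlas M" "H \<in> fst ?b" using base_chart[OF p'] by auto
    have ab: "admissible M ?b" using admissible_atlas[OF atlas_M b(1)] .
    then have inj: "inj_on (snd ?b) (fst ?b)" by (simp add: admissible_def)
    have ib: "chart_inv ?b (snd ?b H) = H" using inj b(2) by (rule chart_inv_chart)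
    have pb: "plot M (chart_inv ?b) (snd ?b H)" by (rule plot_chart_inv[OF atlas_M ab]) (use b in auto)
    have "\<forall>\<^sub>F y in nhds (snd ?b H). \<pi> (s' (chart_inv ?b y)) = chart_inv ?b y" using s'(1)[OF pb ib] by blast
    moreover have "filterlim (\<lambda>t. snd ?b (\<pi> (f t))) (nhds (snd ?b H)) (nhds 0)"
      using smooth_near_tendsto[OF plot_base_chart(2)[OF atlas_M ppf(1)]] ppf(2) by simp
    ultimately have "\<forall>\<^sub>F t in nhds 0. \<pi> (s' (chart_inv ?b (snd ?b (\<pi> (f t))))) = chart_inv ?b (snd ?b (\<pi> (f t)))"
      by (rule eventually_compose_filterlim)
    moreover have "\<forall>\<^sub>F t in nhds 0. \<pi> (f t) \<in> fst ?b" using plot_base_chart(1)[OF atlas_M ppf(1)] ppf(2) by simp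
    ultimately show ?thesis by eventually_elim (simp add: a_def chart_inv_chart[OF inj])
  qed
  define h where "h t = inv\<^bsub>G\<^esub> (a t) \<cdot> f t" for t
  have ph: "plot MG h 0" unfolding h_def by (intro plot_mult plot_inv pa pf)
  have h0: "h 0 = \<one>\<^bsub>G\<^esub>" by (simp add: h_def a0 f0)
  have fah: "\<forall>\<^sub>F t in nhds 0. f t = a t \<cdot> h t"
    using plot_eventually[OF pa] plot_eventually[OF pf]
    by eventually_elim (auto dest!: plot_carrier simp: h_def m_assoc[symmetric])
  have "u = dplot MG (\<lambda>t. a t \<cdot> h t) 0 1" using dplot_cong[OF fah] df by metis
  also have "\<dots> = dplot MG h 0 1" using dplot_mult_one[OF pa a0 ph h0] da by simp
  also have "\<dots> = velocity MG h 0" by (rule velocity_eq_dplot[OF atlas_G ph, symmetric])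
  finally have uh: "u = velocity MG h 0" .
  have hH: "\<forall>\<^sub>F t in nhds 0. h t \<in> H"
    using api plot_eventually[OF pa] plot_eventually[OF pf]
  proof eventually_elim
    case (elim t)
    have c: "a t \<in> carrier G" "f t \<in> carrier G" using elim(2,3) plot_carrier by auto
    have "\<pi> (h t) = inv\<^bsub>G\<^esub> (a t) \<bullet>\<^sub>M \<pi> (a t)" using c elim(1) act_proj[of "inv\<^bsub>G\<^esub> (a t)" "f t"] by (simp add: h_def)
    also have "\<dots> = H" using c act_proj[of "inv\<^bsub>G\<^esub> (a t)" "a t"] by (simp add: proj_one)
    finally show ?case using c by (intro proj_eq_H) (auto simp: h_def)
  qed
  have "\<forall>\<^sub>F t in nhds 0. h t \<in> H \<and> plot MG h t" using hH plot_eventually[OF ph] by eventually_elim simp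
  then obtain T where T: "open T" "0 \<in> T" "\<And>t. t \<in> T \<Longrightarrow> h t \<in> H \<and> plot MG h t" by (auto simp: eventually_nhds)
  obtain \<delta> :: real where d: "\<delta> > 0" "ball 0 \<delta> \<subseteq> T" using T(1,2) open_contains_ball by blast
  have "u \<in> {velocity MG \<gamma> 0 | \<gamma> J. open_interval J \<and> 0 \<in> J \<and> smooth_curve MG J \<gamma> \<and> \<gamma> ` J \<subseteq> H \<and> \<gamma> 0 = \<one>\<^bsub>G\<^esub>}"
  proof (intro CollectI exI conjI)
    show "open_interval (ball 0 \<delta>)" unfolding open_interval_def by (simp add: ball_eq_greaterThanLessThan)
    show "smooth_curve MG (ball 0 \<delta>) h" by (rule plot_smooth_curve[OF atlas_G open_G]) (use T(3) d in auto)
    show "h ` ball 0 \<delta> \<subseteq> H" using T(3) d(2) by blast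
  qed (use uh h0 d in auto)
  then show "u \<in> lie_subalgebra G MG H" by (simp add: lie_subalgebra_def)
qed

text \<open>A left translation differentiates the multiplication in its second argument only.\<close>

lemma field_comps_left_invariant:
  assumes x: "x \<in> snd \<phi> ` fst \<phi>"
  shows "field_comps MG \<phi> (left_invariant_field G MG u) x = fd mul_chart (x, x0) (0, u)"
proof -
  have p: "plot MG (\<lambda>x'. e x \<cdot> e x') x0" by (intro plot_mult plot_const e_carrier x plot_e x0_in)
  have fx: "e x \<cdot> e x0 = e x" by (simp add: e_x0 e_carrier[OF x])
  have "left_invariant_field G MG u (e x) = dplot MG (\<lambda>x'. e x \<cdot> e x') x0 u"
    by (simp add: left_invariant_field_def tangent_map_eq_dplot[OF atlas_G one_atlas])
  then have "field_comps MG \<phi> (left_invariant_field G MG u) x = comps MG \<phi> (e x \<cdot> e x0) (dplot MG (\<lambda>x'. e x \<cdot> e x') x0 u)"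
    by (simp add: field_comps_def fx)
  also have "\<dots> = fd (\<lambda>x'. snd \<phi> (e x \<cdot> e x')) x0 u"
    by (rule comps_dplot[OF atlas_G p \<phi>(3)]) (simp add: fx e_in[OF x])
  also have "\<dots> = fd (\<lambda>x'. mul_chart (x, x')) x0 u" by (simp add: mul_chart_def)
  also have "\<dots> = fd mul_chart (x, x0) (0, u)" by (rule fd_partial_snd[OF mul_chart_smooth(1)[OF x]])
  finally show ?thesis .
qed

lemma fd_left_invariant:
  "fd (field_comps MG \<phi> (left_invariant_field G MG u)) x0 v = fd2 mul_chart (x0, x0) (v, 0) (0, u)"
proof -
  have "fd (field_comps MG \<phi> (left_invariant_field G MG u)) x0 = fd (\<lambda>x. fd mul_chart (x, x0) (0, u)) x0"
    by (rule fd_cong) (use eventually_\<phi> in eventually_elim, rule field_comps_left_invariant)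
  also have "\<dots> = (\<lambda>v. fd2 mul_chart (x0, x0) (v, 0) (0, u) + fd mul_chart (x0, x0) 0)"
    by (rule fd_eqI, rule has_derivative_fd_along[where q = "\<lambda>x. (x, x0)" and r = "\<lambda>_. (0, u)", OF mul_chart_smooth(1)[OF x0_in]])
       (auto intro!: derivative_eq_intros simp: zero_prod_def)
  finally show ?thesis by (simp add: linear_0[OF smooth_near_linear[OF mul_chart_smooth(1)[OF x0_in]]])
qed

lemma lie_bracket_eq:
  "lie_bracket G MG u v = fd2 mul_chart (x0, x0) (u, 0) (0, v) - fd2 mul_chart (x0, x0) (v, 0) (0, u)"
  by (simp add: lie_bracket_def vector_field_bracket_def Let_def fd_left_invariant
      field_comps_left_invariant[OF x0_in] fd_mul_chart_snd)

end

section \<open>Invariant sprays in group coordinates\<close>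

text \<open>The inverse of the restriction of \<open>f\<close> to \<open>V\<close>, as a linear map on the whole target space.\<close>

lemma linear_section_on_complement:
  fixes f :: "'a::euclidean_space \<Rightarrow> 'b::euclidean_space"
  assumes f: "linear f" and V: "subspace V" and inj: "\<And>v. v \<in> V \<Longrightarrow> f v = 0 \<Longrightarrow> v = 0"
    and surj: "\<And>u. \<exists>v\<in>V. f v = u"
  shows "\<exists>q. linear q \<and> (\<forall>u. q u \<in> V \<and> f (q u) = u) \<and> (\<forall>v\<in>V. q (f v) = v)"
proof -
  obtain q where q: "\<And>u. q u \<in> V \<and> f (q u) = u" using surj by metis
  have eq: "v = v'" if "v \<in> V" "v' \<in> V" "f v = f v'" for v v'
    using inj[of "v - v'"] that V by (simp add: subspace_diff linear_diff[OF f])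
  have "linear q"
  proof (rule linearI)
    show "q (a + b) = q a + q b" for a b
      by (rule eq) (use q V in \<open>auto simp: subspace_add linear_add[OF f]\<close>)
    show "q (r *\<^sub>R a) = r *\<^sub>R q a" for r a
      by (rule eq) (use q V in \<open>auto simp: subspace_scale linear_scale[OF f]\<close>)
  qed
  moreover have "q (f v) = v" if "v \<in> V" for v using eq q that by blast
  ultimately show ?thesis using q by blast
qed

locale homogeneous_spray = homogeneous_space G MG H M
  for G :: "('g, 'z) monoid_scheme" and MG :: "('g, 'a::euclidean_space) manifold"
    and H :: "'g set" and M :: "('g set, 'e::euclidean_space) manifold" +
  fixes S :: "'g set \<times> 'e \<Rightarrow> 'e \<times> 'e" and \<mm> :: "'a set"
  assumes inv_spray: "invariant_spray G M S" and dec: "linear_decomposition G MG H \<mm>"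
begin

abbreviation \<iota> where "\<iota> \<equiv> iota G MG H M"

lemma spray: "spray M S" using inv_spray by (simp add: invariant_spray_def)

lemma subspace_m: "subspace \<mm>" using dec by (simp add: linear_decomposition_def)

lemma iota_m_inj: "u \<in> \<mm> \<Longrightarrow> \<iota> u = 0 \<Longrightarrow> u = 0"
  using dec lie_subalgebra_eq unfolding linear_decomposition_def by blast

lemma iota_m_surj: "\<exists>u\<in>\<mm>. \<iota> u = v"
proof -
  obtain u where u: "\<iota> u = v" using iota_surj by blast
  obtain a b where "a \<in> lie_subalgebra G MG H" "b \<in> \<mm>" "u = a + b"
    using dec unfolding linear_decomposition_def by blast
  then show ?thesis using u by (auto simp: lie_subalgebra_eq linear_add[OF iota_linear])
qed

text \<open>The inverse of \<open>iota\<close> on \<open>\<mm>\<close>, that is, the identification of the tangent space at the base point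
with \<open>\<mm>\<close>.\<close>

definition Q :: "'e \<Rightarrow> 'a" where
  "Q = (SOME q. linear q \<and> (\<forall>u. q u \<in> \<mm> \<and> \<iota> (q u) = u) \<and> (\<forall>v\<in>\<mm>. q (\<iota> v) = v))"

lemma Q: "linear Q" "Q v \<in> \<mm>" "\<iota> (Q v) = v" "u \<in> \<mm> \<Longrightarrow> Q (\<iota> u) = u"
proof -
  have "linear Q \<and> (\<forall>u. Q u \<in> \<mm> \<and> \<iota> (Q u) = u) \<and> (\<forall>v\<in>\<mm>. Q (\<iota> v) = v)"
    using someI_ex[OF linear_section_on_complement[OF iota_linear subspace_m iota_m_inj iota_m_surj]]
    unfolding Q_def by simp
  then show "linear Q" "Q v \<in> \<mm>" "\<iota> (Q v) = v" "u \<in> \<mm> \<Longrightarrow> Q (\<iota> u) = u" by auto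
qed

text \<open>The complement \<open>lie_subalgebra G MG H\<close> is the kernel of \<open>iota\<close>.\<close>

lemma proj_m_eq: "proj_m G MG H \<mm> u = Q (\<iota> u)"
  unfolding proj_m_def lie_subalgebra_eq
proof (rule the_equality)
  show "Q (\<iota> u) \<in> \<mm> \<and> u - Q (\<iota> u) \<in> {u. \<iota> u = 0}"
    using Q by (simp add: linear_diff[OF iota_linear])
  fix b assume "b \<in> \<mm> \<and> u - b \<in> {u. \<iota> u = 0}"
  then have "b \<in> \<mm>" "\<iota> b = \<iota> u" by (auto simp: linear_diff[OF iota_linear])
  then show "b = Q (\<iota> u)" using Q(4) by metis
qed

lemma bracket_m_in: "bracket_m G MG H \<mm> u v \<in> \<mm>"
  and iota_bracket_m: "\<iota> (bracket_m G MG H \<mm> u v) = \<iota> (lie_bracket G MG u v)"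
  using Q by (auto simp: bracket_m_def proj_m_eq)

lemma in_atlas_H: "H \<in> (\<Union>\<kappa>\<in>atlas M. fst \<kappa>)" using cover_M H_top by blast

abbreviation \<beta> where "\<beta> \<equiv> base_chart M H"
abbreviation y0 where "y0 \<equiv> snd \<beta> H"

lemma \<beta>: "\<beta> \<in> atlas M" "H \<in> fst \<beta>" "admissible M \<beta>" "\<beta> \<in> charts M" "chart_inv \<beta> y0 = H" "y0 \<in> snd \<beta> ` fst \<beta>"
proof -
  show b: "\<beta> \<in> atlas M" "H \<in> fst \<beta>" using base_chart[OF in_atlas_H] by auto
  show a: "admissible M \<beta>" using admissible_atlas[OF atlas_M b(1)] .
  show "\<beta> \<in> charts M" using atlas_subset_charts[OF M] b by blast
  show "chart_inv \<beta> y0 = H" using a b(2) by (intro chart_inv_chart) (simp_all add: admissible_def)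
  show "y0 \<in> snd \<beta> ` fst \<beta>" using b by blast
qed

text \<open>\<open>Psi\<close>, \<open>P\<close> and \<open>B\<close> are the maps of the introduction: orbit map of \<open>g\<close> times a product of two group elements,
its first derivative in the second factor, and its mixed second derivative.\<close>

definition Phi where "Phi \<kappa> g x = snd \<kappa> (g \<bullet>\<^sub>M \<pi> (e x))"
definition Psi where "Psi \<kappa> g z = snd \<kappa> (g \<bullet>\<^sub>M \<pi> (e (fst z) \<cdot> e (snd z)))"
definition P where "P \<kappa> g u = fd (Psi \<kappa> g) (x0, x0) (0, u)"
definition B where "B \<kappa> g a u = fd2 (Psi \<kappa> g) (x0, x0) (a, 0) (0, u)"

lemma plot_Phi: "g \<in> carrier G \<Longrightarrow> plot M (\<lambda>x. g \<bullet>\<^sub>M \<pi> (e x)) x0"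
  by (intro plot_act plot_proj plot_e x0_in)

lemma plot_Psi: "g \<in> carrier G \<Longrightarrow> x \<in> snd \<phi> ` fst \<phi> \<Longrightarrow> x' \<in> snd \<phi> ` fst \<phi> \<Longrightarrow>
    plot M (\<lambda>z. g \<bullet>\<^sub>M \<pi> (e (fst z) \<cdot> e (snd z))) (x, x')"
  by (intro plot_act plot_proj plot_mul_chart)

lemma Phi_smooth:
  assumes "g \<in> carrier G" "admissible M \<kappa>" "\<pi> g \<in> fst \<kappa>"
  shows "smooth_near x0 (Phi \<kappa> g)"
  using plot_chart(2)[OF atlas_M plot_Phi[OF assms(1)] assms(2)] assms(3)
  by (simp add: Phi_def[abs_def] e_x0 proj_one)

lemma Psi_smooth:
  assumes g: "g \<in> carrier G" and \<kappa>: "admissible M \<kappa>" and x: "x \<in> snd \<phi> ` fst \<phi>" and i: "\<pi> (g \<cdot> e x) \<in> fst \<kappa>"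
  shows "smooth_near (x, x0) (Psi \<kappa> g)"
  using plot_chart(2)[OF atlas_M plot_Psi[OF g x x0_in] \<kappa>] i act_proj[OF g e_carrier[OF x]] e_carrier[OF x]
  by (simp add: Psi_def[abs_def] e_x0)

lemma Psi_smooth_x0:
  assumes "g \<in> carrier G" "admissible M \<kappa>" "\<pi> g \<in> fst \<kappa>"
  shows "smooth_near (x0, x0) (Psi \<kappa> g)"
  by (rule Psi_smooth[OF assms(1,2) x0_in]) (simp add: e_x0 assms)

text \<open>Here \<open>Phi\<close> depends on the product only. This factorisation separates the symmetric from the
antisymmetric part of the mixed derivative \<open>B\<close>.\<close>

lemma Psi_eq_Phi_mul_chart: "\<forall>\<^sub>F z in nhds (x0, x0). Psi \<kappa> g z = Phi \<kappa> g (mul_chart z)"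
  using mul_chart_smooth(2)[OF x0_in]
  by eventually_elim (simp add: Psi_def Phi_def mul_chart_def case_prod_beta' chart_inv_chart[OF \<phi>(4)])

lemma mul_chart_x0: "mul_chart (x0, x0) = x0" by (rule mul_chart_x0_left[OF x0_in])

lemma fd_Psi:
  assumes "g \<in> carrier G" "admissible M \<kappa>" "\<pi> g \<in> fst \<kappa>"
  shows "fd (Psi \<kappa> g) (x0, x0) z = fd (Phi \<kappa> g) x0 (fd mul_chart (x0, x0) z)"
proof -
  have "fd (Psi \<kappa> g) (x0, x0) = fd (\<lambda>z. Phi \<kappa> g (mul_chart z)) (x0, x0)" by (rule fd_cong[OF Psi_eq_Phi_mul_chart])
  then show ?thesis
    using fd_chain[of "Phi \<kappa> g" mul_chart "(x0, x0)" z] smooth_near_differentiable[OF Phi_smooth[OF assms]]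
      smooth_near_differentiable[OF mul_chart_smooth(1)[OF x0_in]] by (simp add: mul_chart_x0)
qed

lemma fd2_Psi:
  assumes "g \<in> carrier G" "admissible M \<kappa>" "\<pi> g \<in> fst \<kappa>"
  shows "fd2 (Psi \<kappa> g) (x0, x0) a b =
    fd2 (Phi \<kappa> g) x0 (fd mul_chart (x0, x0) a) (fd mul_chart (x0, x0) b) + fd (Phi \<kappa> g) x0 (fd2 mul_chart (x0, x0) a b)"
proof -
  have "\<forall>\<^sub>F y in nhds (x0, x0). \<forall>\<^sub>F z in nhds y. Psi \<kappa> g z = Phi \<kappa> g (mul_chart z)"
    using Psi_eq_Phi_mul_chart by (simp add: eventually_eventually)
  then have "\<forall>\<^sub>F y in nhds (x0, x0). fd (Psi \<kappa> g) y b = fd (\<lambda>z. Phi \<kappa> g (mul_chart z)) y b"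
    by eventually_elim (drule fd_cong, simp)
  from fd_cong[OF this] show ?thesis
    using fd2_compose[where f = "Phi \<kappa> g" and q = mul_chart and z = "(x0, x0)" and a = a and b = b] Phi_smooth[OF assms] mul_chart_smooth(1)[OF x0_in] by (simp add: mul_chart_x0)
qed

lemma P_eq_Phi:
  assumes "g \<in> carrier G" "admissible M \<kappa>" "\<pi> g \<in> fst \<kappa>"
  shows "P \<kappa> g u = fd (Phi \<kappa> g) x0 u"
  by (simp add: P_def fd_Psi[OF assms] fd_mul_chart_snd)

lemma P_linear:
  assumes "g \<in> carrier G" "admissible M \<kappa>" "\<pi> g \<in> fst \<kappa>"
  shows "linear (P \<kappa> g)"
  using smooth_near_linear[OF Phi_smooth[OF assms]] by (simp add: P_eq_Phi[OF assms, abs_def])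

lemma comps_act_iota:
  assumes "g \<in> carrier G" "admissible M \<kappa>" "\<pi> g \<in> fst \<kappa>"
  shows "comps M \<kappa> (\<pi> g) (tangent_map M M (\<lambda>x. g \<bullet>\<^sub>M x) H (\<iota> u)) = P \<kappa> g u"
proof -
  have "tangent_map M M (\<lambda>x. g \<bullet>\<^sub>M x) H (\<iota> u) = dplot M (\<lambda>x. g \<bullet>\<^sub>M \<pi> (e x)) x0 u"
    using tangent_map_dplot[OF atlas_M atlas_M plot_proj[OF plot_e[OF x0_in]] smooth_at_act[OF assms(1)], of u] H_top
    by (simp add: iota_eq e_x0 proj_one)
  then show ?thesis
    using comps_dplot[OF atlas_M plot_Phi[OF assms(1)] assms(2), of u] assms(3)
    by (simp add: e_x0 proj_one P_eq_Phi[OF assms] Phi_def[abs_def])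
qed

lemma B_linear_left: "g \<in> carrier G \<Longrightarrow> admissible M \<kappa> \<Longrightarrow> \<pi> g \<in> fst \<kappa> \<Longrightarrow> linear (\<lambda>a. B \<kappa> g a u)"
  and B_linear_right: "g \<in> carrier G \<Longrightarrow> admissible M \<kappa> \<Longrightarrow> \<pi> g \<in> fst \<kappa> \<Longrightarrow> linear (\<lambda>u. B \<kappa> g a u)"
proof -
  assume as: "g \<in> carrier G" "admissible M \<kappa>" "\<pi> g \<in> fst \<kappa>"
  have 1: "linear (\<lambda>a::'a. (a, 0::'a))" "linear (\<lambda>a::'a. (0::'a, a))" by (auto intro!: linearI)
  show "linear (\<lambda>a. B \<kappa> g a u)"
    unfolding B_def using linear_compose[OF 1(1) fd2_linear_left[OF Psi_smooth_x0[OF as]]] by (simp add: o_def)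
  show "linear (\<lambda>u. B \<kappa> g a u)"
    unfolding B_def using linear_compose[OF 1(2) fd2_linear_right[OF Psi_smooth_x0[OF as]]] by (simp add: o_def)
qed

lemma B_bilinear: "g \<in> carrier G \<Longrightarrow> admissible M \<kappa> \<Longrightarrow> \<pi> g \<in> fst \<kappa> \<Longrightarrow> bounded_bilinear (B \<kappa> g)"
  by (intro bilinear_conv_bounded_bilinear[THEN iffD1]) (auto simp: bilinear_def B_linear_left B_linear_right)

lemma B_eq:
  assumes "g \<in> carrier G" "admissible M \<kappa>" "\<pi> g \<in> fst \<kappa>"
  shows "B \<kappa> g a b = fd2 (Phi \<kappa> g) x0 a b + P \<kappa> g (fd2 mul_chart (x0, x0) (a, 0) (0, b))"
  by (simp add: B_def fd2_Psi[OF assms] fd_mul_chart_fst fd_mul_chart_snd P_eq_Phi[OF assms])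

text \<open>The contribution of \<open>Phi\<close> is a second derivative and cancels by symmetry. The rest is the mixed second
derivative of the multiplication, whose antisymmetrisation is the Lie bracket.\<close>

lemma B_antisym:
  assumes "g \<in> carrier G" "admissible M \<kappa>" "\<pi> g \<in> fst \<kappa>"
  shows "B \<kappa> g a b - B \<kappa> g b a = P \<kappa> g (lie_bracket G MG a b)"
  by (simp add: B_eq[OF assms] lie_bracket_eq linear_diff[OF P_linear[OF assms]]
      fd2_commute[OF Phi_smooth[OF assms], of a b])

lemma P_eq_0_iff:
  assumes "g \<in> carrier G" "admissible M \<kappa>" "\<pi> g \<in> fst \<kappa>"
  shows "P \<kappa> g u = 0 \<longleftrightarrow> \<iota> u = 0"
  unfolding comps_act_iota[OF assms, symmetric]
  by (simp add: comps_eq_0_iff[OF atlas_M assms(2,3)] tangent_act_eq_0[OF assms(1) H_top])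

lemma P_bracket_m:
  assumes "g \<in> carrier G" "admissible M \<kappa>" "\<pi> g \<in> fst \<kappa>"
  shows "P \<kappa> g (bracket_m G MG H \<mm> a b) = P \<kappa> g (lie_bracket G MG a b)"
  unfolding comps_act_iota[OF assms, symmetric] by (simp add: iota_bracket_m)

text \<open>The map \<open>P \<kappa> g\<close> is \<open>iota\<close> followed by isomorphisms, so it restricts to an isomorphism on \<open>\<mm>\<close>.\<close>

lemma P_section:
  assumes "g \<in> carrier G" "admissible M \<kappa>" "\<pi> g \<in> fst \<kappa>"
  obtains q where "linear q" "\<And>u. q u \<in> \<mm>" "\<And>u. P \<kappa> g (q u) = u" "\<And>v. v \<in> \<mm> \<Longrightarrow> q (P \<kappa> g v) = v"
proof -
  have 1: "v = 0" if "v \<in> \<mm>" "P \<kappa> g v = 0" for v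
    using that iota_m_inj by (simp add: P_eq_0_iff[OF assms])
  have 2: "\<exists>v\<in>\<mm>. P \<kappa> g v = u" for u
  proof -
    have "chart_inv \<kappa> (snd \<kappa> (\<pi> g)) = \<pi> g"
      using assms(2,3) by (intro chart_inv_chart) (auto simp: admissible_def)
    then obtain v where v: "comps M \<kappa> (\<pi> g) v = u"
      using comps_dplot_chart_inv[OF atlas_M assms(2), of "snd \<kappa> (\<pi> g)" u] assms(3) by auto
    obtain v' where v': "tangent_map M M (\<lambda>x. g \<bullet>\<^sub>M x) H v' = v"
      using tangent_act_surj[OF assms(1) H_top] by blast
    obtain w where w: "w \<in> \<mm>" "\<iota> w = v'" using iota_m_surj by blast
    have "P \<kappa> g w = u" using comps_act_iota[OF assms, of w] by (simp add: w v v')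
    with w(1) show ?thesis by blast
  qed
  obtain q where "linear q \<and> (\<forall>u. q u \<in> \<mm> \<and> P \<kappa> g (q u) = u) \<and> (\<forall>v\<in>\<mm>. q (P \<kappa> g v) = v)"
    using linear_section_on_complement[OF P_linear[OF assms] subspace_m 1 2] by blast
  then show thesis using that by blast
qed

lemma P_base: "P \<beta> \<one>\<^bsub>G\<^esub> u = \<iota> u"
proof -
  have "\<pi> \<one>\<^bsub>G\<^esub> \<in> fst \<beta>" using \<beta>(2) by (simp add: proj_one)
  then have "P \<beta> \<one>\<^bsub>G\<^esub> u = fd (Phi \<beta> \<one>\<^bsub>G\<^esub>) x0 u" by (rule P_eq_Phi[OF one_closed \<beta>(3)])
  also have "fd (Phi \<beta> \<one>\<^bsub>G\<^esub>) x0 = fd (\<lambda>x. snd \<beta> (\<pi> (e x))) x0"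
    by (rule fd_cong) (use eventually_\<phi> in eventually_elim, simp add: Phi_def act_proj e_carrier)
  finally show ?thesis by (simp add: iota_eq dplot_def e_x0 proj_one)
qed

text \<open>\<open>push_forward\<close> evaluates the field at a preimage chosen by \<open>inv_into\<close>; it has the expected value because
the lifted action is injective on the slit tangent bundle.\<close>

lemma spray_invariant:
  assumes g: "g \<in> carrier G" and z: "z \<in> topspace (mtop (slit_tangent_bundle M))"
  shows "S (tangent_lift M (\<lambda>x. g \<bullet>\<^sub>M x) z) =
    tangent_map (slit_tangent_bundle M) (slit_tangent_bundle M) (tangent_lift M (\<lambda>x. g \<bullet>\<^sub>M x)) z (S z)"
proof -
  let ?F = "tangent_lift M (\<lambda>x. g \<bullet>\<^sub>M x)" and ?T = "topspace (mtop (slit_tangent_bundle M))"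
  have T: "?T = topspace (mtop M) \<times> (UNIV - {0})" by (rule topspace_slit_tangent_bundle[OF atlas_M open_M cover_M])
  have Fz: "?F z \<in> ?T" using z g by (auto simp: T tangent_lift_def act_top tangent_act_eq_0)
  have inj: "inj_on ?F ?T"
  proof (rule inj_onI)
    fix a b assume ab: "a \<in> ?T" "b \<in> ?T" "?F a = ?F b"
    obtain p v q w where pq: "a = (p, v)" "b = (q, w)" by (cases a, cases b)
    have t: "p \<in> topspace (mtop M)" "q \<in> topspace (mtop M)" using ab by (auto simp: T pq)
    have F: "g \<bullet>\<^sub>M p = g \<bullet>\<^sub>M q" "tangent_map M M (\<lambda>x. g \<bullet>\<^sub>M x) p v = tangent_map M M (\<lambda>x. g \<bullet>\<^sub>M x) q w"
      using ab(3) by (auto simp: pq tangent_lift_def)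
    have "inv\<^bsub>G\<^esub> g \<bullet>\<^sub>M (g \<bullet>\<^sub>M p) = inv\<^bsub>G\<^esub> g \<bullet>\<^sub>M (g \<bullet>\<^sub>M q)" by (simp only: F(1))
    then have p: "p = q" by (simp only: act_inv_act[OF g t(1)] act_inv_act[OF g t(2)])
    have F2: "tangent_map M M (\<lambda>x. g \<bullet>\<^sub>M x) p v = tangent_map M M (\<lambda>x. g \<bullet>\<^sub>M x) p w"
      using F(2) unfolding p .
    have "v = w" using tangent_act_inverse[OF g t(1), of v] unfolding F2 tangent_act_inverse[OF g t(1), of w] by (rule sym)
    with p show "a = b" by (simp add: pq)
  qed
  have "S (?F z) = push_forward (slit_tangent_bundle M) ?F S (?F z)"
    using inv_spray g Fz by (auto simp: invariant_spray_def)
  then show ?thesis by (simp add: push_forward_def inv_into_f_f[OF inj z])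
qed

text \<open>The spray vector field as seen in the reference chart at the base point: twice the spray coefficient,
corrected by the second order term of the parametrisation of \<open>G/H\<close> by the group.\<close>

definition eta_hat where "eta_hat w = 2 *\<^sub>R spray_coeff M S \<beta> y0 w + B \<beta> \<one>\<^bsub>G\<^esub> (Q w) (Q w)"
definition eta where "eta y = Q (eta_hat (\<iota> y))"

lemma eta_in: "eta y \<in> \<mm>" by (simp add: eta_def Q)

text \<open>At the identity and in the reference chart this is the definition of \<open>eta\<close>. The general case follows
from the transformation law: the map \<open>Psi \<kappa> g\<close> is the coordinate expression \<open>\<tau>\<close> of the action after
\<open>Psi \<beta> \<one>\<close>, so both \<open>B\<close> and twice the spray coefficient pick up the second derivative of \<open>\<tau>\<close>, with opposite
signs.\<close>

lemma spray_coeff_eq_eta: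
  assumes g: "g \<in> carrier G" and \<kappa>: "\<kappa> \<in> charts M" and i: "\<pi> g \<in> fst \<kappa>" and y: "y \<in> \<mm>" "y \<noteq> 0"
  shows "2 *\<^sub>R spray_coeff M S \<kappa> (snd \<kappa> (\<pi> g)) (P \<kappa> g y) + B \<kappa> g y y = P \<kappa> g (eta y)"
proof -
  have ak: "admissible M \<kappa>" by (rule admissible_charts[OF M \<kappa>])
  have i1: "\<pi> \<one>\<^bsub>G\<^esub> \<in> fst \<beta>" using \<beta>(2) by (simp add: proj_one)
  define \<tau> where "\<tau> x = snd \<kappa> (g \<bullet>\<^sub>M chart_inv \<beta> x)" for x
  have pt: "plot M (\<lambda>x. g \<bullet>\<^sub>M chart_inv \<beta> x) y0" by (intro plot_act plot_chart_inv atlas_M \<beta> g)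
  have st: "smooth_near y0 \<tau>" unfolding \<tau>_def using plot_chart(2)[OF atlas_M pt ak] i by (simp add: \<beta>)
  let ?z = "(x0, x0)"
  have sPsi: "smooth_near ?z (Psi \<beta> \<one>\<^bsub>G\<^esub>)" by (rule Psi_smooth_x0[OF one_closed \<beta>(3) i1])
  have Psi0: "Psi \<beta> \<one>\<^bsub>G\<^esub> ?z = y0" by (simp add: Psi_def e_x0 act_proj proj_one)
  have "\<forall>\<^sub>F z in nhds ?z. \<one>\<^bsub>G\<^esub> \<bullet>\<^sub>M \<pi> (e (fst z) \<cdot> e (snd z)) \<in> fst \<beta>"
    using plot_chart(1)[OF atlas_M plot_Psi[OF one_closed x0_in x0_in] \<beta>(3)] i1 by (simp add: e_x0 act_proj)
  then have ev: "\<forall>\<^sub>F z in nhds ?z. Psi \<kappa> g z = \<tau> (Psi \<beta> \<one>\<^bsub>G\<^esub> z)"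
    using plot_eventually[OF plot_mul_chart[OF x0_in x0_in]]
  proof eventually_elim
    case (elim z)
    have c: "e (fst z) \<cdot> e (snd z) \<in> carrier G" using plot_carrier[OF elim(2)] by simp
    have "inj_on (snd \<beta>) (fst \<beta>)" using \<beta>(3) by (simp add: admissible_def)
    from chart_inv_chart[OF this elim(1)] show ?case
      using c by (simp add: Psi_def \<tau>_def act_proj g)
  qed
  have PT: "fd (Psi \<kappa> g) ?z b = fd \<tau> y0 (fd (Psi \<beta> \<one>\<^bsub>G\<^esub>) ?z b)" for b
  proof -
    have "fd (Psi \<kappa> g) ?z = fd (\<lambda>z. \<tau> (Psi \<beta> \<one>\<^bsub>G\<^esub> z)) ?z" by (rule fd_cong[OF ev])
    then show ?thesis
      using fd_chain[of \<tau> "Psi \<beta> \<one>\<^bsub>G\<^esub>" ?z b] smooth_near_differentiable[OF st] smooth_near_differentiable[OF sPsi]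
      by (simp add: Psi0)
  qed
  have BT: "fd2 (Psi \<kappa> g) ?z a b = fd2 \<tau> y0 (fd (Psi \<beta> \<one>\<^bsub>G\<^esub>) ?z a) (fd (Psi \<beta> \<one>\<^bsub>G\<^esub>) ?z b)
     + fd \<tau> y0 (fd2 (Psi \<beta> \<one>\<^bsub>G\<^esub>) ?z a b)" for a b
  proof -
    have "\<forall>\<^sub>F y in nhds ?z. \<forall>\<^sub>F z in nhds y. Psi \<kappa> g z = \<tau> (Psi \<beta> \<one>\<^bsub>G\<^esub> z)"
      using ev by (simp add: eventually_eventually)
    then have "\<forall>\<^sub>F y in nhds ?z. fd (Psi \<kappa> g) y b = fd (\<lambda>z. \<tau> (Psi \<beta> \<one>\<^bsub>G\<^esub> z)) y b"
      by eventually_elim (drule fd_cong, simp)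
    from fd_cong[OF this] show ?thesis
      using fd2_compose[where f = \<tau> and q = "Psi \<beta> \<one>\<^bsub>G\<^esub>" and z = ?z and a = a and b = b] st sPsi by (simp add: Psi0)
  qed
  have P: "P \<kappa> g u = fd \<tau> y0 (\<iota> u)" for u
    using PT[of "(0, u)"] by (simp add: P_def P_base[unfolded P_def])
  have f1: "fd (Psi \<beta> \<one>\<^bsub>G\<^esub>) ?z (a, 0) = \<iota> a" for a
    using P_base[of a] by (simp add: fd_Psi[OF one_closed \<beta>(3) i1] fd_mul_chart_fst P_eq_Phi[OF one_closed \<beta>(3) i1])
  have Bt: "B \<kappa> g a b = fd2 \<tau> y0 (\<iota> a) (\<iota> b) + fd \<tau> y0 (B \<beta> \<one>\<^bsub>G\<^esub> a b)" for a b
    unfolding B_def BT f1 by (simp add: P_base[unfolded P_def])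
  have iy: "\<iota> y \<noteq> 0" using iota_m_inj y by blast
  have "2 *\<^sub>R spray_coeff M S \<kappa> (\<tau> y0) (fd \<tau> y0 (\<iota> y)) =
     2 *\<^sub>R fd \<tau> y0 (spray_coeff M S \<beta> y0 (\<iota> y)) - fd2 \<tau> y0 (\<iota> y) (\<iota> y)"
    unfolding \<tau>_def[abs_def]
  proof (rule spray_transform[OF M spray \<beta>(4) \<kappa> \<beta>(6) iy])
    show "smooth_at M M (\<lambda>x. g \<bullet>\<^sub>M x) p" if "p \<in> topspace (mtop M)" for p by (rule smooth_at_act[OF g that])
    show "g \<bullet>\<^sub>M chart_inv \<beta> y0 \<in> fst \<kappa>" using i by (simp add: \<beta>)
    show "fd (\<lambda>x. snd \<kappa> (g \<bullet>\<^sub>M chart_inv \<beta> x)) y0 (\<iota> y) \<noteq> 0"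
      using P[of y] P_eq_0_iff[OF g ak i, of y] iy by (simp add: \<tau>_def[abs_def])
  qed (rule spray_invariant[OF g])
  moreover have "\<tau> y0 = snd \<kappa> (\<pi> g)" by (simp add: \<tau>_def \<beta>)
  moreover have "P \<kappa> g (eta y) = fd \<tau> y0 (eta_hat (\<iota> y))" by (simp add: P eta_def Q)
  ultimately show ?thesis
    using y Q(4)[OF y(1)] smooth_near_linear[OF st] by (simp add: P Bt eta_hat_def linear_add linear_scale)
qed

text \<open>Smoothness of a spray is known in charts of the atlas, to which the reference chart \<open>\<beta>\<close> belongs.\<close>

lemma spray_coeff_smooth:
  assumes w: "w \<noteq> 0"
  shows "smooth_near w (spray_coeff M S \<beta> y0)"
proof -
  let ?SB = "slit_tangent_bundle M"
  let ?f = "field_comps ?SB (slit_chart M \<beta>) S"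
  let ?O = "snd (slit_chart M \<beta>) ` fst (slit_chart M \<beta>)"
  have O: "?O = snd \<beta> ` fst \<beta> \<times> (UNIV - {0})"
    unfolding fst_slit_chart by (rule slit_chart_image[OF atlas_M \<beta>(3) subset_refl])
  have "slit_chart M \<beta> \<in> atlas ?SB" using \<beta>(1) by (simp add: atlas_slit_tangent_bundle[OF open_M])
  then have "smooth_on ?O ?f" using spray unfolding spray_def smooth_vector_field_def by blast
  moreover have "open ?O" unfolding O using \<beta>(3) by (intro open_Times) (auto simp: admissible_def)
  ultimately have s: "smooth_near (y0, w) ?f" using O \<beta>(6) w by (intro smooth_nearI[of ?O]) auto
  have "smooth_near w (\<lambda>w. (- 1/2) *\<^sub>R snd (?f (y0, w)))"
    by (intro smooth_near_bounded_linear[OF bounded_linear_scaleR_right] smooth_near_bounded_linear[OF bounded_linear_snd]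
        smooth_near_compose[of "\<lambda>w. (y0, w)" w ?f] s smooth_near_Pair smooth_near_const smooth_near_ident)
  then show ?thesis
  proof (rule smooth_near_cong)
    have "\<forall>\<^sub>F w in nhds w. w \<noteq> 0" using w by (rule t1_space_nhds)
    then show "\<forall>\<^sub>F w in nhds w. (- 1/2) *\<^sub>R snd (?f (y0, w)) = spray_coeff M S \<beta> y0 w"
    proof eventually_elim
      case (elim w)
      show ?case
        using comps_spray[OF M spray \<beta>(4,6) elim] by (simp add: field_comps_def chart_inv_slit_chart[OF atlas_M \<beta>(3,6) elim])
    qed
  qed
qed

lemma eta_hat_smooth:
  assumes "w \<noteq> 0" shows "smooth_near w eta_hat"
proof -
  have i1: "\<pi> \<one>\<^bsub>G\<^esub> \<in> fst \<beta>" using \<beta>(2) by (simp add: proj_one)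
  have q: "smooth_near w Q" using smooth_near_linear_map[OF Q(1) smooth_near_ident[of w]] by simp
  show ?thesis unfolding eta_hat_def[abs_def]
    by (intro smooth_near_add smooth_near_bounded_linear[OF bounded_linear_scaleR_right] spray_coeff_smooth assms
        smooth_near_bilinear[OF B_bilinear[OF one_closed \<beta>(3) i1]] q)
qed

lemma eta_smooth:
  assumes "\<iota> y \<noteq> 0" shows "smooth_near y eta"
proof -
  have "smooth_near y \<iota>" using smooth_near_linear_map[OF iota_linear smooth_near_ident[of y]] by simp
  then show ?thesis unfolding eta_def[abs_def]
    by (intro smooth_near_linear_map[OF Q(1)] smooth_near_compose[of \<iota> y eta_hat] eta_hat_smooth assms)
qed

text \<open>The derivative of \<open>spray_coeff_eq_eta\<close> with respect to \<open>y\<close>. Since that identity expresses the spray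
coefficient through \<open>eta\<close>, differentiability in an arbitrary chart comes for free.\<close>

lemma nonlin_conn_eq:
  assumes g: "g \<in> carrier G" and \<kappa>: "\<kappa> \<in> charts M" and i: "\<pi> g \<in> fst \<kappa>" and y: "y \<in> \<mm>" "y \<noteq> 0" and w: "w \<in> \<mm>"
  shows "nonlin_conn M S \<kappa> (snd \<kappa> (\<pi> g)) (P \<kappa> g y) (P \<kappa> g w) =
    (1/2) *\<^sub>R (P \<kappa> g (fd eta y w) - (B \<kappa> g y w + B \<kappa> g w y))"
proof -
  have ak: "admissible M \<kappa>" by (rule admissible_charts[OF M \<kappa>])
  obtain q where q: "linear q" "\<And>u. q u \<in> \<mm>" "\<And>u. P \<kappa> g (q u) = u" "\<And>v. v \<in> \<mm> \<Longrightarrow> q (P \<kappa> g v) = v"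
    using P_section[OF g ak i] by blast
  have Pl: "bounded_linear (P \<kappa> g)" using P_linear[OF g ak i] linear_conv_bounded_linear by blast
  have ql: "bounded_linear q" using q(1) linear_conv_bounded_linear by blast
  have Py: "P \<kappa> g y \<noteq> 0" using q(4)[OF y(1)] y(2) linear_0[OF q(1)] by auto
  have iy: "\<iota> y \<noteq> 0" using iota_m_inj y by blast
  let ?f = "\<lambda>u. (1/2) *\<^sub>R (P \<kappa> g (eta (q u)) - B \<kappa> g (q u) (q u))"
  have "(eta has_derivative fd eta (q (P \<kappa> g y))) (at (q (P \<kappa> g y)))"
    using smooth_near_has_derivative[OF eta_smooth[OF iy]] by (simp add: q(4)[OF y(1)])
  from diff_chain_at[OF bounded_linear_imp_has_derivative[OF ql] this]
  have d1: "((\<lambda>u. eta (q u)) has_derivative (\<lambda>u. fd eta y (q u))) (at (P \<kappa> g y))"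
    by (simp add: o_def q(4)[OF y(1)])
  have d: "(?f has_derivative (\<lambda>u. (1/2) *\<^sub>R (P \<kappa> g (fd eta y (q u)) -
      (B \<kappa> g (q (P \<kappa> g y)) (q u) + B \<kappa> g (q u) (q (P \<kappa> g y)))))) (at (P \<kappa> g y))"
    by (intro has_derivative_scaleR_right has_derivative_diff bounded_linear.has_derivative[OF Pl] d1
       bounded_bilinear.FDERIV[OF B_bilinear[OF g ak i]] bounded_linear_imp_has_derivative ql)
  have ev: "\<forall>\<^sub>F u in nhds (P \<kappa> g y). u \<noteq> 0" using Py by (rule t1_space_nhds)
  have "\<forall>\<^sub>F u in nhds (P \<kappa> g y). ?f u = spray_coeff M S \<kappa> (snd \<kappa> (\<pi> g)) u"
    using ev
  proof eventually_elim
    case (elim u)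
    have "q u \<noteq> 0" using elim q(3)[of u] linear_0[OF P_linear[OF g ak i]] by auto
    from spray_coeff_eq_eta[OF g \<kappa> i q(2) this]
    have "P \<kappa> g (eta (q u)) - B \<kappa> g (q u) (q u) = 2 *\<^sub>R spray_coeff M S \<kappa> (snd \<kappa> (\<pi> g)) u"
      by (simp add: q(3) algebra_simps)
    then show ?case by simp
  qed
  from fd_cong[OF this, symmetric]
  have "fd (spray_coeff M S \<kappa> (snd \<kappa> (\<pi> g))) (P \<kappa> g y) = fd ?f (P \<kappa> g y)" .
  then show ?thesis
    unfolding nonlin_conn_def by (simp add: fd_eqI[OF d] q(4) y w)
qed

end

context homogeneous_space
begin

section \<open>Curves in the group and their projections\<close>

text \<open>The coordinate of \<open>g\<inverse> \<gamma>\<close> in the chart at the identity; used with \<open>g\<close> the value of \<open>\<gamma>\<close> at the time of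
interest, so that the point of reference becomes \<open>x0\<close>.\<close>

definition left_coord :: "'g \<Rightarrow> (real \<Rightarrow> 'g) \<Rightarrow> real \<Rightarrow> 'a" where
  "left_coord g \<gamma> s = snd \<phi> (inv\<^bsub>G\<^esub> g \<cdot> \<gamma> s)"

text \<open>Left division in the chart \<open>\<phi>\<close>, the inverse operation of \<open>mul_chart\<close>. It recovers the left velocity from
the derivative of a coordinate curve.\<close>

definition ldiv_chart :: "'a \<times> 'a \<Rightarrow> 'a" where
  "ldiv_chart = (\<lambda>(x, x'). snd \<phi> (inv\<^bsub>G\<^esub> (e x) \<cdot> e x'))"

lemma plot_left: "plot MG \<gamma> t \<Longrightarrow> g \<in> carrier G \<Longrightarrow> plot MG (\<lambda>s. g \<cdot> \<gamma> s) t"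
  by (intro plot_mult plot_const)

lemma smooth_at_left: "g \<in> carrier G \<Longrightarrow> h \<in> carrier G \<Longrightarrow> smooth_at MG MG (\<lambda>x. g \<cdot> x) h"
  unfolding smooth_at_def
  by (intro plot_left plot_chart_inv atlas_G admissible_atlas)
     (use base_chart[of h MG] cover_G topMG in auto)

lemma left_velocity_eq:
  assumes "plot MG \<gamma> t"
  shows "left_velocity G MG \<gamma> t = dplot MG (\<lambda>s. inv\<^bsub>G\<^esub> (\<gamma> t) \<cdot> \<gamma> s) t 1"
  using tangent_map_dplot[OF atlas_G atlas_G assms smooth_at_left, of "inv\<^bsub>G\<^esub> (\<gamma> t)" 1] plot_carrier[OF assms]
  by (simp add: left_velocity_def velocity_eq_dplot[OF atlas_G assms])

lemma left_velocity_eq_fd: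
  assumes "plot MG \<gamma> t"
  shows "left_velocity G MG \<gamma> t = fd (\<lambda>s. snd \<phi> (inv\<^bsub>G\<^esub> (\<gamma> t) \<cdot> \<gamma> s)) t 1"
  using plot_carrier[OF assms] by (simp add: left_velocity_eq[OF assms] dplot_def)

lemma left_coord_smooth:
  assumes \<gamma>: "plot MG \<gamma> t" and g: "g \<in> carrier G" and i: "inv\<^bsub>G\<^esub> g \<cdot> \<gamma> t \<in> fst \<phi>"
  shows "\<forall>\<^sub>F s in nhds t. inv\<^bsub>G\<^esub> g \<cdot> \<gamma> s \<in> fst \<phi>" "smooth_near t (left_coord g \<gamma>)"
  using plot_chart[OF atlas_G plot_left[OF \<gamma>, of "inv\<^bsub>G\<^esub> g"] \<phi>(3)] g i by (auto simp: left_coord_def[abs_def])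

lemma e_left_coord: "inv\<^bsub>G\<^esub> g \<cdot> \<gamma> s \<in> fst \<phi> \<Longrightarrow> e (left_coord g \<gamma> s) = inv\<^bsub>G\<^esub> g \<cdot> \<gamma> s"
  unfolding left_coord_def by (rule chart_inv_chart[OF \<phi>(4)])

lemma left_coord_in: "inv\<^bsub>G\<^esub> g \<cdot> \<gamma> s \<in> fst \<phi> \<Longrightarrow> left_coord g \<gamma> s \<in> snd \<phi> ` fst \<phi>"
  unfolding left_coord_def by blast

lemma ldiv_chart_smooth:
  assumes x: "x \<in> snd \<phi> ` fst \<phi>"
  shows "smooth_near (x, x) ldiv_chart"
proof -
  have p: "plot MG (\<lambda>z. inv\<^bsub>G\<^esub> (e (fst z)) \<cdot> e (snd z)) (x, x)"
    by (intro plot_mult plot_inv plot_e_fst plot_e_snd x)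
  show ?thesis
    using plot_chart(2)[OF atlas_G p \<phi>(3)] \<phi>(2) e_carrier[OF x] by (simp add: ldiv_chart_def case_prod_beta')
qed

lemma inv_mul_cancel: "g \<in> carrier G \<Longrightarrow> a \<in> carrier G \<Longrightarrow> b \<in> carrier G \<Longrightarrow>
   inv\<^bsub>G\<^esub> (inv\<^bsub>G\<^esub> g \<cdot> a) \<cdot> (inv\<^bsub>G\<^esub> g \<cdot> b) = inv\<^bsub>G\<^esub> a \<cdot> b"
  by (simp add: inv_mult_group m_assoc) (simp add: m_assoc[symmetric])

text \<open>Near \<open>t\<close> the curve \<open>\<gamma>\<close> is \<open>\<gamma> t\<close> times a curve through the identity whose velocity is the left velocity.\<close>

lemma fd_left_coord:
  assumes \<gamma>: "plot MG \<gamma> t" and g: "g \<in> carrier G" and i: "inv\<^bsub>G\<^esub> g \<cdot> \<gamma> t \<in> fst \<phi>"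
  shows "fd (left_coord g \<gamma>) t 1 = fd mul_chart (left_coord g \<gamma> t, x0) (0, left_velocity G MG \<gamma> t)"
proof -
  have c: "\<gamma> t \<in> carrier G" by (rule plot_carrier[OF \<gamma>])
  let ?k = "left_coord (\<gamma> t) \<gamma>"
  have it: "inv\<^bsub>G\<^esub> (\<gamma> t) \<cdot> \<gamma> t \<in> fst \<phi>" using c \<phi>(2) by simp
  note k = left_coord_smooth[OF \<gamma> c it]
  have kt: "?k t = x0" using c by (simp add: left_coord_def)
  have "\<forall>\<^sub>F s in nhds t. left_coord g \<gamma> s = mul_chart (left_coord g \<gamma> t, ?k s)"
    using k(1) plot_eventually[OF \<gamma>]
  proof eventually_elim
    case (elim s)
    have "\<gamma> s \<in> carrier G" by (rule plot_carrier[OF elim(2)])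
    then have "(inv\<^bsub>G\<^esub> g \<cdot> \<gamma> t) \<cdot> (inv\<^bsub>G\<^esub> (\<gamma> t) \<cdot> \<gamma> s) = inv\<^bsub>G\<^esub> g \<cdot> \<gamma> s"
      using c g by (simp add: m_assoc) (simp add: m_assoc[symmetric])
    then show ?case by (simp add: mul_chart_def e_left_coord[where \<gamma> = \<gamma> and s = t, OF i] e_left_coord[where \<gamma> = \<gamma> and s = s, OF elim(1)]) (simp add: left_coord_def)
  qed
  then have "fd (left_coord g \<gamma>) t = fd (\<lambda>s. mul_chart (left_coord g \<gamma> t, ?k s)) t" by (rule fd_cong)
  also have "\<dots> = (\<lambda>v. fd mul_chart (left_coord g \<gamma> t, x0) (0, fd ?k t v))"
  proof (rule fd_eqI)
    have "((\<lambda>s. (left_coord g \<gamma> t, ?k s)) has_derivative (\<lambda>v. (0, fd ?k t v))) (at t)"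
      by (intro has_derivative_Pair has_derivative_const smooth_near_has_derivative k)
    from diff_chain_at[OF this, of mul_chart] smooth_near_has_derivative[OF mul_chart_smooth(1)[OF left_coord_in[where \<gamma> = \<gamma> and s = t, OF i]]]
    show "((\<lambda>s. mul_chart (left_coord g \<gamma> t, ?k s)) has_derivative (\<lambda>v. fd mul_chart (left_coord g \<gamma> t, x0) (0, fd ?k t v))) (at t)"
      by (simp add: o_def kt)
  qed
  finally show ?thesis by (simp add: left_velocity_eq_fd[OF \<gamma>] left_coord_def[abs_def])
qed

lemma left_velocity_ldiv_chart:
  assumes \<gamma>: "plot MG \<gamma> t" and g: "g \<in> carrier G" and i: "inv\<^bsub>G\<^esub> g \<cdot> \<gamma> t \<in> fst \<phi>"
  shows "left_velocity G MG \<gamma> t = fd ldiv_chart (left_coord g \<gamma> t, left_coord g \<gamma> t) (0, fd (left_coord g \<gamma>) t 1)"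
proof -
  have c: "\<gamma> t \<in> carrier G" by (rule plot_carrier[OF \<gamma>])
  note k = left_coord_smooth[OF \<gamma> g i]
  have "\<forall>\<^sub>F s in nhds t. snd \<phi> (inv\<^bsub>G\<^esub> (\<gamma> t) \<cdot> \<gamma> s) = ldiv_chart (left_coord g \<gamma> t, left_coord g \<gamma> s)"
    using k(1) plot_eventually[OF \<gamma>]
    by eventually_elim (simp add: ldiv_chart_def e_left_coord i inv_mul_cancel[OF g c plot_carrier])
  then have "fd (\<lambda>s. snd \<phi> (inv\<^bsub>G\<^esub> (\<gamma> t) \<cdot> \<gamma> s)) t = fd (\<lambda>s. ldiv_chart (left_coord g \<gamma> t, left_coord g \<gamma> s)) t" by (rule fd_cong)
  also have "\<dots> = (\<lambda>v. fd ldiv_chart (left_coord g \<gamma> t, left_coord g \<gamma> t) (0, fd (left_coord g \<gamma>) t v))"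
  proof (rule fd_eqI)
    have "((\<lambda>s. (left_coord g \<gamma> t, left_coord g \<gamma> s)) has_derivative (\<lambda>v. (0, fd (left_coord g \<gamma>) t v))) (at t)"
      by (intro has_derivative_Pair has_derivative_const smooth_near_has_derivative k)
    from diff_chain_at[OF this, of ldiv_chart] smooth_near_has_derivative[OF ldiv_chart_smooth[OF left_coord_in[where \<gamma> = \<gamma> and s = t, OF i]]]
    show "((\<lambda>s. ldiv_chart (left_coord g \<gamma> t, left_coord g \<gamma> s)) has_derivative (\<lambda>v. fd ldiv_chart (left_coord g \<gamma> t, left_coord g \<gamma> t) (0, fd (left_coord g \<gamma>) t v))) (at t)"
      by (simp add: o_def)
  qed
  finally show ?thesis by (simp add: left_velocity_eq_fd[OF \<gamma>])
qed

lemma left_velocity_smooth: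
  assumes \<gamma>: "plot MG \<gamma> t"
  shows "smooth_near t (left_velocity G MG \<gamma>)"
proof -
  have c: "\<gamma> t \<in> carrier G" by (rule plot_carrier[OF \<gamma>])
  let ?k = "left_coord (\<gamma> t) \<gamma>"
  have it: "inv\<^bsub>G\<^esub> (\<gamma> t) \<cdot> \<gamma> t \<in> fst \<phi>" using c \<phi>(2) by simp
  note k = left_coord_smooth[OF \<gamma> c it]
  have "smooth_near t (\<lambda>s. fd ldiv_chart (?k s, ?k s) (0, fd ?k s 1))"
    by (rule smooth_near_fd[where q = "\<lambda>s. (?k s, ?k s)" and r = "\<lambda>s. (0, fd ?k s 1)"])
       (intro ldiv_chart_smooth left_coord_in[where \<gamma> = \<gamma> and s = t, OF it] smooth_near_Pair k smooth_near_const smooth_near_fd_const)+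
  then show ?thesis
  proof (rule smooth_near_cong)
    show "\<forall>\<^sub>F s in nhds t. fd ldiv_chart (?k s, ?k s) (0, fd ?k s 1) = left_velocity G MG \<gamma> s"
      using k(1) plot_eventually[OF \<gamma>] by eventually_elim (use left_velocity_ldiv_chart[OF _ c] in auto)
  qed
qed

lemma fd_ldiv_chart_mul_chart:
  assumes x: "x \<in> snd \<phi> ` fst \<phi>"
  shows "fd ldiv_chart (x, x) (0, fd mul_chart (x, x0) (0, u)) = u"
proof -
  have m: "smooth_near (x, x0) mul_chart" by (rule mul_chart_smooth(1)[OF x])
  have "plot MG (\<lambda>x'. e x \<cdot> e x') x0" by (intro plot_mult plot_const e_carrier x plot_e x0_in)
  from plot_chart(1)[OF atlas_G this \<phi>(3)]
  have ev: "\<forall>\<^sub>F x' in nhds x0. e x \<cdot> e x' \<in> fst \<phi>" using e_carrier[OF x] e_in[OF x] by (simp add: e_x0)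
  have "\<forall>\<^sub>F x' in nhds x0. ldiv_chart (x, mul_chart (x, x')) = x'"
    using ev eventually_\<phi>
  proof eventually_elim
    case (elim x')
    have "inv\<^bsub>G\<^esub> (e x) \<cdot> (e x \<cdot> e x') = e x'"
      using e_carrier[OF x] e_carrier[OF elim(2)] by (simp add: m_assoc[symmetric])
    then show ?case using elim by (simp add: ldiv_chart_def mul_chart_def chart_inv_chart[OF \<phi>(4) elim(1)] \<phi>_e)
  qed
  then have 1: "fd (\<lambda>x'. ldiv_chart (x, mul_chart (x, x'))) x0 = fd (\<lambda>x'. x') x0" by (rule fd_cong)
  have d: "((\<lambda>x'. (x, mul_chart (x, x'))) has_derivative (\<lambda>v. (0, fd mul_chart (x, x0) (0, v)))) (at x0)"
  proof (intro has_derivative_Pair has_derivative_const)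
    have "((\<lambda>x'. (x, x')) has_derivative (\<lambda>v. (0, v))) (at x0)" by (auto intro!: derivative_eq_intros)
    from diff_chain_at[OF this smooth_near_has_derivative[OF m]]
    show "((\<lambda>x'. mul_chart (x, x')) has_derivative (\<lambda>v. fd mul_chart (x, x0) (0, v))) (at x0)" by (simp add: o_def)
  qed
  have "((\<lambda>x'. ldiv_chart (x, mul_chart (x, x'))) has_derivative (\<lambda>v. fd ldiv_chart (x, x) (0, fd mul_chart (x, x0) (0, v)))) (at x0)"
    using diff_chain_at[OF d, of ldiv_chart] smooth_near_has_derivative[OF ldiv_chart_smooth[OF x]]
    by (simp add: o_def mul_chart_x0_right[OF x])
  from fd_eqI[OF this] 1 show ?thesis by (simp add: fun_eq_iff)
qed

lemma velocity_proj:
  assumes \<gamma>: "plot MG \<gamma> t"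
  shows "velocity M (\<lambda>s. \<pi> (\<gamma> s)) t = tangent_map M M (\<lambda>x. \<gamma> t \<bullet>\<^sub>M x) H (iota G MG H M (left_velocity G MG \<gamma> t))"
proof -
  have c: "\<gamma> t \<in> carrier G" by (rule plot_carrier[OF \<gamma>])
  let ?f = "\<lambda>s. inv\<^bsub>G\<^esub> (\<gamma> t) \<cdot> \<gamma> s"
  have f: "plot MG ?f t" "?f t = \<one>\<^bsub>G\<^esub>" using c by (auto intro: plot_left \<gamma>)
  have pf: "plot M (\<lambda>s. \<pi> (?f s)) t" by (rule plot_proj[OF f(1)])
  have "iota G MG H M (left_velocity G MG \<gamma> t) = dplot M (\<lambda>s. \<pi> (?f s)) t 1"
    unfolding left_velocity_eq[OF \<gamma>] by (rule iota_dplot[OF f])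
  then have "tangent_map M M (\<lambda>x. \<gamma> t \<bullet>\<^sub>M x) H (iota G MG H M (left_velocity G MG \<gamma> t)) =
      dplot M (\<lambda>s. \<gamma> t \<bullet>\<^sub>M \<pi> (?f s)) t 1"
    using tangent_map_dplot[OF atlas_M atlas_M pf smooth_at_act[OF c], of 1] H_top by (simp add: c proj_one)
  also have "dplot M (\<lambda>s. \<gamma> t \<bullet>\<^sub>M \<pi> (?f s)) t = dplot M (\<lambda>s. \<pi> (\<gamma> s)) t"
  proof (rule dplot_cong)
    show "\<forall>\<^sub>F s in nhds t. \<gamma> t \<bullet>\<^sub>M \<pi> (?f s) = \<pi> (\<gamma> s)"
      using plot_eventually[OF \<gamma>]
    proof eventually_elim
      case (elim s)
      have "\<gamma> s \<in> carrier G" by (rule plot_carrier[OF elim])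
      then show ?case using c by (simp add: act_proj m_assoc[symmetric])
    qed
  qed
  finally show ?thesis by (simp add: velocity_eq_dplot[OF atlas_M plot_proj[OF \<gamma>]])
qed

lemma velocity_proj_one:
  assumes \<gamma>: "plot MG \<gamma> t" "\<gamma> t = \<one>\<^bsub>G\<^esub>"
  shows "velocity M (\<lambda>s. \<pi> (\<gamma> s)) t = iota G MG H M (left_velocity G MG \<gamma> t)"
proof -
  have "dplot MG (\<lambda>s. inv\<^bsub>G\<^esub> (\<gamma> t) \<cdot> \<gamma> s) t = dplot MG \<gamma> t"
    by (rule dplot_cong) (use plot_eventually[OF \<gamma>(1)] in eventually_elim, drule plot_carrier, simp add: \<gamma>(2))
  then show ?thesis
    using iota_dplot[OF \<gamma>, of 1] by (simp add: velocity_eq_dplot[OF atlas_M plot_proj[OF \<gamma>(1)]] left_velocity_eq[OF \<gamma>(1)])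
qed

end

context homogeneous_spray
begin

text \<open>The group elements \<open>\<gamma> s\<close> for different \<open>s\<close> are absorbed into the first argument of the single function
\<open>Psi \<kappa> g\<close>; only this makes it possible to differentiate in \<open>s\<close>.\<close>

lemma comps_along:
  assumes \<gamma>: "plot MG \<gamma> s" and g: "g \<in> carrier G" and i: "inv\<^bsub>G\<^esub> g \<cdot> \<gamma> s \<in> fst \<phi>"
    and \<kappa>: "admissible M \<kappa>" "\<pi> (\<gamma> s) \<in> fst \<kappa>"
  shows "comps M \<kappa> (\<pi> (\<gamma> s)) (tangent_map M M (\<lambda>x. \<gamma> s \<bullet>\<^sub>M x) H (\<iota> u)) = fd (Psi \<kappa> g) (left_coord g \<gamma> s, x0) (0, u)"
proof -
  have c: "\<gamma> s \<in> carrier G" by (rule plot_carrier[OF \<gamma>])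
  have ge: "g \<cdot> e (left_coord g \<gamma> s) = \<gamma> s" using c g by (simp add: e_left_coord[where \<gamma> = \<gamma> and s = s, OF i] m_assoc[symmetric])
  have "comps M \<kappa> (\<pi> (\<gamma> s)) (tangent_map M M (\<lambda>x. \<gamma> s \<bullet>\<^sub>M x) H (\<iota> u)) = fd (Phi \<kappa> (\<gamma> s)) x0 u"
    by (simp add: comps_act_iota[OF c \<kappa>] P_eq_Phi[OF c \<kappa>])
  also have "fd (Phi \<kappa> (\<gamma> s)) x0 = fd (\<lambda>x. Psi \<kappa> g (left_coord g \<gamma> s, x)) x0"
  proof (rule fd_cong)
    show "\<forall>\<^sub>F x in nhds x0. Phi \<kappa> (\<gamma> s) x = Psi \<kappa> g (left_coord g \<gamma> s, x)"
      using eventually_\<phi>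
    proof eventually_elim
      case (elim x)
      have "\<gamma> s \<bullet>\<^sub>M \<pi> (e x) = g \<bullet>\<^sub>M \<pi> (e (left_coord g \<gamma> s) \<cdot> e x)"
        using ge c g e_carrier[OF elim] e_carrier[OF left_coord_in[where \<gamma> = \<gamma> and s = s, OF i]] by (simp add: act_proj m_assoc[symmetric])
      then show ?case by (simp add: Phi_def Psi_def)
    qed
  qed
  also have "fd (\<lambda>x. Psi \<kappa> g (left_coord g \<gamma> s, x)) x0 u = fd (Psi \<kappa> g) (left_coord g \<gamma> s, x0) (0, u)"
    by (rule fd_partial_snd[OF Psi_smooth[OF g \<kappa>(1) left_coord_in[where \<gamma> = \<gamma> and s = s, OF i]]]) (simp add: ge \<kappa>(2))
  finally show ?thesis .
qed

text \<open>The derivative of the expression in \<open>comps_along\<close>. At time \<open>t\<close> the coordinate \<open>left_coord (\<gamma> t) \<gamma>\<close> passes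
through \<open>x0\<close> with the left velocity of \<open>\<gamma>\<close> as its derivative.\<close>

lemma field_derivative:
  assumes \<gamma>: "plot MG \<gamma> t" and \<kappa>: "admissible M \<kappa>" "\<pi> (\<gamma> t) \<in> fst \<kappa>"
    and w: "(w has_vector_derivative w') (at t)"
  shows "((\<lambda>s. comps M \<kappa> (\<pi> (\<gamma> s)) (tangent_map M M (\<lambda>x. \<gamma> s \<bullet>\<^sub>M x) H (\<iota> (w s)))) has_vector_derivative
     B \<kappa> (\<gamma> t) (left_velocity G MG \<gamma> t) (w t) + P \<kappa> (\<gamma> t) w') (at t)"
proof -
  let ?g = "\<gamma> t"
  have c: "?g \<in> carrier G" by (rule plot_carrier[OF \<gamma>])
  let ?k = "left_coord ?g \<gamma>"
  have it: "inv\<^bsub>G\<^esub> ?g \<cdot> \<gamma> t \<in> fst \<phi>" using c \<phi>(2) by simp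
  note k = left_coord_smooth[OF \<gamma> c it]
  have kt: "?k t = x0" using c by (simp add: left_coord_def)
  let ?l = "left_velocity G MG \<gamma> t"
  have kd: "fd ?k t v = v *\<^sub>R ?l" for v
    using fd_left_coord[OF \<gamma> c it] linear_scale[OF smooth_near_linear[OF k(2)], of v 1] by (simp add: kt fd_mul_chart_snd)
  have q: "((\<lambda>s. (?k s, x0)) has_derivative (\<lambda>v. (v *\<^sub>R ?l, 0))) (at t)"
    using has_derivative_Pair[OF smooth_near_has_derivative[OF k(2)] has_derivative_const[of x0 "at t"]] by (simp add: kd)
  have r: "((\<lambda>s. (0::'a, w s)) has_derivative (\<lambda>v. (0, v *\<^sub>R w'))) (at t)"
    using has_derivative_Pair[OF has_derivative_const w[unfolded has_vector_derivative_def]] .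
  have sm: "smooth_near (?k t, x0) (Psi \<kappa> ?g)" unfolding kt by (rule Psi_smooth_x0[OF c \<kappa>])
  have d: "((\<lambda>s. fd (Psi \<kappa> ?g) (?k s, x0) (0, w s)) has_derivative
      (\<lambda>v. fd2 (Psi \<kappa> ?g) (?k t, x0) (v *\<^sub>R ?l, 0) (0, w t) + fd (Psi \<kappa> ?g) (?k t, x0) (0, v *\<^sub>R w'))) (at t)"
    by (rule has_derivative_fd_along[where q = "\<lambda>s. (?k s, x0)" and r = "\<lambda>s. (0, w s)", OF sm q r])
  have eq: "fd2 (Psi \<kappa> ?g) (?k t, x0) (v *\<^sub>R ?l, 0) (0, w t) + fd (Psi \<kappa> ?g) (?k t, x0) (0, v *\<^sub>R w')
     = v *\<^sub>R (B \<kappa> ?g ?l (w t) + P \<kappa> ?g w')" for v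
    using linear_scale[OF B_linear_left[OF c \<kappa>], of v ?l "w t"] linear_scale[OF P_linear[OF c \<kappa>], of v w']
    by (simp add: kt B_def P_def scaleR_add_right)
  have d': "((\<lambda>s. fd (Psi \<kappa> ?g) (?k s, x0) (0, w s)) has_vector_derivative (B \<kappa> ?g ?l (w t) + P \<kappa> ?g w')) (at t)"
    unfolding has_vector_derivative_def using d by (simp only: eq)
  have ev: "\<forall>\<^sub>F s in nhds t. fd (Psi \<kappa> ?g) (?k s, x0) (0, w s) = comps M \<kappa> (\<pi> (\<gamma> s)) (tangent_map M M (\<lambda>x. \<gamma> s \<bullet>\<^sub>M x) H (\<iota> (w s)))"
    using k(1) plot_eventually[OF \<gamma>] plot_chart(1)[OF atlas_M plot_proj[OF \<gamma>] \<kappa>]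
    by eventually_elim (use comps_along[OF _ c _ \<kappa>(1)] in auto)
  show ?thesis
    unfolding has_vector_derivative_def
    by (rule has_derivative_transform_eventually[OF d'[unfolded has_vector_derivative_def]])
       (use ev eventually_nhds_x_imp_x[OF ev] in \<open>auto simp: eventually_nhds_conv_at\<close>)
qed

text \<open>Being \<open>\<mm>\<close>-valued is a linear equation, which can be differentiated.\<close>

lemma m_derivative:
  assumes "(w has_vector_derivative w') (at t)" "\<forall>\<^sub>F s in nhds t. w s \<in> \<mm>"
  shows "w' \<in> \<mm>"
proof -
  have l: "bounded_linear (\<lambda>u. Q (\<iota> u))"
    using linear_compose[OF iota_linear Q(1)] linear_conv_bounded_linear by (auto simp: o_def)
  have "((\<lambda>s. Q (\<iota> (w s))) has_vector_derivative Q (\<iota> w')) (at t)"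
    by (rule bounded_linear.has_vector_derivative[OF l assms(1)])
  moreover obtain T where T: "open T" "t \<in> T" "\<And>s. s \<in> T \<Longrightarrow> w s \<in> \<mm>" using assms(2) by (auto simp: eventually_nhds)
  ultimately have "(w has_vector_derivative Q (\<iota> w')) (at t)"
    using has_vector_derivative_transform_within_open[of "\<lambda>s. Q (\<iota> (w s))" "Q (\<iota> w')" t T w] Q(4) by blast
  then have "w' = Q (\<iota> w')" using vector_derivative_unique_at[OF assms(1)] by blast
  then show ?thesis using Q(2) by metis
qed

text \<open>The velocity of the lifted curve and the spray have the same horizontal components, so they agree if and
only if the vertical components do. The vertical component of the velocity is the derivative of the
coordinate velocity, which \<open>field_derivative\<close> computes as \<open>B(Y, Y) + P Y'\<close>; that of the spray is
\<open>B(Y, Y) - P (eta Y)\<close>.\<close>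

lemma geodesic_equation_iff:
  assumes J: "open J" "t \<in> J" and \<gamma>: "\<And>s. s \<in> J \<Longrightarrow> plot MG \<gamma> s"
    and lv: "\<And>s. s \<in> J \<Longrightarrow> left_velocity G MG \<gamma> s \<in> \<mm> - {0}"
    and c: "\<And>s. s \<in> J \<Longrightarrow> c s = \<pi> (\<gamma> s)"
    and Y': "(left_velocity G MG \<gamma> has_vector_derivative Y') (at t)"
  shows "plot (slit_tangent_bundle M) (\<lambda>s. (c s, velocity M c s)) t"
    "velocity M c t = tangent_map M M (\<lambda>x. \<gamma> t \<bullet>\<^sub>M x) H (\<iota> (left_velocity G MG \<gamma> t))"
    "velocity (slit_tangent_bundle M) (\<lambda>s. (c s, velocity M c s)) t = S (c t, velocity M c t) \<longleftrightarrow>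
     Y' = - eta (left_velocity G MG \<gamma> t)"
proof -
  let ?SB = "slit_tangent_bundle M"
  let ?p = "\<lambda>s. \<pi> (\<gamma> s)" and ?Y = "left_velocity G MG \<gamma>"
  have evJ: "\<forall>\<^sub>F s in nhds r. s \<in> J" if "r \<in> J" for r by (rule eventually_nhds_in_open[OF J(1) that])
  have pp: "plot M ?p s" if "s \<in> J" for s by (rule plot_proj[OF \<gamma>[OF that]])
  have cp: "plot M c s" if "s \<in> J" for s
    by (rule plot_cong[OF pp[OF that]]) (use evJ[OF that] in eventually_elim, simp add: c)
  have vel: "velocity M c s = tangent_map M M (\<lambda>x. \<gamma> s \<bullet>\<^sub>M x) H (\<iota> (?Y s))" if s: "s \<in> J" for s
  proof -
    have "dplot M c s = dplot M ?p s" by (rule dplot_cong) (use evJ[OF s] in eventually_elim, simp add: c)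
    then show ?thesis
      using velocity_proj[OF \<gamma>[OF s]] by (simp add: velocity_eq_dplot[OF atlas_M cp[OF s]] velocity_eq_dplot[OF atlas_M pp[OF s]])
  qed
  have car: "\<gamma> s \<in> carrier G" if "s \<in> J" for s by (rule plot_carrier[OF \<gamma>[OF that]])
  show "velocity M c t = tangent_map M M (\<lambda>x. \<gamma> t \<bullet>\<^sub>M x) H (\<iota> (?Y t))" by (rule vel[OF J(2)])
  have vne: "velocity M c s \<noteq> 0" if s: "s \<in> J" for s
    using iota_m_inj[of "?Y s"] lv[OF s] by (auto simp: vel[OF s] tangent_act_eq_0[OF car[OF s] H_top])
  have dne: "dplot M c t 1 \<noteq> 0" using vne[OF J(2)] by (simp add: velocity_eq_dplot[OF atlas_M cp[OF J(2)]])
  have evz: "\<forall>\<^sub>F s in nhds t. tplot M c (s, 1) = (c s, velocity M c s)"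
    using evJ[OF J(2)] by eventually_elim (simp add: tplot_def velocity_eq_dplot[OF atlas_M cp])
  have pt: "plot ?SB (tplot M c) (t, 1)" by (rule plot_tplot[OF atlas_M open_M cp[OF J(2)] dne])
  have line: "smooth_near t (\<lambda>s. (s, 1::real))" by (intro smooth_near_Pair smooth_near_ident smooth_near_const)
  have dline: "fd (\<lambda>s. (s, 1::real)) t = (\<lambda>v. (v, 0))" by (rule fd_eqI) (auto intro!: derivative_eq_intros)
  have pz': "plot ?SB (\<lambda>s. tplot M c (s, 1)) t" by (rule plot_reparam[OF pt line])
  show pz: "plot ?SB (\<lambda>s. (c s, velocity M c s)) t" by (rule plot_cong[OF pz' evz])
  note atlas_SB = smooth_atlas_slit_tangent_bundle[OF atlas_M open_M]
  have "velocity ?SB (\<lambda>s. (c s, velocity M c s)) t = dplot ?SB (\<lambda>s. tplot M c (s, 1)) t 1"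
    by (simp add: velocity_eq_dplot[OF atlas_SB pz] dplot_cong[OF evz])
  also have "\<dots> = dplot ?SB (tplot M c) (t, 1) (1, 0)"
    using dplot_reparam[OF atlas_SB pt line, of 1] by (simp add: dline)
  finally have v: "velocity ?SB (\<lambda>s. (c s, velocity M c s)) t = dplot ?SB (tplot M c) (t, 1) (1, 0)" .
  let ?\<kappa> = "base_chart M (c t)"
  have ct: "c t \<in> (\<Union>\<kappa>\<in>atlas M. fst \<kappa>)" by (rule plot_in_atlas[OF cp[OF J(2)]])
  have k: "?\<kappa> \<in> charts M" "admissible M ?\<kappa>" "c t \<in> fst ?\<kappa>"
    using base_chart[OF ct] atlas_subset_charts[OF M] admissible_atlas[OF atlas_M] by auto
  have i: "\<pi> (\<gamma> t) \<in> fst ?\<kappa>" using k(3) c[OF J(2)] by simp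
  let ?f = "\<lambda>s. snd ?\<kappa> (c s)"
  have sf: "smooth_near t ?f" by (rule plot_chart(2)[OF atlas_M cp[OF J(2)] k(2,3)])
  have f1: "fd ?f t 1 = P ?\<kappa> (\<gamma> t) (?Y t)"
    using comps_dplot[OF atlas_M cp[OF J(2)] k(2,3), of 1] comps_act_iota[OF car[OF J(2)] k(2) i, of "?Y t"]
    unfolding velocity_eq_dplot[OF atlas_M cp[OF J(2)], symmetric] vel[OF J(2)] c[OF J(2)] by simp
  have f2: "fd2 ?f t 1 1 = B ?\<kappa> (\<gamma> t) (?Y t) (?Y t) + P ?\<kappa> (\<gamma> t) Y'"
  proof -
    have "\<forall>\<^sub>F s in nhds t. fd ?f s 1 = comps M ?\<kappa> (\<pi> (\<gamma> s)) (tangent_map M M (\<lambda>x. \<gamma> s \<bullet>\<^sub>M x) H (\<iota> (?Y s)))"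
      using evJ[OF J(2)] plot_chart(1)[OF atlas_M cp[OF J(2)] k(2,3)]
    proof eventually_elim
      case (elim s)
      show ?case
        using comps_dplot[OF atlas_M cp[OF elim(1)] k(2) elim(2), of 1]
        unfolding velocity_eq_dplot[OF atlas_M cp[OF elim(1)], symmetric] vel[OF elim(1)] c[OF elim(1)] by (rule sym)
    qed
    then have "fd (\<lambda>s. fd ?f s 1) t = fd (\<lambda>s. comps M ?\<kappa> (\<pi> (\<gamma> s)) (tangent_map M M (\<lambda>x. \<gamma> s \<bullet>\<^sub>M x) H (\<iota> (?Y s)))) t"
      by (rule fd_cong)
    also have "\<dots> = (\<lambda>v. v *\<^sub>R (B ?\<kappa> (\<gamma> t) (?Y t) (?Y t) + P ?\<kappa> (\<gamma> t) Y'))"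
      by (rule fd_eqI, rule field_derivative[OF \<gamma>[OF J(2)] k(2) i Y', unfolded has_vector_derivative_def])
    finally show ?thesis by simp
  qed
  have inj: "inj_on (snd ?\<kappa>) (fst ?\<kappa>)" using k(2) by (simp add: admissible_def)
  have xin: "?f t \<in> snd ?\<kappa> ` fst ?\<kappa>" using k(3) by blast
  have fne: "fd ?f t 1 \<noteq> 0"
    using comps_dplot[OF atlas_M cp[OF J(2)] k(2,3), of 1] comps_eq_0_iff[OF atlas_M k(2,3), of "dplot M c t 1"] dne by simp
  have z: "tplot M (chart_inv ?\<kappa>) (?f t, fd ?f t 1) = tplot M c (t, 1)"
    using chart_inv_chart[OF inj k(3)] dplot_chart_inv_comps[OF atlas_M k(2,3), of "dplot M c t 1"]
      comps_dplot[OF atlas_M cp[OF J(2)] k(2,3), of 1] by (simp add: tplot_def)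
  have zt: "tplot M c (t, 1) = (c t, velocity M c t)" using eventually_nhds_x_imp_x[OF evz] .
  have zin: "tplot M c (t, 1) \<in> fst (slit_chart M ?\<kappa>)" using k(3) vne[OF J(2)] by (simp add: zt fst_slit_chart)
  have c1: "comps ?SB (slit_chart M ?\<kappa>) (tplot M c (t, 1)) (S (tplot M c (t, 1))) =
      (fd ?f t 1, - 2 *\<^sub>R spray_coeff M S ?\<kappa> (?f t) (fd ?f t 1))"
    using comps_spray[OF M spray k(1) xin fne] by (simp add: z)
  have c2: "comps ?SB (slit_chart M ?\<kappa>) (tplot M c (t, 1)) (dplot ?SB (tplot M c) (t, 1) (1, 0)) =
      (fd ?f t 1, fd2 ?f t 1 1)"
    using comps_slit_tplot[OF atlas_M open_M cp[OF J(2)] dne k(2,3), of 1 0] linear_0[OF smooth_near_linear[OF sf]] by simp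
  have "velocity ?SB (\<lambda>s. (c s, velocity M c s)) t = S (c t, velocity M c t) \<longleftrightarrow>
     dplot ?SB (tplot M c) (t, 1) (1, 0) = S (tplot M c (t, 1))"
    by (simp add: v zt)
  also have "\<dots> \<longleftrightarrow> fd2 ?f t 1 1 = - 2 *\<^sub>R spray_coeff M S ?\<kappa> (?f t) (fd ?f t 1)"
  proof
    assume eq: "dplot ?SB (tplot M c) (t, 1) (1, 0) = S (tplot M c (t, 1))"
    have "(fd ?f t 1, - 2 *\<^sub>R spray_coeff M S ?\<kappa> (?f t) (fd ?f t 1)) = (fd ?f t 1, fd2 ?f t 1 1)"
      using c2 unfolding eq c1 .
    then show "fd2 ?f t 1 1 = - 2 *\<^sub>R spray_coeff M S ?\<kappa> (?f t) (fd ?f t 1)" by (simp only: prod.inject)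
  next
    assume eq: "fd2 ?f t 1 1 = - 2 *\<^sub>R spray_coeff M S ?\<kappa> (?f t) (fd ?f t 1)"
    show "dplot ?SB (tplot M c) (t, 1) (1, 0) = S (tplot M c (t, 1))"
      by (rule comps_inj[OF atlas_SB admissible_slit_chart[OF atlas_M open_M k(2)] zin]) (simp only: c1 c2 eq)
  qed
  also have "\<dots> \<longleftrightarrow> P ?\<kappa> (\<gamma> t) (Y' + eta (?Y t)) = 0"
  proof -
    have "2 *\<^sub>R spray_coeff M S ?\<kappa> (?f t) (fd ?f t 1) + B ?\<kappa> (\<gamma> t) (?Y t) (?Y t) = P ?\<kappa> (\<gamma> t) (eta (?Y t))"
      using spray_coeff_eq_eta[OF car[OF J(2)] k(1) i, of "?Y t"] lv[OF J(2)]
      unfolding f1 unfolding c[OF J(2)] by blast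
    note this[symmetric]
    then have "P ?\<kappa> (\<gamma> t) (Y' + eta (?Y t)) = fd2 ?f t 1 1 + 2 *\<^sub>R spray_coeff M S ?\<kappa> (?f t) (fd ?f t 1)"
      by (simp add: f2 linear_add[OF P_linear[OF car[OF J(2)] k(2) i]] add.commute)
    then show ?thesis by (simp add: eq_neg_iff_add_eq_0)
  qed
  also have "\<dots> \<longleftrightarrow> Y' = - eta (?Y t)"
  proof -
    have "\<forall>\<^sub>F s in nhds t. ?Y s \<in> \<mm>" using evJ[OF J(2)] by eventually_elim (use lv in blast)
    then have "Y' + eta (?Y t) \<in> \<mm>" using m_derivative[OF Y'] eta_in subspace_add[OF subspace_m] by blast
    then have "\<iota> (Y' + eta (?Y t)) = 0 \<longleftrightarrow> Y' + eta (?Y t) = 0"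
      using iota_m_inj linear_0[OF iota_linear] by auto
    then show ?thesis by (simp add: P_eq_0_iff[OF car[OF J(2)] k(2) i] eq_neg_iff_add_eq_0)
  qed
  finally show "velocity ?SB (\<lambda>s. (c s, velocity M c s)) t = S (c t, velocity M c t) \<longleftrightarrow> Y' = - eta (?Y t)" .
qed

end

context homogeneous_spray
begin

section \<open>The spray vector field, the connection operator and the covariant derivative\<close>

text \<open>Instead of solving the geodesic equation on \<open>G/H\<close> and lifting the solution afterwards, one solves for
the lift together with its left velocity. The left velocity is written as \<open>Q v\<close> with an unknown \<open>v\<close> in the
tangent space at the base point, so that it stays in \<open>\<mm>\<close> automatically.\<close>

lemma geodesic_lift_exists:
  assumes y: "y \<in> \<mm>" "y \<noteq> 0"
  obtains J c \<gamma> where "open_interval J" "0 \<in> J" "geodesic M S J c" "c 0 = H"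
    "velocity M c 0 = \<iota> y" "m_lift G MG H \<mm> J c \<gamma>"
    "vector_derivative (left_velocity G MG \<gamma>) (at 0) = - eta y"
proof -
  have iy: "\<iota> y \<noteq> 0" using iota_m_inj y by blast
  \<comment> \<open>The components say that \<open>Q v\<close> is the left velocity and that its derivative is \<open>- eta (Q v)\<close>.\<close>
  define F where "F z = (fd mul_chart (fst z, x0) (0, Q (snd z)), - eta_hat (snd z))" for z :: "'a \<times> 'e"
  define U where "U = snd \<phi> ` fst \<phi> \<times> (UNIV - {0::'e})"
  have U: "open U" unfolding U_def by (intro open_Times open_\<phi>) auto
  have F_smooth: "smooth_near z F" if z: "z \<in> U" for z
  proof -
    have f: "fst z \<in> snd \<phi> ` fst \<phi>" "snd z \<noteq> 0" using z by (auto simp: U_def)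
    have "smooth_near z (\<lambda>z. fd mul_chart (fst z, x0) (0, Q (snd z)))"
      by (rule smooth_near_fd[where q = "\<lambda>z. (fst z, x0)" and r = "\<lambda>z. (0, Q (snd z))"])
         (intro mul_chart_smooth(1) f smooth_near_Pair smooth_near_const smooth_near_fst smooth_near_snd smooth_near_linear_map[OF Q(1)])+
    moreover have "smooth_near z (\<lambda>z. - eta_hat (snd z))"
      by (intro smooth_near_bounded_linear[OF bounded_linear_minus[OF bounded_linear_ident]]
          smooth_near_compose[of snd z eta_hat] eta_hat_smooth f smooth_near_snd)
    ultimately show ?thesis unfolding F_def by (rule smooth_near_Pair)
  qed
  have sF: "smooth_on U F" by (rule smooth_on_local[OF U F_smooth])
  have z0: "(x0, \<iota> y) \<in> U" using x0_in iy by (simp add: U_def)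
  obtain \<epsilon> z where z: "\<epsilon> > 0" "z 0 = (x0, \<iota> y)" "\<And>t. t \<in> {-\<epsilon><..<\<epsilon>} \<Longrightarrow> (z has_vector_derivative F (z t)) (at t)"
    using smooth_ode_local_solution[OF F_smooth[OF z0]] by blast
  have "isCont z 0" using has_vector_derivative_continuous[OF z(3)[of 0]] z(1) by simp
  then have "\<forall>\<^sub>F t in at 0. z t \<in> U"
    using topological_tendstoD[OF _ U] z0 z(2) unfolding isCont_def by metis
  then have "\<forall>\<^sub>F t in nhds 0. z t \<in> U" using z0 z(2) by (simp add: eventually_nhds_conv_at)
  then obtain d where d: "d > 0" "\<And>t. dist t 0 < d \<Longrightarrow> z t \<in> U" unfolding eventually_nhds_metric by blast
  define \<delta> where "\<delta> = min d \<epsilon>"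
  define J where "J = {-\<delta><..<\<delta>}"
  have J: "open_interval J" "open J" "0 \<in> J" using d z by (auto simp: J_def \<delta>_def open_interval_def is_interval_convex)
  have zU: "z t \<in> U" if "t \<in> J" for t using d(2)[of t] that by (auto simp: J_def \<delta>_def dist_real_def)
  have zd: "(z has_vector_derivative F (z t)) (at t)" if "t \<in> J" for t using z(3)[of t] that by (auto simp: J_def \<delta>_def)
  have sz: "smooth_on J z" by (rule smooth_ode_bootstrap[OF J(2) U sF zU zd])
  have nz: "smooth_near t z" if "t \<in> J" for t using smooth_nearI[OF J(2) that sz] .
  define \<gamma> where "\<gamma> t = e (fst (z t))" for t
  define c where "c t = \<pi> (\<gamma> t)" for t
  have fz: "fst (z t) \<in> snd \<phi> ` fst \<phi>" "snd (z t) \<noteq> 0" if "t \<in> J" for t using zU[OF that] by (auto simp: U_def)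
  have sfst: "smooth_near t (\<lambda>t. fst (z t))" if "t \<in> J" for t by (rule smooth_near_bounded_linear[OF bounded_linear_fst nz[OF that]])
  have \<gamma>: "plot MG \<gamma> t" if "t \<in> J" for t
    unfolding \<gamma>_def by (rule plot_reparam[OF plot_e[OF fz(1)[OF that]] sfst[OF that]])
  have car: "\<gamma> t \<in> carrier G" if "t \<in> J" for t by (rule plot_carrier[OF \<gamma>[OF that]])
  have evJ: "\<forall>\<^sub>F s in nhds t. s \<in> J" if "t \<in> J" for t by (rule eventually_nhds_in_open[OF J(2) that])
  have lv: "left_velocity G MG \<gamma> t = Q (snd (z t))" if t: "t \<in> J" for t
  proof -
    have i: "inv\<^bsub>G\<^esub> \<one>\<^bsub>G\<^esub> \<cdot> \<gamma> t \<in> fst \<phi>" using car[OF t] e_in[OF fz(1)[OF t]] by (simp add: \<gamma>_def)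
    have kz: "left_coord \<one>\<^bsub>G\<^esub> \<gamma> s = fst (z s)" if "s \<in> J" for s
      using car[OF that] \<phi>_e[OF fz(1)[OF that]] by (simp add: left_coord_def \<gamma>_def)
    have "fd (left_coord \<one>\<^bsub>G\<^esub> \<gamma>) t = fd (\<lambda>s. fst (z s)) t"
      by (rule fd_cong) (use evJ[OF t] in eventually_elim, rule kz)
    also have "\<dots> = (\<lambda>v. fst (v *\<^sub>R F (z t)))"
      by (rule fd_eqI, rule bounded_linear.has_derivative[OF bounded_linear_fst zd[OF t, unfolded has_vector_derivative_def]])
    finally have "fd (left_coord \<one>\<^bsub>G\<^esub> \<gamma>) t 1 = fd mul_chart (fst (z t), x0) (0, Q (snd (z t)))" by (simp add: F_def)
    then show ?thesis
      using left_velocity_ldiv_chart[OF \<gamma>[OF t] one_closed i] fd_ldiv_chart_mul_chart[OF fz(1)[OF t]] by (simp add: kz[OF t])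
  qed
  have lvm: "left_velocity G MG \<gamma> t \<in> \<mm> - {0}" if t: "t \<in> J" for t
  proof -
    have "Q (snd (z t)) \<noteq> 0" using Q(3)[of "snd (z t)"] fz(2)[OF t] linear_0[OF iota_linear] by auto
    then show ?thesis using Q(2) by (simp add: lv[OF t])
  qed
  have Y': "(left_velocity G MG \<gamma> has_vector_derivative - eta (left_velocity G MG \<gamma> t)) (at t)" if t: "t \<in> J" for t
  proof -
    have "bounded_linear (\<lambda>z. Q (snd z))"
      using bounded_linear_compose[OF linear_conv_bounded_linear[THEN iffD1, OF Q(1)] bounded_linear_snd] .
    from bounded_linear.has_vector_derivative[OF this zd[OF t]]
    have "((\<lambda>s. Q (snd (z s))) has_vector_derivative - eta (left_velocity G MG \<gamma> t)) (at t)"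
      by (simp add: F_def lv[OF t] eta_def Q linear_neg[OF Q(1)])
    then show ?thesis
      by (rule has_vector_derivative_transform_within_open[OF _ J(2) t]) (simp add: lv)
  qed
  note gi = geodesic_equation_iff[OF J(2) _ \<gamma> lvm c_def Y']
  note atlas_SB = smooth_atlas_slit_tangent_bundle[OF atlas_M open_M] and open_SB = open_charts_slit_tangent_bundle[OF atlas_M open_M]
  show thesis
  proof (rule that)
    show "open_interval J" "0 \<in> J" by (fact J)+
    show c0: "c 0 = H" by (simp add: c_def \<gamma>_def z(2) e_x0 proj_one)
    show "m_lift G MG H \<mm> J c \<gamma>"
      unfolding m_lift_def using lvm plot_smooth_curve[OF atlas_G open_G J(2) \<gamma>]
      by (simp add: c_def) (simp add: \<gamma>_def z(2) e_x0)
    have \<gamma>0: "\<gamma> 0 = \<one>\<^bsub>G\<^esub>" by (simp add: \<gamma>_def z(2) e_x0)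
    have lv0: "left_velocity G MG \<gamma> 0 = y" using lv[OF J(3)] z(2) Q(4)[OF y(1)] by simp
    show "velocity M c 0 = \<iota> y"
      using velocity_proj_one[OF \<gamma>[OF J(3)] \<gamma>0] by (simp add: lv0 c_def[abs_def])
    show "vector_derivative (left_velocity G MG \<gamma>) (at 0) = - eta y"
      using vector_derivative_at[OF Y'[OF J(3)]] by (simp add: lv0)
    show "geodesic M S J c"
      unfolding geodesic_def integral_curve_def
    proof (intro conjI ballI)
      show "smooth_curve M J c"
        by (rule plot_smooth_curve[OF atlas_M open_M J(2)]) (auto simp: c_def[abs_def] intro: plot_proj \<gamma>)
      show "smooth_curve (slit_tangent_bundle M) J (\<lambda>t. (c t, velocity M c t))"
        by (rule plot_smooth_curve[OF atlas_SB open_SB J(2)]) (rule gi(1), auto)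
      fix t assume t: "t \<in> J"
      have v: "velocity M c t = tangent_map M M (\<lambda>x. \<gamma> t \<bullet>\<^sub>M x) H (\<iota> (left_velocity G MG \<gamma> t))"
        by (rule gi(2)) (use t in auto)
      show "velocity M c t \<noteq> 0"
        using v lvm[OF t] iota_m_inj tangent_act_eq_0[OF car[OF t] H_top] by auto
      show "velocity (slit_tangent_bundle M) (\<lambda>t. (c t, velocity M c t)) t = S (c t, velocity M c t)"
        by (rule gi(3)[THEN iffD2]) (use t in auto)
    qed
  qed
qed

text \<open>The value does not depend on the geodesic and its lift, because \<open>geodesic_equation_iff\<close> at time \<open>0\<close> expresses
the derivative of the left velocity through its initial value \<open>y\<close>.\<close>

lemma spray_vector_eq_eta:
  assumes y: "y \<in> \<mm>" "y \<noteq> 0"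
  shows "spray_vector G MG H M S \<mm> y = eta y"
  unfolding spray_vector_def
proof (rule the_equality)
  obtain J c \<gamma> where "open_interval J" "0 \<in> J" "geodesic M S J c" "c 0 = H"
    "velocity M c 0 = \<iota> y" "m_lift G MG H \<mm> J c \<gamma>"
    "vector_derivative (left_velocity G MG \<gamma>) (at 0) = - eta y"
    using geodesic_lift_exists[OF y] by blast
  then show "\<exists>J c cbar. open_interval J \<and> 0 \<in> J \<and> geodesic M S J c \<and> c 0 = H \<and>
        velocity M c 0 = \<iota> y \<and> m_lift G MG H \<mm> J c cbar \<and>
        eta y = - vector_derivative (left_velocity G MG cbar) (at 0)"
    by (intro exI[of _ J] exI[of _ c] exI[of _ \<gamma>]) simp
next
  fix z assume "\<exists>J c cbar. open_interval J \<and> 0 \<in> J \<and> geodesic M S J c \<and> c 0 = H \<and>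
        velocity M c 0 = \<iota> y \<and> m_lift G MG H \<mm> J c cbar \<and>
        z = - vector_derivative (left_velocity G MG cbar) (at 0)"
  then obtain J c \<gamma> where J: "open J" "0 \<in> J" and geo: "geodesic M S J c"
    and v0: "velocity M c 0 = \<iota> y" and ml: "m_lift G MG H \<mm> J c \<gamma>"
    and z: "z = - vector_derivative (left_velocity G MG \<gamma>) (at 0)"
    by (auto simp: open_interval_def)
  have \<gamma>: "plot MG \<gamma> t" if "t \<in> J" for t
    using ml smooth_curve_plot_manifold[OF _ J(1) that MG] by (simp add: m_lift_def)
  have lvm: "left_velocity G MG \<gamma> t \<in> \<mm> - {0}" and c: "c t = \<pi> (\<gamma> t)" if "t \<in> J" for t
    using ml that by (auto simp: m_lift_def)
  have \<gamma>0: "\<gamma> 0 = \<one>\<^bsub>G\<^esub>" using ml by (simp add: m_lift_def)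
  let ?Y = "left_velocity G MG \<gamma>"
  have Y': "(?Y has_vector_derivative vector_derivative ?Y (at 0)) (at 0)"
    using smooth_near_differentiable[OF left_velocity_smooth[OF \<gamma>[OF J(2)]]] vector_derivative_works by blast
  have "\<forall>\<^sub>F s in nhds 0. c s = \<pi> (\<gamma> s)"
    using eventually_nhds_in_open[OF J] by eventually_elim (rule c)
  note ce = this
  have pc: "plot M (\<lambda>s. \<pi> (\<gamma> s)) 0" by (rule plot_proj[OF \<gamma>[OF J(2)]])
  have "plot M c 0" by (rule plot_cong[OF pc]) (use ce in eventually_elim, simp)
  then have "velocity M c 0 = \<iota> (?Y 0)"
    using velocity_proj_one[OF \<gamma>[OF J(2)] \<gamma>0] dplot_cong[OF ce, of M]
    by (simp add: velocity_eq_dplot[OF atlas_M] pc)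
  then have "?Y 0 = y" using v0 Q(4) lvm[OF J(2)] y by (metis DiffD1)
  moreover have "vector_derivative ?Y (at 0) = - eta (?Y 0)"
    using geodesic_equation_iff(3)[OF J \<gamma> lvm c Y'] geo J(2) by (simp add: geodesic_def integral_curve_def)
  ultimately show "z = eta y" using z by simp
qed

lemma conn_op_eq:
  assumes y: "y \<in> \<mm>" "y \<noteq> 0" and w: "w \<in> \<mm>"
  shows "conn_op G MG H M S \<mm> y w = (1/2) *\<^sub>R fd eta y w - (1/2) *\<^sub>R bracket_m G MG H \<mm> y w"
    "fd eta y w \<in> \<mm>"
proof -
  have iy: "\<iota> y \<noteq> 0" using iota_m_inj y by blast
  have line: "((\<lambda>t. y + t *\<^sub>R w) has_derivative (\<lambda>t. t *\<^sub>R w)) (at (0::real))"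
    by (auto intro!: derivative_eq_intros)
  have d: "((\<lambda>t. eta (y + t *\<^sub>R w)) has_vector_derivative fd eta y w) (at (0::real))"
    using diff_chain_at[OF line, of eta "fd eta y"] smooth_near_has_derivative[OF eta_smooth[OF iy]]
      linear_scale[OF smooth_near_linear[OF eta_smooth[OF iy]]]
    by (simp add: has_vector_derivative_def o_def)
  have "isCont (\<lambda>t::real. y + t *\<^sub>R w) 0" by (intro continuous_intros)
  then have "\<forall>\<^sub>F t in at (0::real). y + t *\<^sub>R w \<noteq> 0"
    unfolding isCont_def using y(2) by (intro tendsto_imp_eventually_ne) auto
  then have "\<forall>\<^sub>F t in nhds (0::real). y + t *\<^sub>R w \<noteq> 0" using y(2) by (simp add: eventually_nhds_conv_at)
  then obtain T where T: "open T" "(0::real) \<in> T" "\<And>t. t \<in> T \<Longrightarrow> y + t *\<^sub>R w \<noteq> 0" by (auto simp: eventually_nhds)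
  have inm: "y + t *\<^sub>R w \<in> \<mm>" for t using subspace_m y w by (simp add: subspace_add subspace_scale)
  have "((\<lambda>t. spray_vector G MG H M S \<mm> (y + t *\<^sub>R w)) has_vector_derivative fd eta y w) (at (0::real))"
    by (rule has_vector_derivative_transform_within_open[OF d T(1,2)]) (simp add: spray_vector_eq_eta[OF inm T(3)])
  from vector_derivative_at[OF this]
  show "conn_op G MG H M S \<mm> y w = (1/2) *\<^sub>R fd eta y w - (1/2) *\<^sub>R bracket_m G MG H \<mm> y w"
    by (simp add: conn_op_def)
  show "fd eta y w \<in> \<mm>" by (rule m_derivative[OF d]) (simp add: eta_in)
qed

text \<open>The field \<open>w\<close> is recovered from \<open>W\<close> by the tangent map of the action of \<open>\<gamma>(s)\<inverse>\<close>. In coordinates this is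
the \<open>x\<close>-derivative of the smooth function \<open>f (s, x)\<close> below, applied to the components of \<open>W\<close>, and
therefore smooth in \<open>s\<close>.\<close>

lemma moving_frame_smooth:
  assumes J: "open J" "t \<in> J" and c: "smooth_curve M J c" and \<gamma>: "plot MG \<gamma> t"
    and lift: "\<And>s. s \<in> J \<Longrightarrow> c s = \<pi> (\<gamma> s)"
    and W: "smooth_field_along M J c W"
    and w: "\<And>s. s \<in> J \<Longrightarrow> w s \<in> \<mm>"
    and Ww: "\<And>s. s \<in> J \<Longrightarrow> W s = tangent_map M M (\<lambda>x. \<gamma> s \<bullet>\<^sub>M x) H (\<iota> (w s))"
  shows "smooth_near t w"
proof -
  let ?\<kappa> = "base_chart M (c t)"
  have pc: "plot M c t" by (rule smooth_curve_plot_manifold[OF c J M])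
  have k: "?\<kappa> \<in> atlas M" "c t \<in> fst ?\<kappa>" using base_chart[OF plot_in_atlas[OF pc]] by auto
  have ak: "admissible M ?\<kappa>" by (rule admissible_atlas[OF atlas_M k(1)])
  note ck = plot_chart[OF atlas_M pc ak k(2)]
  define b where "b s = comps M ?\<kappa> (c s) (W s)" for s
  have evJ: "\<forall>\<^sub>F s in nhds t. s \<in> J" by (rule eventually_nhds_in_open[OF J])
  have sb: "smooth_near t b"
  proof -
    let ?D = "snd (J, id::real\<Rightarrow>real) ` (fst (J, id::real\<Rightarrow>real) \<inter> (\<lambda>s. (c s, W s)) -` fst (tangent_chart M ?\<kappa>))"
    have "smooth_on ?D (snd (tangent_chart M ?\<kappa>) \<circ> (\<lambda>s. (c s, W s)) \<circ> chart_inv (J, id))"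
      using W k(1) unfolding smooth_field_along_def smooth_curve_def smooth_map_def
      by (auto simp: euclid_def tangent_bundle_def)
    moreover have "\<forall>\<^sub>F s in nhds t. s \<in> ?D"
      using evJ ck(1) by eventually_elim (auto simp: tangent_chart_def)
    then obtain T where T: "open T" "t \<in> T" "T \<subseteq> ?D" unfolding eventually_nhds by blast
    ultimately have "smooth_near t (snd (tangent_chart M ?\<kappa>) \<circ> (\<lambda>s. (c s, W s)) \<circ> chart_inv (J, id))"
      by (intro smooth_nearI[OF T(1,2)]) (rule smooth_on_subset)
    then have "smooth_near t (\<lambda>s. snd ((snd (tangent_chart M ?\<kappa>) \<circ> (\<lambda>s. (c s, W s)) \<circ> chart_inv (J, id)) s))"
      by (rule smooth_near_bounded_linear[OF bounded_linear_snd])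
    then show ?thesis
    proof (rule smooth_near_cong)
      show "\<forall>\<^sub>F s in nhds t. snd ((snd (tangent_chart M ?\<kappa>) \<circ> (\<lambda>s. (c s, W s)) \<circ> chart_inv (J, id)) s) = b s"
        using evJ
      proof eventually_elim
        case (elim s)
        have "chart_inv (J, id) s = s" using chart_inv_chart[of "(J, id)" s] elim by simp
        then show ?case by (simp add: b_def tangent_chart_def)
      qed
    qed
  qed
  define f where "f z = snd \<beta> (inv\<^bsub>G\<^esub> (\<gamma> (fst z)) \<bullet>\<^sub>M chart_inv ?\<kappa> (snd z))" for z
  define x where "x s = snd ?\<kappa> (c s)" for s
  have inj: "inj_on (snd ?\<kappa>) (fst ?\<kappa>)" using ak by (simp add: admissible_def)
  have ix: "chart_inv ?\<kappa> (x s) = c s" "x s \<in> snd ?\<kappa> ` fst ?\<kappa>" if "c s \<in> fst ?\<kappa>" for s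
    using that chart_inv_chart[OF inj that] by (auto simp: x_def)
  have to_H: "inv\<^bsub>G\<^esub> (\<gamma> s) \<bullet>\<^sub>M c s = H" if "s \<in> J" "plot MG \<gamma> s" for s
    using act_inv_act[OF plot_carrier[OF that(2)] H_top] lift[OF that(1)] by simp
  have fplot: "plot M (\<lambda>z. inv\<^bsub>G\<^esub> (\<gamma> (fst z)) \<bullet>\<^sub>M chart_inv ?\<kappa> (snd z)) (s, x s)"
    if s: "plot MG \<gamma> s" "c s \<in> fst ?\<kappa>" for s
  proof (rule plot_act_plot)
    show "plot MG (\<lambda>z. inv\<^bsub>G\<^esub> (\<gamma> (fst z))) (s, x s)"
      by (intro plot_inv plot_reparam[of MG \<gamma> fst] smooth_near_fst) (simp add: s)
    show "plot M (\<lambda>z. chart_inv ?\<kappa> (snd z)) (s, x s)"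
      by (rule plot_reparam[of M "chart_inv ?\<kappa>" snd, OF _ smooth_near_snd]) (simp add: plot_chart_inv[OF atlas_M ak ix(2)[OF s(2)]])
  qed
  have fs: "smooth_near (s, x s) f" if s: "s \<in> J" "plot MG \<gamma> s" "c s \<in> fst ?\<kappa>" for s
    using plot_chart(2)[OF atlas_M fplot[OF s(2,3)] \<beta>(3)] \<beta>(2) to_H[OF s(1,2)] by (simp add: f_def[abs_def] ix(1)[OF s(3)])
  have "smooth_near t (\<lambda>s. Q (fd f (s, x s) (0, b s)))"
    by (intro smooth_near_linear_map[OF Q(1)] smooth_near_fd[where q = "\<lambda>s. (s, x s)" and r = "\<lambda>s. (0, b s)"]
        fs J(2) \<gamma> k(2) smooth_near_Pair smooth_near_ident smooth_near_const sb)
      (use ck(2) in \<open>simp add: x_def[abs_def]\<close>)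
  then show ?thesis
  proof (rule smooth_near_cong)
    show "\<forall>\<^sub>F s in nhds t. Q (fd f (s, x s) (0, b s)) = w s"
      using evJ ck(1) plot_eventually[OF \<gamma>]
    proof eventually_elim
      case (elim s)
      have g: "\<gamma> s \<in> carrier G" by (rule plot_carrier[OF elim(3)])
      let ?i = "chart_inv ?\<kappa>"
      have pl: "plot M ?i (x s)" by (rule plot_chart_inv[OF atlas_M ak ix(2)[OF elim(2)]])
      have Wd: "W s = dplot M ?i (x s) (b s)"
        unfolding b_def x_def by (rule dplot_chart_inv_comps[OF atlas_M ak elim(2), symmetric])
      have "\<iota> (w s) = tangent_map M M (\<lambda>x. inv\<^bsub>G\<^esub> (\<gamma> s) \<bullet>\<^sub>M x) (c s) (W s)"
        using tangent_act_inverse[OF g H_top, of "\<iota> (w s)"] Ww[OF elim(1)] lift[OF elim(1)] by simp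
      also have "\<dots> = dplot M (\<lambda>x. inv\<^bsub>G\<^esub> (\<gamma> s) \<bullet>\<^sub>M ?i x) (x s) (b s)"
        using tangent_map_dplot[OF atlas_M atlas_M pl smooth_at_act, of "inv\<^bsub>G\<^esub> (\<gamma> s)" "b s"] g plot_top[OF pl]
        by (simp add: ix(1)[OF elim(2)] Wd)
      also have "\<dots> = fd (\<lambda>x. f (s, x)) (x s) (b s)"
        by (simp add: dplot_def f_def ix(1)[OF elim(2)] to_H[OF elim(1,3)])
      also have "\<dots> = fd f (s, x s) (0, b s)" by (rule fd_partial_snd[OF fs[OF elim(1,3,2)]])
      finally show ?case using Q(4)[OF w[OF elim(1)]] by simp
    qed
  qed
qed

text \<open>Components in a single chart determine a tangent vector.\<close>

lemma lin_cov_deriv_eqI: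
  assumes p: "c t \<in> topspace (mtop M)"
    and Z: "\<And>\<kappa>. \<kappa> \<in> charts M \<Longrightarrow> c t \<in> fst \<kappa> \<Longrightarrow> comps M \<kappa> (c t) Z =
          vector_derivative (\<lambda>s. comps M \<kappa> (c s) (X s)) (at t) +
          nonlin_conn M S \<kappa> (snd \<kappa> (c t)) (comps M \<kappa> (c t) (velocity M c t)) (comps M \<kappa> (c t) (X t))"
  shows "lin_cov_deriv M S c X t = Z"
  unfolding lin_cov_deriv_def
proof (rule the_equality)
  show "\<forall>\<kappa>\<in>charts M. c t \<in> fst \<kappa> \<longrightarrow> comps M \<kappa> (c t) Z =
          vector_derivative (\<lambda>s. comps M \<kappa> (c s) (X s)) (at t) +
          nonlin_conn M S \<kappa> (snd \<kappa> (c t)) (comps M \<kappa> (c t) (velocity M c t)) (comps M \<kappa> (c t) (X t))"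
    using Z by blast
  fix Z' assume Z': "\<forall>\<kappa>\<in>charts M. c t \<in> fst \<kappa> \<longrightarrow> comps M \<kappa> (c t) Z' =
          vector_derivative (\<lambda>s. comps M \<kappa> (c s) (X s)) (at t) +
          nonlin_conn M S \<kappa> (snd \<kappa> (c t)) (comps M \<kappa> (c t) (velocity M c t)) (comps M \<kappa> (c t) (X t))"
  let ?b = "base_chart M (c t)"
  have p': "c t \<in> (\<Union>\<kappa>\<in>atlas M. fst \<kappa>)" using cover_M p by blast
  have b: "?b \<in> charts M" "admissible M ?b" "c t \<in> fst ?b"
    using base_chart[OF p'] atlas_subset_charts[OF M] admissible_atlas[OF atlas_M] by auto
  show "Z' = Z" by (rule comps_inj[OF atlas_M b(2,3)]) (use Z[OF b(1,3)] Z' b in simp)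
qed

end

theorem theoremC:
  fixes G :: "('g, 'z) monoid_scheme"
    and MG :: "('g, 'a::euclidean_space) manifold"
    and H :: "'g set"
    and M :: "('g set, 'e::euclidean_space) manifold"
    and S :: "'g set \<times> 'e \<Rightarrow> 'e \<times> 'e"
    and \<mm> :: "'a set"
    and J :: "real set"
    and c :: "real \<Rightarrow> 'g set"
    and cbar :: "real \<Rightarrow> 'g"
    and y w :: "real \<Rightarrow> 'a"
    and W :: "real \<Rightarrow> 'e"
  assumes "homogeneous_spray_manifold G MG H M S"
    and "linear_decomposition G MG H \<mm>"
    and "open_interval J" and "0 \<in> J"
    and "smooth_curve M J c" and "c 0 = H"
    and "\<forall>t\<in>J. velocity M c t \<noteq> 0"
    and "m_lift G MG H \<mm> J c cbar"
    and "\<forall>t\<in>J. y t = left_velocity G MG cbar t"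
    and "smooth_field_along M J c W"
    and "\<forall>t\<in>J. w t \<in> \<mm>"
    and "\<forall>t\<in>J. W t = tangent_map M M (\<lambda>x. cbar t <#\<^bsub>G\<^esub> x) H (iota G MG H M (w t))"
  shows "(\<forall>t\<in>J. lin_cov_deriv M S c W t =
            tangent_map M M (\<lambda>x. cbar t <#\<^bsub>G\<^esub> x) H
              (iota G MG H M
                (vector_derivative w (at t) + conn_op G MG H M S \<mm> (y t) (w t)
                  + bracket_m G MG H \<mm> (y t) (w t)))) \<and>
         (linearly_parallel M S J c W \<longleftrightarrow>
            (\<forall>t\<in>J. vector_derivative w (at t) + conn_op G MG H M S \<mm> (y t) (w t)
                  + bracket_m G MG H \<mm> (y t) (w t) = 0))"
proof -
  interpret homogeneous_spray G MG H M S \<mm>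
    using assms(1,2) by unfold_locales (auto simp: homogeneous_spray_manifold_def)
  have J: "open J" using assms(3) by (simp add: open_interval_def)
  define E where "E t = vector_derivative w (at t) + conn_op G MG H M S \<mm> (y t) (w t)
                  + bracket_m G MG H \<mm> (y t) (w t)" for t
  have main: "lin_cov_deriv M S c W t = tangent_map M M (\<lambda>x. cbar t <#\<^bsub>G\<^esub> x) H (iota G MG H M (E t))
      \<and> E t \<in> \<mm> \<and> cbar t \<in> carrier G"
    if t: "t \<in> J" for t
  proof -
    have \<gamma>: "plot MG cbar s" if "s \<in> J" for s
      using assms(8) smooth_curve_plot_manifold[OF _ J that MG] by (simp add: m_lift_def)
    have ys: "y s \<in> \<mm>" "y s \<noteq> 0" "y s = left_velocity G MG cbar s" and lift: "c s = cbar s <#\<^bsub>G\<^esub> H" if "s \<in> J" for s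
      using assms(8,9) that by (auto simp: m_lift_def)
    have wm: "w s \<in> \<mm>" if "s \<in> J" for s using assms(11) that by blast
    have Ww: "W s = tangent_map M M (\<lambda>x. cbar s <#\<^bsub>G\<^esub> x) H (iota G MG H M (w s))" if "s \<in> J" for s
      using assms(12) that by blast
    let ?w' = "vector_derivative w (at t)"
    have w': "(w has_vector_derivative ?w') (at t)"
      using smooth_near_differentiable[OF moving_frame_smooth[OF J t assms(5) \<gamma>[OF t] lift assms(10) wm Ww]]
        vector_derivative_works by blast
    have evJ: "\<forall>\<^sub>F s in nhds t. s \<in> J" by (rule eventually_nhds_in_open[OF J t])
    have w'm: "?w' \<in> \<mm>" by (rule m_derivative[OF w']) (use evJ in eventually_elim, rule wm)
    note co = conn_op_eq[OF ys(1,2)[OF t] wm[OF t]]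
    have Em: "E t \<in> \<mm>"
      unfolding E_def co(1)
      by (intro subspace_add subspace_diff subspace_scale subspace_m w'm co(2) bracket_m_in)
    have car: "cbar t \<in> carrier G" by (rule plot_carrier[OF \<gamma>[OF t]])
    have vel: "velocity M c t = tangent_map M M (\<lambda>x. cbar t <#\<^bsub>G\<^esub> x) H (iota G MG H M (y t))"
    proof -
      have pc: "plot M (\<lambda>s. cbar s <#\<^bsub>G\<^esub> H) t" by (rule plot_proj[OF \<gamma>[OF t]])
      have ce: "\<forall>\<^sub>F s in nhds t. cbar s <#\<^bsub>G\<^esub> H = c s" using evJ by eventually_elim (simp add: lift)
      have "velocity M c t = velocity M (\<lambda>s. cbar s <#\<^bsub>G\<^esub> H) t"
        by (simp add: velocity_eq_dplot[OF atlas_M plot_cong[OF pc ce]] velocity_eq_dplot[OF atlas_M pc] dplot_cong[OF ce])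
      then show ?thesis using velocity_proj[OF \<gamma>[OF t]] ys(3)[OF t] by simp
    qed
    have "lin_cov_deriv M S c W t = tangent_map M M (\<lambda>x. cbar t <#\<^bsub>G\<^esub> x) H (iota G MG H M (E t))"
    proof (rule lin_cov_deriv_eqI)
      show "c t \<in> topspace (mtop M)" by (rule plot_top[OF smooth_curve_plot_manifold[OF assms(5) J t M]])
      fix \<kappa> assume \<kappa>: "\<kappa> \<in> charts M" "c t \<in> fst \<kappa>"
      have ak: "admissible M \<kappa>" by (rule admissible_charts[OF M \<kappa>(1)])
      have i: "cbar t <#\<^bsub>G\<^esub> H \<in> fst \<kappa>" using \<kappa>(2) lift[OF t] by simp
      let ?P = "P \<kappa> (cbar t)" and ?B = "B \<kappa> (cbar t)"
      note ci = comps_act_iota[OF car ak i]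
      have "((\<lambda>s. comps M \<kappa> (c s) (W s)) has_vector_derivative ?B (y t) (w t) + ?P ?w') (at t)"
        by (rule has_vector_derivative_transform_within_open[OF field_derivative[OF \<gamma>[OF t] ak i w', folded ys(3)[OF t]] J t])
           (simp add: lift Ww)
      then have 1: "vector_derivative (\<lambda>s. comps M \<kappa> (c s) (W s)) (at t) = ?B (y t) (w t) + ?P ?w'"
        by (rule vector_derivative_at)
      have 2: "nonlin_conn M S \<kappa> (snd \<kappa> (c t)) (comps M \<kappa> (c t) (velocity M c t)) (comps M \<kappa> (c t) (W t)) =
          (1/2) *\<^sub>R (?P (fd eta (y t) (w t)) - (?B (y t) (w t) + ?B (w t) (y t)))"
        unfolding vel Ww[OF t] lift[OF t] ci by (rule nonlin_conn_eq[OF car \<kappa>(1) i ys(1,2)[OF t] wm[OF t]])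
      have 3: "?P (bracket_m G MG H \<mm> (y t) (w t)) = ?B (y t) (w t) - ?B (w t) (y t)"
        by (simp add: P_bracket_m[OF car ak i] B_antisym[OF car ak i])
      have "?P (E t) = ?P ?w' + (1/2) *\<^sub>R ?P (fd eta (y t) (w t)) + (1/2) *\<^sub>R ?P (bracket_m G MG H \<mm> (y t) (w t))"
      proof -
        have "E t = ?w' + (1/2) *\<^sub>R fd eta (y t) (w t) + (1/2) *\<^sub>R bracket_m G MG H \<mm> (y t) (w t)"
          unfolding E_def co(1) by (simp add: algebra_simps flip: scaleR_left.add)
        then show ?thesis using P_linear[OF car ak i] by (simp add: linear_add linear_scale)
      qed
      also have "\<dots> = (?B (y t) (w t) + ?P ?w') + (1/2) *\<^sub>R (?P (fd eta (y t) (w t)) - (?B (y t) (w t) + ?B (w t) (y t)))"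
        unfolding 3 by (simp add: algebra_simps flip: scaleR_left.add)
      finally show "comps M \<kappa> (c t) (tangent_map M M (\<lambda>x. cbar t <#\<^bsub>G\<^esub> x) H (iota G MG H M (E t))) =
          vector_derivative (\<lambda>s. comps M \<kappa> (c s) (W s)) (at t) +
          nonlin_conn M S \<kappa> (snd \<kappa> (c t)) (comps M \<kappa> (c t) (velocity M c t)) (comps M \<kappa> (c t) (W t))"
        unfolding 1 2 by (simp only: lift[OF t] ci)
    qed
    then show ?thesis using Em car by blast
  qed
  have "lin_cov_deriv M S c W t = 0 \<longleftrightarrow> E t = 0" if t: "t \<in> J" for t
    using main[OF t] iota_m_inj[of "E t"] linear_0[OF iota_linear] by (auto simp: tangent_act_eq_0[OF _ H_top])
  then show ?thesis
    using main unfolding linearly_parallel_def E_def by blast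
qed

end
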